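(* Let $\mathcal C$ be a braided monoidal category with braiding $\Phi$ and let $H\in\mathcal C$ be a finite Hopf algebra with a bijective antipode. Suppose that $\Phi_{H,M}$ is symmetric, i.e. $\Phi_{H,M}=\Phi_{M,H}^{-1}$, for all $M\in{}_H\mathcal{YD}(\mathcal C)^{H^{op}}$. Then the category ${}_H\mathcal{YD}(\mathcal C)^{H^{op}}$ (with braiding $\Phi^{1+}$) and the category ${}_{D(H)}\mathcal C$ of left modules over the Drinfel'd double $D(H)=(H^{op})^*\bowtie H$ (with braiding $\Psi$) are isomorphic as braided monoidal categories.
   Context: $\mathcal C$ is taken strict. $H$ has multiplication $\nabla$, unit $\eta$, comultiplication $\Delta$, counit $\varepsilon$, antipode $S$. An object name also denotes its identity morphism; composition is written by juxtaposition. $H$ is finite if $[H,I]$, $[H,H]$ exist and the dual basis morphism $H\otimes[H,I]\to[H,H]$ is an isomorphism; then $H^*=[H,I]$ is a left dual of $H$ with evaluation $ev:H^*\otimes H\to I$ and dual basis morphism $d:I\to H\otimes H^*$. Put $\overline{ev}=ev\,\Phi_{H,H^*}:H\otimes H^*\to I$. A left-right Yetter-Drinfel'd module over $H$ is a left $H$-module $(M,\mu_M)$ and right $H$-comodule $(M,\rho_M)$ in $\mathcal C$ with $(M\otimes\nabla)(\rho_M\otimes H)\Phi_{M,H}^{-1}(H\otimes\mu_M)(\Delta\otimes M)=(\mu_M\otimes\nabla)(H\otimes\Phi_{H,M}\otimes H)(\Delta\otimes\rho_M)$. ${}_H\mathcal{YD}(\mathcal C)^{H^{op}}$ is the category of these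 with left $H$-linear, right $H$-colinear morphisms; $M\otimes N$ carries the action $(\mu_M\otimes\mu_N)(H\otimes\Phi_{H,M}\otimes N)(\Delta\otimes M\otimes N)$ and the coaction $(M\otimes N\otimes\nabla\Phi_{H,H})(M\otimes\Phi_{H,N}\otimes H)(\rho_M\otimes\rho_N)$. Its braiding is $\Phi^{1+}_{M,N}=(N\otimes\mu_M)(\rho_N\otimes M)\Phi_{M,N}$. (Since every object of $\mathcal C$ is a Yetter-Drinfel'd module with trivial action and coaction, the symmetricity hypothesis amounts to $\Phi_{H,M}=\Phi_{M,H}^{-1}$ for all $M\in\mathcal C$.) Drinfel'd double. $H^{op}$ is $H$ with multiplication $\nabla\Phi_{H,H}$. $B=(H^{op})^*$ is the object $H^*$ with multiplication given by $ev(\nabla_B\otimes H)=(ev\otimes ev)(H^*\otimes\Phi_{H^*,H}\otimes H)(H^*\otimes H^*\otimes\Delta)$, comultiplication given by $(ev\otimes ev)(H^*\otimes\Phi_{H^*,H}\otimes H)(\Delta_B\otimes H\otimes H)=ev(H^*\otimes\nabla\Phi_{H,H})$, unit given by $ev(\eta_B\otimes H)=\varepsilon$ and counit $ev(H^*\otimes\eta)$. Define $\triangleright:H\otimes B\to B$ by $\overline{ev}(H\otimes\triangleright)=\overline{ev}\big(\nabla\Phi_{H,H}(\nabla\otimes S^{-1})(H\otimes\Delta)\otimes B\big)$ and $\triangleleft:H\otimes B\to H$ by $\triangleleft=(H\otimes\overline{ev})(H\otimes\nabla\Phi_{H,H}\otimes B)(\Phi_{H,H}^{-1}\otimes S^{-1}\otimes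 B)((\Delta\otimes H)\Delta\otimes B)$. Then $D(H)=B\bowtie H$ is the object $B\otimes H$ with unit $\eta_B\otimes\eta$, counit $\varepsilon_B\otimes\varepsilon$, comultiplication $(B\otimes\Phi_{B,H}\otimes H)(\Delta_B\otimes\Delta)$ and multiplication $(\nabla_B\otimes\nabla)(B\otimes\triangleright\otimes\triangleleft\otimes H)(B\otimes H\otimes\Phi_{H,B}\otimes B\otimes H)(B\otimes\Delta\otimes\Delta_B\otimes H)$; it is a Hopf algebra in $\mathcal C$. ${}_{D(H)}\mathcal C$ is the monoidal category of left $D(H)$-modules; $H$ and $H^*=B$ act on its objects via $\eta_B\otimes H$ and $B\otimes\eta$; write $\mu$ for the $H$-actions and $\mu^*$ for the $H^*$-actions. The braiding on ${}_{D(H)}\mathcal C$ is $\Psi_{M,N}=\Phi_{M,N}(\mu_M\otimes\mu^*_N)(H\otimes\Phi_{H^*,M}\otimes N)(d\otimes M\otimes N)$. *)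

theory Defs
  imports Main
begin

section \<open>Strict braided monoidal categories\<close>

text \<open>
  Juxtaposition of morphisms is written \<open>g \<cdot> f\<close> (first \<open>f\<close>, then \<open>g\<close>) and binds weaker than the
  tensor product \<open>\<otimes>\<close> of morphisms; \<open>\<boxtimes>\<close> is the tensor product of objects and
  \<open>\<langle>X\<rangle>\<close> the identity morphism of \<open>X\<close>.
\<close>

record ('o, 'a) braided_cat =
  Obj   :: "'o set"
  Arr   :: "'a set"
  src   :: "'a \<Rightarrow> 'o"
  tgt   :: "'a \<Rightarrow> 'o"
  ident :: "'o \<Rightarrow> 'a"  ("\<langle>_\<rangle>\<index>")
  cmp   :: "'a \<Rightarrow> 'a \<Rightarrow> 'a"  (infixr "\<cdot>\<index>" 60)
  tobj  :: "'o \<Rightarrow> 'o \<Rightarrow> 'o"  (infixr "\<boxtimes>\<index>" 70)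
  tarr  :: "'a \<Rightarrow> 'a \<Rightarrow> 'a"  (infixr "\<otimes>\<index>" 70)
  uobj  :: "'o"  ("\<I>\<index>")
  braid :: "'o \<Rightarrow> 'o \<Rightarrow> 'a"  ("\<Phi>\<index>")

definition Hom :: "('o, 'a, 'x) braided_cat_scheme \<Rightarrow> 'o \<Rightarrow> 'o \<Rightarrow> 'a set"  ("Hom\<index>") where
  "Hom\<^bsub>C\<^esub> X Y = {f \<in> Arr C. src C f = X \<and> tgt C f = Y}"

definition inverses ::
    "('o, 'a, 'x) braided_cat_scheme \<Rightarrow> 'a \<Rightarrow> 'a \<Rightarrow> bool" where
  "inverses C f g \<longleftrightarrow> f \<in> Arr C \<and> g \<in> Hom\<^bsub>C\<^esub> (tgt C f) (src C f)
     \<and> g \<cdot>\<^bsub>C\<^esub> f = \<langle>src C f\<rangle>\<^bsub>C\<^esub> \<and> f \<cdot>\<^bsub>C\<^esub> g = \<langle>tgt C f\<rangle>\<^bsub>C\<^esub>"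

definition is_iso :: "('o, 'a, 'x) braided_cat_scheme \<Rightarrow> 'a \<Rightarrow> bool" where
  "is_iso C f \<longleftrightarrow> (\<exists>g. inverses C f g)"

definition arr_inv :: "('o, 'a, 'x) braided_cat_scheme \<Rightarrow> 'a \<Rightarrow> 'a"  ("inv\<index> _" [81] 80) where
  "inv\<^bsub>C\<^esub> f = (THE g. inverses C f g)"

locale small_category =
  fixes C :: "('o, 'a, 'x) braided_cat_scheme" (structure)
  assumes src_obj: "f \<in> Arr C \<Longrightarrow> src C f \<in> Obj C"
    and tgt_obj: "f \<in> Arr C \<Longrightarrow> tgt C f \<in> Obj C"
    and ident_hom: "X \<in> Obj C \<Longrightarrow> \<langle>X\<rangle> \<in> Hom X X"
    and cmp_hom: "\<lbrakk>f \<in> Hom X Y; g \<in> Hom Y Z\<rbrakk> \<Longrightarrow> g \<cdot> f \<in> Hom X Z"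
    and cmp_ident_right: "f \<in> Hom X Y \<Longrightarrow> f \<cdot> \<langle>X\<rangle> = f"
    and cmp_ident_left: "f \<in> Hom X Y \<Longrightarrow> \<langle>Y\<rangle> \<cdot> f = f"
    and cmp_assoc: "\<lbrakk>f \<in> Hom X Y; g \<in> Hom Y Z; h \<in> Hom Z W\<rbrakk> \<Longrightarrow> (h \<cdot> g) \<cdot> f = h \<cdot> (g \<cdot> f)"

locale strict_monoidal_category = small_category +
  assumes unit_obj: "\<I> \<in> Obj C"
    and tobj_obj: "\<lbrakk>X \<in> Obj C; Y \<in> Obj C\<rbrakk> \<Longrightarrow> X \<boxtimes> Y \<in> Obj C"
    and tarr_hom: "\<lbrakk>f \<in> Hom X Y; g \<in> Hom Z W\<rbrakk> \<Longrightarrow> f \<otimes> g \<in> Hom (X \<boxtimes> Z) (Y \<boxtimes> W)"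
    and tarr_ident: "\<lbrakk>X \<in> Obj C; Y \<in> Obj C\<rbrakk> \<Longrightarrow> \<langle>X\<rangle> \<otimes> \<langle>Y\<rangle> = \<langle>X \<boxtimes> Y\<rangle>"
    and interchange: "\<lbrakk>f \<in> Hom X Y; f' \<in> Hom Y Z; g \<in> Hom U V; g' \<in> Hom V W\<rbrakk>
          \<Longrightarrow> (f' \<otimes> g') \<cdot> (f \<otimes> g) = (f' \<cdot> f) \<otimes> (g' \<cdot> g)"
    and tobj_assoc: "\<lbrakk>X \<in> Obj C; Y \<in> Obj C; Z \<in> Obj C\<rbrakk> \<Longrightarrow> (X \<boxtimes> Y) \<boxtimes> Z = X \<boxtimes> (Y \<boxtimes> Z)"
    and tobj_unit_left: "X \<in> Obj C \<Longrightarrow> \<I> \<boxtimes> X = X"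
    and tobj_unit_right: "X \<in> Obj C \<Longrightarrow> X \<boxtimes> \<I> = X"
    and tarr_assoc: "\<lbrakk>f \<in> Arr C; g \<in> Arr C; h \<in> Arr C\<rbrakk> \<Longrightarrow> (f \<otimes> g) \<otimes> h = f \<otimes> (g \<otimes> h)"
    and tarr_unit_left: "f \<in> Arr C \<Longrightarrow> \<langle>\<I>\<rangle> \<otimes> f = f"
    and tarr_unit_right: "f \<in> Arr C \<Longrightarrow> f \<otimes> \<langle>\<I>\<rangle> = f"

locale strict_braided_category = strict_monoidal_category +
  assumes braid_hom: "\<lbrakk>X \<in> Obj C; Y \<in> Obj C\<rbrakk> \<Longrightarrow> \<Phi> X Y \<in> Hom (X \<boxtimes> Y) (Y \<boxtimes> X)"
    and braid_iso: "\<lbrakk>X \<in> Obj C; Y \<in> Obj C\<rbrakk> \<Longrightarrow> is_iso C (\<Phi> X Y)"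
    and braid_natural: "\<lbrakk>f \<in> Hom X Y; g \<in> Hom Z W\<rbrakk> \<Longrightarrow> \<Phi> Y W \<cdot> (f \<otimes> g) = (g \<otimes> f) \<cdot> \<Phi> X Z"
    and hexagon_right: "\<lbrakk>X \<in> Obj C; Y \<in> Obj C; Z \<in> Obj C\<rbrakk>
          \<Longrightarrow> \<Phi> X (Y \<boxtimes> Z) = (\<langle>Y\<rangle> \<otimes> \<Phi> X Z) \<cdot> (\<Phi> X Y \<otimes> \<langle>Z\<rangle>)"
    and hexagon_left: "\<lbrakk>X \<in> Obj C; Y \<in> Obj C; Z \<in> Obj C\<rbrakk>
          \<Longrightarrow> \<Phi> (X \<boxtimes> Y) Z = (\<Phi> X Z \<otimes> \<langle>Y\<rangle>) \<cdot> (\<langle>X\<rangle> \<otimes> \<Phi> Y Z)"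

text \<open>
  All categories here are strict, so a functor of braided monoidal categories is taken to
  preserve tensor product, unit object and braiding on the nose.
\<close>

locale braided_functor =
  fixes C :: "('o, 'a, 'x) braided_cat_scheme"
    and D :: "('p, 'b, 'y) braided_cat_scheme"
    and Fo :: "'o \<Rightarrow> 'p"
    and Fa :: "'a \<Rightarrow> 'b"
  assumes obj: "X \<in> Obj C \<Longrightarrow> Fo X \<in> Obj D"
    and arr: "f \<in> Hom\<^bsub>C\<^esub> X Y \<Longrightarrow> Fa f \<in> Hom\<^bsub>D\<^esub> (Fo X) (Fo Y)"
    and ident: "X \<in> Obj C \<Longrightarrow> Fa \<langle>X\<rangle>\<^bsub>C\<^esub> = \<langle>Fo X\<rangle>\<^bsub>D\<^esub>"
    and cmp: "\<lbrakk>f \<in> Hom\<^bsub>C\<^esub> X Y; g \<in> Hom\<^bsub>C\<^esub> Y Z\<rbrakk> \<Longrightarrow> Fa (g \<cdot>\<^bsub>C\<^esub> f) = Fa g \<cdot>\<^bsub>D\<^esub> Fa f"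
    and unit: "Fo \<I>\<^bsub>C\<^esub> = \<I>\<^bsub>D\<^esub>"
    and tobj: "\<lbrakk>X \<in> Obj C; Y \<in> Obj C\<rbrakk> \<Longrightarrow> Fo (X \<boxtimes>\<^bsub>C\<^esub> Y) = Fo X \<boxtimes>\<^bsub>D\<^esub> Fo Y"
    and tarr: "\<lbrakk>f \<in> Arr C; g \<in> Arr C\<rbrakk> \<Longrightarrow> Fa (f \<otimes>\<^bsub>C\<^esub> g) = Fa f \<otimes>\<^bsub>D\<^esub> Fa g"
    and braid: "\<lbrakk>X \<in> Obj C; Y \<in> Obj C\<rbrakk> \<Longrightarrow> Fa (\<Phi>\<^bsub>C\<^esub> X Y) = \<Phi>\<^bsub>D\<^esub> (Fo X) (Fo Y)"

definition isomorphic_braided_categories ::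
    "('o, 'a, 'x) braided_cat_scheme \<Rightarrow> ('p, 'b, 'y) braided_cat_scheme \<Rightarrow> bool" where
  "isomorphic_braided_categories C D \<longleftrightarrow>
     strict_braided_category C \<and> strict_braided_category D \<and>
     (\<exists>Fo Fa Go Ga. braided_functor C D Fo Fa \<and> braided_functor D C Go Ga
        \<and> (\<forall>X\<in>Obj C. Go (Fo X) = X) \<and> (\<forall>f\<in>Arr C. Ga (Fa f) = f)
        \<and> (\<forall>Y\<in>Obj D. Fo (Go Y) = Y) \<and> (\<forall>g\<in>Arr D. Fa (Ga g) = g))"


section \<open>Hopf algebras, modules and comodules\<close>

record ('o, 'a) bialgebra_data =
  ob     :: "'o"
  mult   :: "'a"  ("\<nabla>\<index>")
  unit   :: "'a"  ("\<eta>\<index>")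
  comult :: "'a"  ("\<Delta>\<index>")
  counit :: "'a"  ("\<epsilon>\<index>")

record ('o, 'a) hopf_data = "('o, 'a) bialgebra_data" +
  antipode :: "'a"  ("\<S>\<index>")

locale bialgebra =
  fixes C :: "('o, 'a, 'x) braided_cat_scheme" (structure)
    and H :: "('o, 'a, 'y) bialgebra_data_scheme"
  assumes ob_obj: "ob H \<in> Obj C"
    and mult_hom: "\<nabla>\<^bsub>H\<^esub> \<in> Hom (ob H \<boxtimes> ob H) (ob H)"
    and unit_hom: "\<eta>\<^bsub>H\<^esub> \<in> Hom \<I> (ob H)"
    and comult_hom: "\<Delta>\<^bsub>H\<^esub> \<in> Hom (ob H) (ob H \<boxtimes> ob H)"
    and counit_hom: "\<epsilon>\<^bsub>H\<^esub> \<in> Hom (ob H) \<I>"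
    and mult_assoc: "\<nabla>\<^bsub>H\<^esub> \<cdot> (\<nabla>\<^bsub>H\<^esub> \<otimes> \<langle>ob H\<rangle>) = \<nabla>\<^bsub>H\<^esub> \<cdot> (\<langle>ob H\<rangle> \<otimes> \<nabla>\<^bsub>H\<^esub>)"
    and mult_unit_left: "\<nabla>\<^bsub>H\<^esub> \<cdot> (\<eta>\<^bsub>H\<^esub> \<otimes> \<langle>ob H\<rangle>) = \<langle>ob H\<rangle>"
    and mult_unit_right: "\<nabla>\<^bsub>H\<^esub> \<cdot> (\<langle>ob H\<rangle> \<otimes> \<eta>\<^bsub>H\<^esub>) = \<langle>ob H\<rangle>"
    and comult_coassoc: "(\<Delta>\<^bsub>H\<^esub> \<otimes> \<langle>ob H\<rangle>) \<cdot> \<Delta>\<^bsub>H\<^esub> = (\<langle>ob H\<rangle> \<otimes> \<Delta>\<^bsub>H\<^esub>) \<cdot> \<Delta>\<^bsub>H\<^esub>"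
    and comult_counit_left: "(\<epsilon>\<^bsub>H\<^esub> \<otimes> \<langle>ob H\<rangle>) \<cdot> \<Delta>\<^bsub>H\<^esub> = \<langle>ob H\<rangle>"
    and comult_counit_right: "(\<langle>ob H\<rangle> \<otimes> \<epsilon>\<^bsub>H\<^esub>) \<cdot> \<Delta>\<^bsub>H\<^esub> = \<langle>ob H\<rangle>"
    and comult_mult: "\<Delta>\<^bsub>H\<^esub> \<cdot> \<nabla>\<^bsub>H\<^esub>
          = (\<nabla>\<^bsub>H\<^esub> \<otimes> \<nabla>\<^bsub>H\<^esub>) \<cdot> (\<langle>ob H\<rangle> \<otimes> \<Phi> (ob H) (ob H) \<otimes> \<langle>ob H\<rangle>) \<cdot> (\<Delta>\<^bsub>H\<^esub> \<otimes> \<Delta>\<^bsub>H\<^esub>)"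
    and comult_unit: "\<Delta>\<^bsub>H\<^esub> \<cdot> \<eta>\<^bsub>H\<^esub> = \<eta>\<^bsub>H\<^esub> \<otimes> \<eta>\<^bsub>H\<^esub>"
    and counit_mult: "\<epsilon>\<^bsub>H\<^esub> \<cdot> \<nabla>\<^bsub>H\<^esub> = \<epsilon>\<^bsub>H\<^esub> \<otimes> \<epsilon>\<^bsub>H\<^esub>"
    and counit_unit: "\<epsilon>\<^bsub>H\<^esub> \<cdot> \<eta>\<^bsub>H\<^esub> = \<langle>\<I>\<rangle>"

locale hopf_algebra = bialgebra C H
  for C :: "('o, 'a, 'x) braided_cat_scheme" (structure)
    and H :: "('o, 'a, 'y) hopf_data_scheme" +
  assumes antipode_hom: "\<S>\<^bsub>H\<^esub> \<in> Hom (ob H) (ob H)"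
    and antipode_left: "\<nabla>\<^bsub>H\<^esub> \<cdot> (\<S>\<^bsub>H\<^esub> \<otimes> \<langle>ob H\<rangle>) \<cdot> \<Delta>\<^bsub>H\<^esub> = \<eta>\<^bsub>H\<^esub> \<cdot> \<epsilon>\<^bsub>H\<^esub>"
    and antipode_right: "\<nabla>\<^bsub>H\<^esub> \<cdot> (\<langle>ob H\<rangle> \<otimes> \<S>\<^bsub>H\<^esub>) \<cdot> \<Delta>\<^bsub>H\<^esub> = \<eta>\<^bsub>H\<^esub> \<cdot> \<epsilon>\<^bsub>H\<^esub>"

context
  fixes C :: "('o, 'a, 'x) braided_cat_scheme" (structure)
    and A :: "('o, 'a, 'y) bialgebra_data_scheme"
begin

definition left_module :: "'o \<Rightarrow> 'a \<Rightarrow> bool" where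
  "left_module M \<mu> \<longleftrightarrow> M \<in> Obj C \<and> \<mu> \<in> Hom (ob A \<boxtimes> M) M
     \<and> \<mu> \<cdot> (\<nabla>\<^bsub>A\<^esub> \<otimes> \<langle>M\<rangle>) = \<mu> \<cdot> (\<langle>ob A\<rangle> \<otimes> \<mu>)
     \<and> \<mu> \<cdot> (\<eta>\<^bsub>A\<^esub> \<otimes> \<langle>M\<rangle>) = \<langle>M\<rangle>"

definition right_comodule :: "'o \<Rightarrow> 'a \<Rightarrow> bool" where
  "right_comodule M \<rho> \<longleftrightarrow> M \<in> Obj C \<and> \<rho> \<in> Hom M (M \<boxtimes> ob A)
     \<and> (\<rho> \<otimes> \<langle>ob A\<rangle>) \<cdot> \<rho> = (\<langle>M\<rangle> \<otimes> \<Delta>\<^bsub>A\<^esub>) \<cdot> \<rho>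
     \<and> (\<langle>M\<rangle> \<otimes> \<epsilon>\<^bsub>A\<^esub>) \<cdot> \<rho> = \<langle>M\<rangle>"

definition left_linear :: "'o \<times> 'a \<Rightarrow> 'o \<times> 'a \<Rightarrow> 'a \<Rightarrow> bool" where
  "left_linear = (\<lambda>(M, \<mu>) (N, \<nu>) f. f \<in> Hom M N \<and> f \<cdot> \<mu> = \<nu> \<cdot> (\<langle>ob A\<rangle> \<otimes> f))"

definition right_colinear :: "'o \<times> 'a \<Rightarrow> 'o \<times> 'a \<Rightarrow> 'a \<Rightarrow> bool" where
  "right_colinear = (\<lambda>(M, \<rho>) (N, \<sigma>) f. f \<in> Hom M N \<and> \<sigma> \<cdot> f = (f \<otimes> \<langle>ob A\<rangle>) \<cdot> \<rho>)"

definition tensor_action :: "'o \<times> 'a \<Rightarrow> 'o \<times> 'a \<Rightarrow> 'a" where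
  "tensor_action = (\<lambda>(M, \<mu>) (N, \<nu>).
     (\<mu> \<otimes> \<nu>) \<cdot> (\<langle>ob A\<rangle> \<otimes> \<Phi> (ob A) M \<otimes> \<langle>N\<rangle>) \<cdot> (\<Delta>\<^bsub>A\<^esub> \<otimes> \<langle>M\<rangle> \<otimes> \<langle>N\<rangle>))"

text \<open>The coaction on a tensor product uses the opposite multiplication \<open>\<nabla> \<Phi>\<close> of \<open>A\<close>.\<close>

definition tensor_coaction_op :: "'o \<times> 'a \<Rightarrow> 'o \<times> 'a \<Rightarrow> 'a" where
  "tensor_coaction_op = (\<lambda>(M, \<rho>) (N, \<sigma>).
     (\<langle>M\<rangle> \<otimes> \<langle>N\<rangle> \<otimes> (\<nabla>\<^bsub>A\<^esub> \<cdot> \<Phi> (ob A) (ob A))) \<cdot> (\<langle>M\<rangle> \<otimes> \<Phi> (ob A) N \<otimes> \<langle>ob A\<rangle>) \<cdot> (\<rho> \<otimes> \<sigma>))"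

end


section \<open>The category of left-right Yetter-Drinfel'd modules\<close>

text \<open>
  A Yetter-Drinfel'd module is a triple \<open>(M, \<mu>, \<rho>)\<close>. In the categories constructed below a
  morphism is a triple \<open>(source, f, target)\<close> with \<open>f\<close> a morphism of \<open>C\<close>.
\<close>

context
  fixes C :: "('o, 'a, 'x) braided_cat_scheme" (structure)
    and H :: "('o, 'a, 'y) bialgebra_data_scheme"
begin

definition yd_module :: "'o \<times> 'a \<times> 'a \<Rightarrow> bool" where
  "yd_module = (\<lambda>(M, \<mu>, \<rho>). left_module C H M \<mu> \<and> right_comodule C H M \<rho> \<and>
     (\<langle>M\<rangle> \<otimes> \<nabla>\<^bsub>H\<^esub>) \<cdot> (\<rho> \<otimes> \<langle>ob H\<rangle>) \<cdot> inv (\<Phi> M (ob H)) \<cdot> (\<langle>ob H\<rangle> \<otimes> \<mu>) \<cdot> (\<Delta>\<^bsub>H\<^esub> \<otimes> \<langle>M\<rangle>)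
     = (\<mu> \<otimes> \<nabla>\<^bsub>H\<^esub>) \<cdot> (\<langle>ob H\<rangle> \<otimes> \<Phi> (ob H) M \<otimes> \<langle>ob H\<rangle>) \<cdot> (\<Delta>\<^bsub>H\<^esub> \<otimes> \<rho>))"

definition yd_tensor :: "'o \<times> 'a \<times> 'a \<Rightarrow> 'o \<times> 'a \<times> 'a \<Rightarrow> 'o \<times> 'a \<times> 'a" where
  "yd_tensor = (\<lambda>(M, \<mu>, \<rho>) (N, \<nu>, \<sigma>).
     (M \<boxtimes> N, tensor_action C H (M, \<mu>) (N, \<nu>), tensor_coaction_op C H (M, \<rho>) (N, \<sigma>)))"

definition yd_braiding :: "'o \<times> 'a \<times> 'a \<Rightarrow> 'o \<times> 'a \<times> 'a \<Rightarrow> 'a" where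
  "yd_braiding = (\<lambda>(M, \<mu>, \<rho>) (N, \<nu>, \<sigma>). (\<langle>N\<rangle> \<otimes> \<mu>) \<cdot> (\<sigma> \<otimes> \<langle>M\<rangle>) \<cdot> \<Phi> M N)"

definition yd_category ::
    "('o \<times> 'a \<times> 'a, ('o \<times> 'a \<times> 'a) \<times> 'a \<times> ('o \<times> 'a \<times> 'a)) braided_cat" where
  "yd_category = \<lparr>
     Obj = {X. yd_module X},
     Arr = {((M, \<mu>, \<rho>), f, (N, \<nu>, \<sigma>)) | M \<mu> \<rho> f N \<nu> \<sigma>.
              yd_module (M, \<mu>, \<rho>) \<and> yd_module (N, \<nu>, \<sigma>)
              \<and> left_linear C H (M, \<mu>) (N, \<nu>) f \<and> right_colinear C H (M, \<rho>) (N, \<sigma>) f},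
     src = (\<lambda>(X, f, Y). X),
     tgt = (\<lambda>(X, f, Y). Y),
     ident = (\<lambda>X. (X, \<langle>fst X\<rangle>, X)),
     cmp = (\<lambda>(Y', g, Z) (X, f, Y). (X, g \<cdot> f, Z)),
     tobj = yd_tensor,
     tarr = (\<lambda>(X, f, Y) (X', g, Y'). (yd_tensor X X', f \<otimes> g, yd_tensor Y Y')),
     uobj = (\<I>, \<epsilon>\<^bsub>H\<^esub>, \<eta>\<^bsub>H\<^esub>),
     braid = (\<lambda>X Y. (yd_tensor X Y, yd_braiding X Y, yd_tensor Y X)) \<rparr>"

end


section \<open>Inner homs and finite objects\<close>

context
  fixes C :: "('o, 'a, 'x) braided_cat_scheme" (structure)
begin

text \<open>\<open>E\<close> is the inner hom \<open>[V, W]\<close> with evaluation \<open>e : [V, W] \<otimes> V \<rightarrow> W\<close>.\<close>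

definition inner_hom :: "'o \<Rightarrow> 'o \<Rightarrow> 'o \<Rightarrow> 'a \<Rightarrow> bool" where
  "inner_hom V W E e \<longleftrightarrow> E \<in> Obj C \<and> e \<in> Hom (E \<boxtimes> V) W \<and>
     (\<forall>X\<in>Obj C. \<forall>f\<in>Hom (X \<boxtimes> V) W. \<exists>!g. g \<in> Hom X E \<and> e \<cdot> (g \<otimes> \<langle>V\<rangle>) = f)"

text \<open>
  Below \<open>Vd = [V, I]\<close> with evaluation \<open>ev\<close>, and \<open>VV = [V, V]\<close> with evaluation \<open>evV\<close>;
  \<open>V \<otimes> [V, I] \<rightarrow> [V, V]\<close> is the morphism corresponding to \<open>V \<otimes> ev\<close>.
\<close>

definition dual_basis_morphism :: "'o \<Rightarrow> 'o \<Rightarrow> 'a \<Rightarrow> 'o \<Rightarrow> 'a \<Rightarrow> 'a" where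
  "dual_basis_morphism V Vd ev VV evV =
     (THE g. g \<in> Hom (V \<boxtimes> Vd) VV \<and> evV \<cdot> (g \<otimes> \<langle>V\<rangle>) = \<langle>V\<rangle> \<otimes> ev)"

definition finite_object :: "'o \<Rightarrow> 'o \<Rightarrow> 'a \<Rightarrow> 'o \<Rightarrow> 'a \<Rightarrow> bool" where
  "finite_object V Vd ev VV evV \<longleftrightarrow>
     inner_hom V \<I> Vd ev \<and> inner_hom V V VV evV
     \<and> is_iso C (dual_basis_morphism V Vd ev VV evV)"

text \<open>
  The coevaluation (dual basis) \<open>d : I \<rightarrow> V \<otimes> V\<^sup>*\<close> is the morphism \<open>I \<rightarrow> [V, V]\<close> corresponding to the identity
  of \<open>V\<close>, transported along the inverse of the dual basis morphism.
\<close>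

definition dual_basis :: "'o \<Rightarrow> 'o \<Rightarrow> 'a \<Rightarrow> 'o \<Rightarrow> 'a \<Rightarrow> 'a" where
  "dual_basis V Vd ev VV evV =
     inv (dual_basis_morphism V Vd ev VV evV)
       \<cdot> (THE u. u \<in> Hom \<I> VV \<and> evV \<cdot> (u \<otimes> \<langle>V\<rangle>) = \<langle>V\<rangle>)"

end


section \<open>The Drinfel'd double\<close>

context
  fixes C :: "('o, 'a, 'x) braided_cat_scheme" (structure)
    and H :: "('o, 'a, 'y) hopf_data_scheme"
    and Hd :: 'o
    and ev :: 'a
begin

definition ev_bar :: 'a where
  "ev_bar = ev \<cdot> \<Phi> (ob H) Hd"

definition dual_op :: "('o, 'a) bialgebra_data" where
  "dual_op = \<lparr>
     ob = Hd,
     mult = (THE m. m \<in> Hom (Hd \<boxtimes> Hd) Hd \<and>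
       ev \<cdot> (m \<otimes> \<langle>ob H\<rangle>)
         = (ev \<otimes> ev) \<cdot> (\<langle>Hd\<rangle> \<otimes> \<Phi> Hd (ob H) \<otimes> \<langle>ob H\<rangle>) \<cdot> (\<langle>Hd\<rangle> \<otimes> \<langle>Hd\<rangle> \<otimes> \<Delta>\<^bsub>H\<^esub>)),
     unit = (THE u. u \<in> Hom \<I> Hd \<and> ev \<cdot> (u \<otimes> \<langle>ob H\<rangle>) = \<epsilon>\<^bsub>H\<^esub>),
     comult = (THE c. c \<in> Hom Hd (Hd \<boxtimes> Hd) \<and>
       (ev \<otimes> ev) \<cdot> (\<langle>Hd\<rangle> \<otimes> \<Phi> Hd (ob H) \<otimes> \<langle>ob H\<rangle>) \<cdot> (c \<otimes> \<langle>ob H\<rangle> \<otimes> \<langle>ob H\<rangle>)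
         = ev \<cdot> (\<langle>Hd\<rangle> \<otimes> (\<nabla>\<^bsub>H\<^esub> \<cdot> \<Phi> (ob H) (ob H)))),
     counit = ev \<cdot> (\<langle>Hd\<rangle> \<otimes> \<eta>\<^bsub>H\<^esub>) \<rparr>"

definition double_left_action :: 'a  ("op\<triangleright>") where
  "op\<triangleright> = (THE t. t \<in> Hom (ob H \<boxtimes> Hd) Hd \<and>
     ev_bar \<cdot> (\<langle>ob H\<rangle> \<otimes> t)
       = ev_bar \<cdot> ((\<nabla>\<^bsub>H\<^esub> \<cdot> \<Phi> (ob H) (ob H) \<cdot> (\<nabla>\<^bsub>H\<^esub> \<otimes> inv \<S>\<^bsub>H\<^esub>) \<cdot> (\<langle>ob H\<rangle> \<otimes> \<Delta>\<^bsub>H\<^esub>)) \<otimes> \<langle>Hd\<rangle>))"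

definition double_right_action :: 'a  ("op\<triangleleft>") where
  "op\<triangleleft> = (\<langle>ob H\<rangle> \<otimes> ev_bar)
     \<cdot> (\<langle>ob H\<rangle> \<otimes> (\<nabla>\<^bsub>H\<^esub> \<cdot> \<Phi> (ob H) (ob H)) \<otimes> \<langle>Hd\<rangle>)
     \<cdot> (inv (\<Phi> (ob H) (ob H)) \<otimes> inv \<S>\<^bsub>H\<^esub> \<otimes> \<langle>Hd\<rangle>)
     \<cdot> (((\<Delta>\<^bsub>H\<^esub> \<otimes> \<langle>ob H\<rangle>) \<cdot> \<Delta>\<^bsub>H\<^esub>) \<otimes> \<langle>Hd\<rangle>)"

definition drinfeld_double :: "('o, 'a) bialgebra_data" where
  "drinfeld_double = \<lparr>
     ob = Hd \<boxtimes> ob H,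
     mult = (\<nabla>\<^bsub>dual_op\<^esub> \<otimes> \<nabla>\<^bsub>H\<^esub>)
       \<cdot> (\<langle>Hd\<rangle> \<otimes> op\<triangleright> \<otimes> op\<triangleleft> \<otimes> \<langle>ob H\<rangle>)
       \<cdot> (\<langle>Hd\<rangle> \<otimes> \<langle>ob H\<rangle> \<otimes> \<Phi> (ob H) Hd \<otimes> \<langle>Hd\<rangle> \<otimes> \<langle>ob H\<rangle>)
       \<cdot> (\<langle>Hd\<rangle> \<otimes> \<Delta>\<^bsub>H\<^esub> \<otimes> \<Delta>\<^bsub>dual_op\<^esub> \<otimes> \<langle>ob H\<rangle>),
     unit = \<eta>\<^bsub>dual_op\<^esub> \<otimes> \<eta>\<^bsub>H\<^esub>,
     comult = (\<langle>Hd\<rangle> \<otimes> \<Phi> Hd (ob H) \<otimes> \<langle>ob H\<rangle>) \<cdot> (\<Delta>\<^bsub>dual_op\<^esub> \<otimes> \<Delta>\<^bsub>H\<^esub>),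
     counit = \<epsilon>\<^bsub>dual_op\<^esub> \<otimes> \<epsilon>\<^bsub>H\<^esub> \<rparr>"

text \<open>
  Objects of the category of left \<open>D(H)\<close>-modules are pairs \<open>(M, \<alpha>)\<close>. The braiding takes the
  coevaluation \<open>d : I \<rightarrow> H \<otimes> H\<^sup>*\<close> as a parameter.
\<close>

definition double_module :: "'o \<times> 'a \<Rightarrow> bool" where
  "double_module = (\<lambda>(M, \<alpha>). left_module C drinfeld_double M \<alpha>)"

definition double_tensor :: "'o \<times> 'a \<Rightarrow> 'o \<times> 'a \<Rightarrow> 'o \<times> 'a" where
  "double_tensor = (\<lambda>(M, \<alpha>) (N, \<beta>). (M \<boxtimes> N, tensor_action C drinfeld_double (M, \<alpha>) (N, \<beta>)))"

definition restrict_to_H :: "'o \<times> 'a \<Rightarrow> 'a" where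
  "restrict_to_H = (\<lambda>(M, \<alpha>). \<alpha> \<cdot> (\<eta>\<^bsub>dual_op\<^esub> \<otimes> \<langle>ob H\<rangle> \<otimes> \<langle>M\<rangle>))"

definition restrict_to_dual :: "'o \<times> 'a \<Rightarrow> 'a" where
  "restrict_to_dual = (\<lambda>(M, \<alpha>). \<alpha> \<cdot> (\<langle>Hd\<rangle> \<otimes> \<eta>\<^bsub>H\<^esub> \<otimes> \<langle>M\<rangle>))"

definition double_braiding :: "'a \<Rightarrow> 'o \<times> 'a \<Rightarrow> 'o \<times> 'a \<Rightarrow> 'a" where
  "double_braiding d X Y =
     \<Phi> (fst X) (fst Y) \<cdot> (restrict_to_H X \<otimes> restrict_to_dual Y)
       \<cdot> (\<langle>ob H\<rangle> \<otimes> \<Phi> Hd (fst X) \<otimes> \<langle>fst Y\<rangle>) \<cdot> (d \<otimes> \<langle>fst X\<rangle> \<otimes> \<langle>fst Y\<rangle>)"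

definition double_module_category ::
    "'a \<Rightarrow> ('o \<times> 'a, ('o \<times> 'a) \<times> 'a \<times> ('o \<times> 'a)) braided_cat" where
  "double_module_category d = \<lparr>
     Obj = {X. double_module X},
     Arr = {(X, f, Y). double_module X \<and> double_module Y \<and> left_linear C drinfeld_double X Y f},
     src = (\<lambda>(X, f, Y). X),
     tgt = (\<lambda>(X, f, Y). Y),
     ident = (\<lambda>X. (X, \<langle>fst X\<rangle>, X)),
     cmp = (\<lambda>(Y', g, Z) (X, f, Y). (X, g \<cdot> f, Z)),
     tobj = double_tensor,
     tarr = (\<lambda>(X, f, Y) (X', g, Y'). (double_tensor X X', f \<otimes> g, double_tensor Y Y')),
     uobj = (\<I>, \<epsilon>\<^bsub>drinfeld_double\<^esub>),
     braid = (\<lambda>X Y. (double_tensor X Y, double_braiding d X Y, double_tensor Y X)) \<rparr>"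

end

end

theory Submission
  imports Defs
begin

text \<open>
  The symmetry hypothesis concerns objects with a Yetter-Drinfel'd structure only, but every object \<open>N\<close> of \<open>C\<close>
  is a retract of the free Yetter-Drinfel'd module \<open>H \<otimes> N\<close>. Hence \<open>H\<close>, and by duality \<open>H\<^sup>*\<close>, braids symmetrically
  with every object, and calculations with these two objects follow the classical ones in Sweedler notation.
  A coaction of \<open>H\<close> on \<open>M\<close> is the same as an action \<open>b m = m\<^sub>0 \<langle>b, m\<^sub>1\<rangle>\<close> of \<open>H\<^sup>*\<close>, and the Yetter-Drinfel'd
  condition becomes the rule \<open>h b = \<langle>b, S\<^sup>-\<^sup>1(h\<^sub>3) _ h\<^sub>1\<rangle> h\<^sub>2\<close> that defines the multiplication of the double.
  The axioms of a braided category are checked for Yetter-Drinfel'd modules and carried over to modules over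
  the double along this bijection.

  Every identity between composites of structure morphisms is an equality of string diagrams. It is
  proved by reflection: a list of elementary moves that transforms one diagram into the other is replayed by
  the simplifier.
\<close>

text \<open>The obstacle is a circle: calculations with H want a symmetric crossing with every
  object, but the hypothesis grants it only on Yetter-Drinfel'd modules. The free module must
  therefore be built first, in a category that is merely braided; its coaction and axioms fix every
  over- and undercrossing, and the rules about the inverse antipode carry inverse crossings.
  Afterwards a crossing may be exchanged with its inverse as soon as one of its wires is H or the
  dual, while the crossing of two modules stays a genuine braiding to the end. The pivot between the
  two kinds of modules is a pair of actions, of H and of its dual, subject to one exchange rule.
  Each side is translated into such a pair and recovered from it. Whether a list of moves applies
  depends on numbers and wire types alone, so a single evaluation settles an identity in every
  category where the rules hold.\<close>

section \<open>Inverses, and the braiding with the unit object\<close>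

context small_category
begin

lemma hom_obj: "f \<in> Hom X Y \<Longrightarrow> X \<in> Obj C" "f \<in> Hom X Y \<Longrightarrow> Y \<in> Obj C"
  using src_obj tgt_obj by (auto simp: Hom_def)

lemma hom_arr: "f \<in> Hom X Y \<Longrightarrow> f \<in> Arr C"
  by (simp add: Hom_def)

lemma arr_homD: "f \<in> Arr C \<Longrightarrow> f \<in> Hom (src C f) (tgt C f)"
  by (simp add: Hom_def)

lemma arr_invI:
  assumes "f \<in> Hom X Y" "g \<in> Hom Y X" "g \<cdot> f = \<langle>X\<rangle>" "f \<cdot> g = \<langle>Y\<rangle>"
  shows "inv f = g" "is_iso C f"
proof -
  have fg: "inverses C f g"
    using assms by (auto simp: inverses_def Hom_def)
  then show "is_iso C f"
    by (auto simp: is_iso_def)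
  show "inv f = g"
    unfolding arr_inv_def
  proof (rule the_equality[where P = "inverses C f", OF fg])
    fix h assume "inverses C f h"
    then have h: "h \<in> Hom Y X" "h \<cdot> f = \<langle>X\<rangle>"
      using assms(1) by (auto simp: inverses_def Hom_def)
    have "h = h \<cdot> (f \<cdot> g)"
      using h assms cmp_ident_right by simp
    also have "\<dots> = g"
      using cmp_assoc[OF assms(2,1) h(1)] h assms(2) cmp_ident_left by simp
    finally show "h = g" .
  qed
qed

lemma arr_inv:
  assumes "is_iso C f" "f \<in> Hom X Y"
  shows "inv f \<in> Hom Y X" "inv f \<cdot> f = \<langle>X\<rangle>" "f \<cdot> inv f = \<langle>Y\<rangle>"
proof -
  obtain g where "inverses C f g"
    using assms by (auto simp: is_iso_def)
  then have g: "g \<in> Hom Y X" "g \<cdot> f = \<langle>X\<rangle>" "f \<cdot> g = \<langle>Y\<rangle>"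
    using assms(2) by (auto simp: inverses_def Hom_def)
  then show "inv f \<in> Hom Y X" "inv f \<cdot> f = \<langle>X\<rangle>" "f \<cdot> inv f = \<langle>Y\<rangle>"
    using arr_invI[OF assms(2) g] by auto
qed

lemma inv_ident: "X \<in> Obj C \<Longrightarrow> inv \<langle>X\<rangle> = \<langle>X\<rangle>"
  by (rule arr_invI(1)) (auto simp: ident_hom cmp_ident_left[OF ident_hom])

lemma inv_cmp:
  assumes "is_iso C f" "f \<in> Hom X Y" "is_iso C g" "g \<in> Hom Y Z"
  shows "inv (g \<cdot> f) = inv f \<cdot> inv g" "is_iso C (g \<cdot> f)"
proof -
  note f = arr_inv[OF assms(1,2)] and g = arr_inv[OF assms(3,4)]
  have gf: "g \<cdot> f \<in> Hom X Z" and i: "inv f \<cdot> inv g \<in> Hom Z X"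
    using assms f g cmp_hom by blast+
  have "(inv f \<cdot> inv g) \<cdot> (g \<cdot> f) = inv f \<cdot> ((inv g \<cdot> g) \<cdot> f)"
    using cmp_assoc[OF gf g(1) f(1)] cmp_assoc[OF assms(2,4) g(1)] by simp
  also have "\<dots> = \<langle>X\<rangle>"
    using g f cmp_ident_left[OF assms(2)] by simp
  finally have 1: "(inv f \<cdot> inv g) \<cdot> (g \<cdot> f) = \<langle>X\<rangle>" .
  have "(g \<cdot> f) \<cdot> (inv f \<cdot> inv g) = g \<cdot> ((f \<cdot> inv f) \<cdot> inv g)"
    using cmp_assoc[OF i assms(2,4)] cmp_assoc[OF g(1) f(1) assms(2)] by simp
  also have "\<dots> = \<langle>Z\<rangle>"
    using g f cmp_ident_left[OF g(1)] by simp
  finally have 2: "(g \<cdot> f) \<cdot> (inv f \<cdot> inv g) = \<langle>Z\<rangle>" .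
  show "inv (g \<cdot> f) = inv f \<cdot> inv g" "is_iso C (g \<cdot> f)"
    using arr_invI[OF gf i 1 2] by auto
qed

end

context strict_monoidal_category
begin

lemma inv_tarr:
  assumes "is_iso C f" "f \<in> Hom X Y" "is_iso C g" "g \<in> Hom Z W"
  shows "inv (f \<otimes> g) = inv f \<otimes> inv g" "is_iso C (f \<otimes> g)"
proof -
  note f = arr_inv[OF assms(1,2)] and g = arr_inv[OF assms(3,4)]
  note o = hom_obj[OF assms(2)] hom_obj[OF assms(4)]
  have t: "f \<otimes> g \<in> Hom (X \<boxtimes> Z) (Y \<boxtimes> W)" "inv f \<otimes> inv g \<in> Hom (Y \<boxtimes> W) (X \<boxtimes> Z)"
    using assms f g by (auto intro: tarr_hom)
  have "(inv f \<otimes> inv g) \<cdot> (f \<otimes> g) = \<langle>X \<boxtimes> Z\<rangle>" "(f \<otimes> g) \<cdot> (inv f \<otimes> inv g) = \<langle>Y \<boxtimes> W\<rangle>"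
    using interchange[OF assms(2) f(1) assms(4) g(1)] interchange[OF f(1) assms(2) g(1) assms(4)]
      f g o by (simp_all add: tarr_ident)
  from arr_invI[OF t this] show "inv (f \<otimes> g) = inv f \<otimes> inv g" "is_iso C (f \<otimes> g)" by auto
qed

end

context strict_braided_category
begin

lemma braid_inv:
  assumes "X \<in> Obj C" "Y \<in> Obj C"
  shows "inv (\<Phi> X Y) \<in> Hom (Y \<boxtimes> X) (X \<boxtimes> Y)"
    "inv (\<Phi> X Y) \<cdot> \<Phi> X Y = \<langle>X \<boxtimes> Y\<rangle>"
    "\<Phi> X Y \<cdot> inv (\<Phi> X Y) = \<langle>Y \<boxtimes> X\<rangle>"
  using arr_inv[OF braid_iso braid_hom] assms by auto

lemma idem_iso_ident:
  assumes "f \<in> Hom X X" "is_iso C f" "f \<cdot> f = f"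
  shows "f = \<langle>X\<rangle>"
proof -
  note i = arr_inv[OF assms(2,1)]
  have "f = (inv f \<cdot> f) \<cdot> f" using i assms(1) cmp_ident_left by simp
  also have "\<dots> = inv f \<cdot> f" using cmp_assoc[OF assms(1,1) i(1)] assms(3) by simp
  finally show ?thesis using i by simp
qed

text \<open>The hexagon with two unit factors makes this braiding idempotent, and an invertible
  idempotent is an identity.\<close>

lemma braid_unit:
  assumes "X \<in> Obj C"
  shows "\<Phi> \<I> X = \<langle>X\<rangle>" "\<Phi> X \<I> = \<langle>X\<rangle>"
proof -
  have a: "\<Phi> \<I> X \<in> Hom X X" "\<Phi> X \<I> \<in> Hom X X"
    using braid_hom[OF unit_obj assms] braid_hom[OF assms unit_obj] assms
    by (simp_all add: tobj_unit_left tobj_unit_right)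
  have "\<Phi> \<I> X \<cdot> \<Phi> \<I> X = \<Phi> \<I> X" "\<Phi> X \<I> \<cdot> \<Phi> X \<I> = \<Phi> X \<I>"
    using hexagon_left[OF unit_obj unit_obj assms] hexagon_right[OF assms unit_obj unit_obj]
      hom_arr[OF a(1)] hom_arr[OF a(2)] by (simp_all add: tobj_unit_left unit_obj tarr_unit_left tarr_unit_right)
  then show "\<Phi> \<I> X = \<langle>X\<rangle>" "\<Phi> X \<I> = \<langle>X\<rangle>"
    using idem_iso_ident[OF a(1)] idem_iso_ident[OF a(2)] braid_iso assms unit_obj by auto
qed

end

subsection \<open>Words and whiskering\<close>

text \<open>Every wire type denotes an object, so no side condition on types ever arises; types that
  a calculation does not mention may denote anything.\<close>

locale word_category = strict_braided_category C
  for C :: "('o, 'a, 'x) braided_cat_scheme" (structure) +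
  fixes os :: "nat \<Rightarrow> 'o"
  assumes os_obj [simp]: "os t \<in> Obj C"
begin

primrec W :: "nat list \<Rightarrow> 'o" where
  "W [] = \<I>"
| "W (t # ts) = os t \<boxtimes> W ts"

lemma W_obj [simp]: "W ts \<in> Obj C"
  by (induction ts) (auto simp: unit_obj tobj_obj)

text \<open>By its definition \<open>W\<close> closes every word with the unit object; this rule
  turns a one-letter word into its letter, so that statements over words read as statements over
  objects.\<close>

lemma os_unit [simp]: "os t \<boxtimes> \<I> = os t"
  by (simp add: tobj_unit_right)

lemma W_append: "W (xs @ ys) = W xs \<boxtimes> W ys"
  by (induction xs) (auto simp: tobj_unit_left tobj_assoc)

abbreviation idw :: "nat list \<Rightarrow> 'a" where
  "idw ts \<equiv> \<langle>W ts\<rangle>"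

abbreviation Mor :: "nat list \<Rightarrow> nat list \<Rightarrow> 'a set" where
  "Mor xs ys \<equiv> Hom (W xs) (W ys)"

definition whisker :: "nat list \<Rightarrow> 'a \<Rightarrow> nat list \<Rightarrow> 'a" where
  "whisker u f v = idw u \<otimes> f \<otimes> idw v"

lemma idw_hom [simp]: "idw xs \<in> Mor xs xs"
  by (simp add: ident_hom)

lemma idw_append: "idw (xs @ ys) = idw xs \<otimes> idw ys"
  by (simp add: W_append tarr_ident)

lemma mor_cmp: "f \<in> Mor xs ys \<Longrightarrow> g \<in> Mor ys zs \<Longrightarrow> g \<cdot> f \<in> Mor xs zs"
  by (rule cmp_hom)

lemma mor_assoc: "f \<in> Mor xs ys \<Longrightarrow> g \<in> Mor ys zs \<Longrightarrow> h \<in> Mor zs ws \<Longrightarrow> (h \<cdot> g) \<cdot> f = h \<cdot> (g \<cdot> f)"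
  by (rule cmp_assoc)

lemma mor_id [simp]:
  "f \<in> Mor xs ys \<Longrightarrow> f \<cdot> idw xs = f"
  "f \<in> Mor xs ys \<Longrightarrow> idw ys \<cdot> f = f"
  by (auto intro: cmp_ident_left cmp_ident_right)

lemma mor_tensor: "f \<in> Mor xs ys \<Longrightarrow> g \<in> Mor zs ws \<Longrightarrow> f \<otimes> g \<in> Mor (xs @ zs) (ys @ ws)"
  by (simp add: W_append tarr_hom)

lemma whisker_hom: "f \<in> Mor xs ys \<Longrightarrow> whisker u f v \<in> Mor (u @ xs @ v) (u @ ys @ v)"
  unfolding whisker_def by (intro mor_tensor idw_hom)

lemma whisker_id [simp]: "whisker u (idw xs) v = idw (u @ xs @ v)"
  by (simp add: whisker_def idw_append)

lemma whisker_Nil [simp]: "f \<in> Mor xs ys \<Longrightarrow> whisker [] f [] = f"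
  by (auto simp: whisker_def tarr_unit_left tarr_unit_right hom_arr)

lemma whisker_cmp:
  assumes "f \<in> Mor xs ys" "g \<in> Mor ys zs"
  shows "whisker u g v \<cdot> whisker u f v = whisker u (g \<cdot> f) v"
  unfolding whisker_def
  using interchange[OF idw_hom[of u] idw_hom[of u] mor_tensor[OF assms(1) idw_hom[of v]] mor_tensor[OF assms(2) idw_hom[of v]]]
    interchange[OF assms idw_hom[of v] idw_hom[of v]] mor_id(1)[OF idw_hom]
  by simp

lemma whisker_whisker:
  assumes "f \<in> Mor xs ys"
  shows "whisker u (whisker u' f v') v = whisker (u @ u') f (v' @ v)"
  using hom_arr[OF assms] hom_arr[OF idw_hom] tarr_hom[OF arr_homD arr_homD, THEN hom_arr]
  by (simp add: whisker_def idw_append tarr_assoc)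

lemma tensor_whisker:
  assumes "f \<in> Mor xs ys" "g \<in> Mor zs ws"
  shows "f \<otimes> g = whisker ys g [] \<cdot> whisker [] f zs"
    and "f \<otimes> g = whisker [] f ws \<cdot> whisker xs g []"
  using interchange[OF assms(1) idw_hom idw_hom assms(2)] interchange[OF idw_hom assms(1) assms(2) idw_hom]
    assms hom_arr[OF assms(1)] hom_arr[OF assms(2)] tarr_hom[OF arr_homD arr_homD, THEN hom_arr] hom_arr[OF idw_hom]
  by (simp_all add: whisker_def tarr_unit_left tarr_unit_right)

text \<open>The middle word \<open>v\<close> is absorbed into \<open>g\<close>; what is left is the
  interchange law for two adjacent morphisms, whiskered by \<open>u\<close> and
  \<open>w\<close>.\<close>

lemma whisker_exchange:
  assumes "f \<in> Mor xs ys" "g \<in> Mor zs ws"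
  shows "whisker u f (v @ ws @ w) \<cdot> whisker (u @ xs @ v) g w
       = whisker (u @ ys @ v) g w \<cdot> whisker u f (v @ zs @ w)"
proof -
  have g: "whisker v g [] \<in> Mor (v @ zs) (v @ ws)"
    using whisker_hom[OF assms(2), of v "[]"] by simp
  have eq: "whisker [] f (v @ ws) \<cdot> whisker xs (whisker v g []) []
      = whisker ys (whisker v g []) [] \<cdot> whisker [] f (v @ zs)"
    using tensor_whisker[OF assms(1) g] by simp
  have h: "whisker [] f t \<in> Mor (xs @ t) (ys @ t)" "whisker t (whisker v g []) [] \<in> Mor (t @ v @ zs) (t @ v @ ws)" for t
    using whisker_hom[OF assms(1), of "[]" t] whisker_hom[OF g, of t "[]"] by simp_all
  have "whisker u (whisker [] f (v @ ws)) w \<cdot> whisker u (whisker xs (whisker v g []) []) w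
      = whisker u (whisker ys (whisker v g []) []) w \<cdot> whisker u (whisker [] f (v @ zs)) w"
    using eq whisker_cmp[OF h(2,1)] whisker_cmp[OF h(1,2)] by simp
  then show ?thesis
    by (simp add: whisker_whisker[OF assms(1)] whisker_whisker[OF assms(2)] whisker_whisker[OF g])
qed

end

subsection \<open>Syntax of string diagrams\<close>

text \<open>
  A diagram is a list of layers, each consisting of one generator with a number of wires on its
  left; wires are labelled by types. \<open>Over a b\<close> is the braiding of \<open>a\<close> and \<open>b\<close>, \<open>Under a b\<close> the inverse of
  the braiding of \<open>b\<close> and \<open>a\<close>, and \<open>Gen n d c\<close> the morphism number \<open>n\<close> from \<open>d\<close> to \<open>c\<close>.
\<close>

datatype gen = Over nat nat | Under nat nat | Gen nat "nat list" "nat list"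

fun gdom :: "gen \<Rightarrow> nat list" where
  "gdom (Over a b) = [a, b]"
| "gdom (Under a b) = [a, b]"
| "gdom (Gen n d c) = d"

fun gcod :: "gen \<Rightarrow> nat list" where
  "gcod (Over a b) = [b, a]"
| "gcod (Under a b) = [b, a]"
| "gcod (Gen n d c) = c"

type_synonym layer = "nat \<times> gen"

fun fits :: "nat list \<Rightarrow> layer \<Rightarrow> bool" where
  "fits xs (i, g) \<longleftrightarrow> i \<le> length xs \<and> take (length (gdom g)) (drop i xs) = gdom g"

fun step :: "nat list \<Rightarrow> layer \<Rightarrow> nat list" where
  "step xs (i, g) = take i xs @ gcod g @ drop (i + length (gdom g)) xs"

fun out :: "nat list \<Rightarrow> layer list \<Rightarrow> nat list option" where
  "out xs [] = Some xs"
| "out xs (l # ls) = (if fits xs l then out (step xs l) ls else None)"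

definition shift :: "nat \<Rightarrow> layer list \<Rightarrow> layer list" where
  "shift k = map (\<lambda>(i, g). (k + i, g))"

datatype expr = Idw "nat list" | Atom gen | Overs "nat list" "nat list" | Unders "nat list" "nat list"
  | Comp expr expr (infixr "\<odot>" 60) | Tens expr expr (infixr "\<oslash>" 70)

fun dm :: "expr \<Rightarrow> nat list" and cd :: "expr \<Rightarrow> nat list" where
  "dm (Idw xs) = xs"
| "dm (Atom g) = gdom g"
| "dm (Overs xs ys) = xs @ ys"
| "dm (Unders xs ys) = xs @ ys"
| "dm (e \<odot> f) = dm f"
| "dm (e \<oslash> f) = dm e @ dm f"
| "cd (Idw xs) = xs"
| "cd (Atom g) = gcod g"
| "cd (Overs xs ys) = ys @ xs"
| "cd (Unders xs ys) = ys @ xs"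
| "cd (e \<odot> f) = cd e"
| "cd (e \<oslash> f) = cd e @ cd f"

text \<open>\<open>over_wire\<close> and \<open>overs\<close> unfold the left and the right hexagon
  into crossings of single wires; \<open>wire_under\<close> and \<open>unders\<close> unfold the
  inverted hexagons, hence their reversed order of layers.\<close>

fun over_wire :: "nat list \<Rightarrow> nat \<Rightarrow> layer list" where
  "over_wire [] w = []"
| "over_wire (x # xs) w = shift 1 (over_wire xs w) @ [(0, Over x w)]"

fun overs :: "nat list \<Rightarrow> nat list \<Rightarrow> layer list" where
  "overs xs [] = []"
| "overs xs (y # ys) = over_wire xs y @ shift 1 (overs xs ys)"

fun wire_under :: "nat \<Rightarrow> nat list \<Rightarrow> layer list" where
  "wire_under x [] = []"
| "wire_under x (y # ys) = (0, Under x y) # shift 1 (wire_under x ys)"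

fun unders :: "nat list \<Rightarrow> nat list \<Rightarrow> layer list" where
  "unders [] ys = []"
| "unders (x # xs) ys = shift 1 (unders xs ys) @ wire_under x ys"

text \<open>In a tensor product the left factor is run first, so the right factor is shifted by the
  codomain of the left one and not by its domain.\<close>

fun lay :: "expr \<Rightarrow> layer list" where
  "lay (Idw xs) = []"
| "lay (Atom g) = [(0, g)]"
| "lay (Overs xs ys) = overs xs ys"
| "lay (Unders xs ys) = unders xs ys"
| "lay (e \<odot> f) = lay f @ lay e"
| "lay (e \<oslash> f) = lay e @ shift (length (cd e)) (lay f)"

fun wf_gen :: "gen list \<Rightarrow> gen \<Rightarrow> bool" where
  "wf_gen gs (Gen n d c) \<longleftrightarrow> Gen n d c \<in> set gs"
| "wf_gen gs g \<longleftrightarrow> True"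

fun wf_expr :: "gen list \<Rightarrow> expr \<Rightarrow> bool" where
  "wf_expr gs (Atom g) \<longleftrightarrow> wf_gen gs g"
| "wf_expr gs (e \<odot> f) \<longleftrightarrow> wf_expr gs e \<and> wf_expr gs f \<and> dm e = cd f"
| "wf_expr gs (e \<oslash> f) \<longleftrightarrow> wf_expr gs e \<and> wf_expr gs f"
| "wf_expr gs e \<longleftrightarrow> True"

lemma shift_Nil [simp]: "shift k [] = []"
  and shift_Cons [simp]: "shift k ((i, g) # ls) = (k + i, g) # shift k ls"
  and shift_append [simp]: "shift k (ls @ ls') = shift k ls @ shift k ls'"
  and length_shift [simp]: "length (shift k ls) = length ls"
  by (simp_all add: shift_def)

lemma out_append: "out xs (ls @ ls') = Option.bind (out xs ls) (\<lambda>ys. out ys ls')"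
  by (induction ls arbitrary: xs) auto

lemma fits_split:
  assumes "fits xs (i, g)"
  shows "xs = take i xs @ gdom g @ drop (i + length (gdom g)) xs"
  using assms by (metis append_take_drop_id drop_drop add.commute fits.simps)

lemma fits_whisker:
  "fits xs (i, g) \<Longrightarrow> fits (u @ xs @ v) (length u + i, g) \<and>
     take (length u + i) (u @ xs @ v) = u @ take i xs \<and>
     drop (length u + i + length (gdom g)) (u @ xs @ v) = drop (i + length (gdom g)) xs @ v"
proof -
  assume a: "fits xs (i, g)"
  then have "length (take (length (gdom g)) (drop i xs)) = length (gdom g)" "i \<le> length xs" by simp_all
  then have "i + length (gdom g) \<le> length xs"
    unfolding length_take length_drop min_def by (auto split: if_splits)
  then show ?thesis using a by auto
qed

lemma step_whisker:
  "fits xs (i, g) \<Longrightarrow> step (u @ xs @ v) (length u + i, g) = u @ step xs (i, g) @ v"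
  using fits_whisker[of xs i g u v] by auto

subsection \<open>Semantics of string diagrams\<close>

locale diagrams = word_category +
  fixes vs :: "nat \<Rightarrow> 'b"
begin

fun gval :: "gen \<Rightarrow> 'b" where
  "gval (Over a b) = \<Phi> (os a) (os b)"
| "gval (Under a b) = inv (\<Phi> (os b) (os a))"
| "gval (Gen n d c) = vs n"

definition gok :: "gen \<Rightarrow> bool" where
  "gok g \<longleftrightarrow> gval g \<in> Mor (gdom g) (gcod g)"

definition ok :: "layer list \<Rightarrow> bool" where
  "ok ls \<longleftrightarrow> (\<forall>l\<in>set ls. gok (snd l))"

lemma ok_simps [simp]: "ok []" "ok (l # ls) \<longleftrightarrow> gok (snd l) \<and> ok ls" "ok (ls @ ls') \<longleftrightarrow> ok ls \<and> ok ls'"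
  "ok (shift k ls) \<longleftrightarrow> ok ls"
  by (auto simp: ok_def shift_def)

lemma gok_braid [simp]: "gok (Over a b)" "gok (Under a b)"
  using braid_hom[of "os a" "os b"] braid_inv(1)[of "os b" "os a"]
  by (simp_all add: gok_def tobj_unit_right)

fun lval :: "nat list \<Rightarrow> layer \<Rightarrow> 'b" where
  "lval xs (i, g) = whisker (take i xs) (gval g) (drop (i + length (gdom g)) xs)"

fun run :: "nat list \<Rightarrow> layer list \<Rightarrow> 'b" where
  "run xs [] = idw xs"
| "run xs (l # ls) = run (step xs l) ls \<cdot> lval xs l"

fun sem :: "expr \<Rightarrow> 'b" where
  "sem (Idw xs) = idw xs"
| "sem (Atom g) = gval g"
| "sem (Overs xs ys) = \<Phi> (W xs) (W ys)"
| "sem (Unders xs ys) = inv (\<Phi> (W ys) (W xs))"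
| "sem (e \<odot> f) = sem e \<cdot> sem f"
| "sem (e \<oslash> f) = sem e \<otimes> sem f"

lemma lval_hom: "fits xs l \<Longrightarrow> gok (snd l) \<Longrightarrow> lval xs l \<in> Mor xs (step xs l)"
proof (cases l)
  case (Pair i g)
  assume "fits xs l" "gok (snd l)"
  then show ?thesis
    using whisker_hom[of "gval g" "gdom g" "gcod g" "take i xs" "drop (i + length (gdom g)) xs"] Pair
      fits_split[of xs i g, symmetric] by (simp add: gok_def)
qed

lemma run_hom: "out xs ls = Some ys \<Longrightarrow> ok ls \<Longrightarrow> run xs ls \<in> Mor xs ys"
  by (induction ls arbitrary: xs) (auto split: if_splits intro: mor_cmp lval_hom)

lemma run_append:
  "out xs ls = Some ys \<Longrightarrow> out ys ls' = Some zs \<Longrightarrow> ok ls \<Longrightarrow> ok ls' \<Longrightarrow> run xs (ls @ ls') = run ys ls' \<cdot> run xs ls"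
proof (induction ls arbitrary: xs)
  case Nil
  then show ?case using mor_id(1)[OF run_hom] by simp
next
  case (Cons l ls)
  then have f: "fits xs l" "out (step xs l) ls = Some ys"
    by (auto split: if_splits)
  with Cons show ?case
    using mor_assoc[OF lval_hom run_hom run_hom, OF f(1) _ f(2) _ Cons.prems(2)] by simp
qed

lemma run_whisker:
  "out xs ls = Some ys \<Longrightarrow> ok ls \<Longrightarrow>
    out (u @ xs @ v) (shift (length u) ls) = Some (u @ ys @ v) \<and>
    run (u @ xs @ v) (shift (length u) ls) = whisker u (run xs ls) v"
proof (induction ls arbitrary: xs)
  case (Cons l ls)
  obtain i g where l: "l = (i, g)" by (cases l)
  from Cons.prems l have f: "fits xs (i, g)" "out (step xs (i, g)) ls = Some ys" "gok g" "ok ls"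
    by (auto split: if_splits)
  note w = fits_whisker[OF f(1), of u v] step_whisker[OF f(1), of u v]
  note IH = Cons.IH[OF f(2,4)]
  have "lval (u @ xs @ v) (length u + i, g) = whisker u (lval xs (i, g)) v"
    unfolding lval.simps w(1)[THEN conjunct2, THEN conjunct1] w(1)[THEN conjunct2, THEN conjunct2]
    using whisker_whisker[of "gval g" "gdom g" "gcod g" u] f(3) by (simp add: gok_def)
  moreover have "whisker u (run (step xs (i, g)) ls) v \<cdot> whisker u (lval xs (i, g)) v
      = whisker u (run xs ((i, g) # ls)) v"
    using whisker_cmp[OF lval_hom[OF f(1)] run_hom[OF f(2,4)]] f by simp
  ultimately show ?case
    unfolding l shift_Cons out.simps run.simps(2) w(2) using IH w(1) by auto
qed simp

lemma run_lift:
  assumes "out xs ls = Some ys" "ok ls"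
  shows "out (u @ xs @ v) (shift (length u) ls) = Some (u @ ys @ v)"
    and "run (u @ xs @ v) (shift (length u) ls) = whisker u (run xs ls) v"
  using run_whisker[OF assms] by auto

lemma run_lift1:
  assumes "out xs ls = Some ys" "ok ls"
  shows "out (x # xs) (shift 1 ls) = Some (x # ys)"
    and "run (x # xs) (shift 1 ls) = whisker [x] (run xs ls) []"
  using run_whisker[OF assms, of "[x]" "[]"] by auto

lemma run_lift0:
  assumes "out xs ls = Some ys" "ok ls"
  shows "out (xs @ v) ls = Some (ys @ v)"
    and "run (xs @ v) ls = whisker [] (run xs ls) v"
proof -
  have "shift 0 ls = ls" by (simp add: shift_def)
  then show "out (xs @ v) ls = Some (ys @ v)" "run (xs @ v) ls = whisker [] (run xs ls) v"
    using run_whisker[OF assms, of "[]" v] by simp_all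
qed

lemma whisker_left: "f \<in> Mor xs ys \<Longrightarrow> whisker u f [] = idw u \<otimes> f"
  and whisker_right: "f \<in> Mor xs ys \<Longrightarrow> whisker [] f v = f \<otimes> idw v"
  by (auto simp: whisker_def tarr_unit_right tarr_unit_left hom_arr tarr_hom[OF arr_homD arr_homD, THEN hom_arr] hom_arr[OF idw_hom])

lemma over_wire:
  "out (xs @ [w]) (over_wire xs w) = Some (w # xs) \<and> ok (over_wire xs w)
    \<and> run (xs @ [w]) (over_wire xs w) = \<Phi> (W xs) (os w)"
proof (induction xs)
  case (Cons x xs)
  have b: "\<Phi> (os x) (os w) \<in> Mor [x, w] [w, x]"
    using gok_braid(1)[of x w] by (simp add: gok_def)
  note r = run_lift1[of "xs @ [w]" "over_wire xs w", of "w # xs" x]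
  have h: "whisker [x] (\<Phi> (W xs) (os w)) [] \<in> Mor (x # xs @ [w]) (x # w # xs)"
    using run_hom[OF r(1)] r(2) Cons by simp
  have o: "out (x # w # xs) [(0, Over x w)] = Some (w # x # xs)" by simp
  have 1: "run (x # w # xs) [(0, Over x w)] = whisker [] (\<Phi> (os x) (os w)) xs"
    using mor_id(2)[OF whisker_hom[OF b, of "[]" xs]] by simp
  have 2: "\<Phi> (W (x # xs)) (os w) = whisker [] (\<Phi> (os x) (os w)) xs \<cdot> whisker [x] (\<Phi> (W xs) (os w)) []"
    using hexagon_left[of "os x" "W xs" "os w"] whisker_right[OF b, of xs] whisker_left[of "\<Phi> (W xs) (os w)" "xs @ [w]" "w # xs" "[x]"]
      braid_hom[of "W xs" "os w"] by (simp add: W_append)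
  show ?case
    using Cons r o 1 2 run_append[OF r(1) o] by (simp add: out_append)
qed (simp add: braid_unit)

lemma overs:
  "out (xs @ ys) (overs xs ys) = Some (ys @ xs) \<and> ok (overs xs ys)
    \<and> run (xs @ ys) (overs xs ys) = \<Phi> (W xs) (W ys)"
proof (induction ys)
  case (Cons y ys)
  note r = run_lift0[of "xs @ [y]" "over_wire xs y", of "y # xs" ys]
  note s = run_lift1[of "xs @ ys" "overs xs ys", of "ys @ xs" y]
  have "\<Phi> (W xs) (W (y # ys)) = whisker [y] (\<Phi> (W xs) (W ys)) [] \<cdot> whisker [] (\<Phi> (W xs) (os y)) ys"
    using hexagon_right[of "W xs" "os y" "W ys"] whisker_left[of "\<Phi> (W xs) (W ys)" "xs @ ys" "ys @ xs" "[y]"]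
     whisker_right[of "\<Phi> (W xs) (os y)" "xs @ [y]" "y # xs" ys]
     braid_hom[of "W xs" "W ys"] braid_hom[of "W xs" "os y"] by (simp add: W_append tobj_unit_right)
  then show ?case
    using Cons r s over_wire[of xs y] run_append[of "xs @ y # ys" "over_wire xs y" "y # xs @ ys" "shift 1 (overs xs ys)" "y # ys @ xs"]
    by (simp add: out_append)
qed (simp add: braid_unit)

lemma inv_whisker:
  assumes "is_iso C f" "f \<in> Mor xs ys"
  shows "inv (whisker u f v) = whisker u (inv f) v" "is_iso C (whisker u f v)"
proof -
  have i: "is_iso C (idw t)" for t
    by (rule arr_invI(2)[OF idw_hom idw_hom]) (use mor_id(1)[OF idw_hom] in auto)
  show "inv (whisker u f v) = whisker u (inv f) v" "is_iso C (whisker u f v)"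
    unfolding whisker_def using inv_tarr[OF i idw_hom inv_tarr(2)[OF assms i idw_hom] tarr_hom[OF assms(2) idw_hom]] inv_tarr[OF assms i idw_hom]
    by (simp_all add: inv_ident)
qed

lemma wire_under:
  "out (x # ys) (wire_under x ys) = Some (ys @ [x]) \<and> ok (wire_under x ys)
    \<and> run (x # ys) (wire_under x ys) = inv (\<Phi> (W ys) (os x))"
proof (induction ys)
  case (Cons y ys)
  have b: "\<Phi> (os y) (os x) \<in> Mor [y, x] [x, y]" "\<Phi> (W ys) (os x) \<in> Mor (ys @ [x]) (x # ys)"
    using gok_braid(1)[of y x] braid_hom[of "W ys" "os x"] by (simp_all add: gok_def W_append)
  have hx: "\<Phi> (W (y # ys)) (os x) = whisker [] (\<Phi> (os y) (os x)) ys \<cdot> whisker [y] (\<Phi> (W ys) (os x)) []"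
    using hexagon_left[of "os y" "W ys" "os x"] whisker_right[OF b(1)] whisker_left[OF b(2)] by simp
  note i = inv_whisker[OF braid_iso b(1), of "[]" ys] inv_whisker[OF braid_iso b(2), of "[y]" "[]"]
  have "inv (\<Phi> (W (y # ys)) (os x)) = whisker [y] (inv (\<Phi> (W ys) (os x))) [] \<cdot> whisker [] (inv (\<Phi> (os y) (os x))) ys"
    unfolding hx using inv_cmp(1)[OF i(4) whisker_hom[OF b(2)] i(2)] whisker_hom[OF b(1), of "[]" ys] i by simp
  then show ?case
    using Cons run_lift1[of "x # ys" "wire_under x ys" "ys @ [x]" y] by simp
qed (simp add: braid_unit inv_ident)

lemma unders:
  "out (xs @ ys) (unders xs ys) = Some (ys @ xs) \<and> ok (unders xs ys)
    \<and> run (xs @ ys) (unders xs ys) = inv (\<Phi> (W ys) (W xs))"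
proof (induction xs)
  case (Cons x xs)
  have b: "\<Phi> (W ys) (os x) \<in> Mor (ys @ [x]) (x # ys)" "\<Phi> (W ys) (W xs) \<in> Mor (ys @ xs) (xs @ ys)"
    using braid_hom[of "W ys" "os x"] braid_hom[of "W ys" "W xs"] by (simp_all add: W_append tobj_unit_right)
  have hx: "\<Phi> (W ys) (W (x # xs)) = whisker [x] (\<Phi> (W ys) (W xs)) [] \<cdot> whisker [] (\<Phi> (W ys) (os x)) xs"
    using hexagon_right[of "W ys" "os x" "W xs"] whisker_right[OF b(1)] whisker_left[OF b(2)] by simp
  note i = inv_whisker[OF braid_iso b(1), of "[]" xs] inv_whisker[OF braid_iso b(2), of "[x]" "[]"]
  have hy: "inv (\<Phi> (W ys) (W (x # xs))) = whisker [] (inv (\<Phi> (W ys) (os x))) xs \<cdot> whisker [x] (inv (\<Phi> (W ys) (W xs))) []"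
    unfolding hx using inv_cmp(1)[OF i(2) whisker_hom[OF b(1)] i(4)] whisker_hom[OF b(2), of "[x]" "[]"] i by simp
  note r = run_lift0[of "x # ys" "wire_under x ys" "ys @ [x]" xs]
  note s = run_lift1[of "xs @ ys" "unders xs ys" "ys @ xs" x]
  show ?case
    using Cons r s wire_under[of x ys] hy
      run_append[of "x # xs @ ys" "shift 1 (unders xs ys)" "x # ys @ xs" "wire_under x ys" "ys @ x # xs"]
    by (simp add: out_append)
qed (simp add: braid_unit inv_ident)

definition sig_ok :: "gen list \<Rightarrow> bool" where
  "sig_ok gs \<longleftrightarrow> (\<forall>g\<in>set gs. gok g)"

lemma wf_gen_ok: "sig_ok gs \<Longrightarrow> wf_gen gs g \<Longrightarrow> gok g"
  by (cases g) (auto simp: sig_ok_def)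

text \<open>The bridge of the reflection: moves act on lists of layers, whereas the equations wanted
  are between values of expressions. The crossing cases are the unfolded hexagons, the tensor case
  is the interchange law.\<close>

lemma run_lay:
  assumes "sig_ok gs"
  shows "wf_expr gs e \<Longrightarrow> out (dm e) (lay e) = Some (cd e) \<and> ok (lay e) \<and> run (dm e) (lay e) = sem e"
proof (induction e)
  case (Idw xs)
  then show ?case by simp
next
  case (Atom g)
  then have g: "gok g" using wf_gen_ok assms by simp
  then show ?case
    using mor_id(2) by (simp add: gok_def)
next
  case (Overs xs ys)
  then show ?case using overs[of xs ys] by simp
next
  case (Unders xs ys)
  then show ?case using unders[of xs ys] by simp
next
  case (Comp e f)
  then have "out (dm f) (lay f) = Some (cd f)" "ok (lay f)" "run (dm f) (lay f) = sem f"
    "out (cd f) (lay e) = Some (cd e)" "ok (lay e)" "run (cd f) (lay e) = sem e"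
    by simp_all
  then show ?case using run_append by (simp add: out_append)
next
  case (Tens e f)
  then have e: "out (dm e) (lay e) = Some (cd e)" "ok (lay e)" "run (dm e) (lay e) = sem e"
    and f: "out (dm f) (lay f) = Some (cd f)" "ok (lay f)" "run (dm f) (lay f) = sem f"
    by simp_all
  have h: "sem e \<in> Mor (dm e) (cd e)" "sem f \<in> Mor (dm f) (cd f)"
    using run_hom e f by metis+
  note r = run_lift0[OF e(1,2), of "dm f"] run_lift[OF f(1,2), of "cd e" "[]", simplified]
  show ?case
    using run_append[OF r(1,3)] r e f tensor_whisker(1)[OF h] by (simp add: out_append)
qed

lemma sem_hom: "sig_ok gs \<Longrightarrow> wf_expr gs e \<Longrightarrow> sem e \<in> Mor (dm e) (cd e)"
  using run_lay run_hom by metis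

end

subsection \<open>Planar rewriting\<close>

datatype move = SR nat | SL nat | NF nat nat | NB nat nat | CF nat | CB nat nat nat | RW nat nat nat | WR nat nat nat

fun swap_right :: "nat \<Rightarrow> layer list \<Rightarrow> layer list option" where
  "swap_right 0 ((a, g) # (b, h) # ls) =
     (if a + length (gcod g) \<le> b then Some ((b - length (gcod g) + length (gdom g), h) # (a, g) # ls) else None)"
| "swap_right (Suc n) (l # ls) = map_option (Cons l) (swap_right n ls)"
| "swap_right n ls = None"

fun swap_left :: "nat \<Rightarrow> layer list \<Rightarrow> layer list option" where
  "swap_left 0 ((a, g) # (b, h) # ls) =
     (if b + length (gdom h) \<le> a then Some ((b, h) # (a - length (gdom h) + length (gcod h), g) # ls) else None)"
| "swap_left (Suc n) (l # ls) = map_option (Cons l) (swap_left n ls)"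
| "swap_left n ls = None"

fun rewrite :: "expr \<Rightarrow> expr \<Rightarrow> nat list \<Rightarrow> nat \<Rightarrow> nat \<Rightarrow> layer list \<Rightarrow> layer list option" where
  "rewrite e e' xs 0 k ls =
     (if take (length (lay e)) ls = shift k (lay e) \<and> k \<le> length xs \<and> take (length (dm e)) (drop k xs) = dm e
      then Some (shift k (lay e') @ drop (length (lay e)) ls) else None)"
| "rewrite e e' xs (Suc p) k (l # ls) = map_option (Cons l) (rewrite e e' (step xs l) p k ls)"
| "rewrite e e' xs (Suc p) k [] = None"

text \<open>The four naturality squares: \<open>c\<close> = 0, 1 for the braiding, 2, 3 for its
  inverse. On the second side of the rule the generator follows \<open>length (gdom g)\<close>
  crossings; this is the number that \<open>NB\<close> subtracts to find the start of the
  pattern.\<close>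

definition slide :: "nat \<Rightarrow> gen \<Rightarrow> nat \<Rightarrow> expr \<times> expr" where
  "slide c g w =
    (if c = 0 then (Overs (gcod g) [w] \<odot> (Atom g \<oslash> Idw [w]), (Idw [w] \<oslash> Atom g) \<odot> Overs (gdom g) [w])
     else if c = 1 then (Overs [w] (gcod g) \<odot> (Idw [w] \<oslash> Atom g), (Atom g \<oslash> Idw [w]) \<odot> Overs [w] (gdom g))
     else if c = 2 then (Unders (gcod g) [w] \<odot> (Atom g \<oslash> Idw [w]), (Idw [w] \<oslash> Atom g) \<odot> Unders (gdom g) [w])
     else (Unders [w] (gcod g) \<odot> (Idw [w] \<oslash> Atom g), (Atom g \<oslash> Idw [w]) \<odot> Unders [w] (gdom g)))"

definition cancel :: "nat \<Rightarrow> nat \<Rightarrow> nat \<Rightarrow> expr \<times> expr" where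
  "cancel c a b =
    (if c = 0 then (Atom (Under b a) \<odot> Atom (Over a b), Idw [a, b])
     else (Atom (Over b a) \<odot> Atom (Under a b), Idw [a, b]))"

fun state :: "nat list \<Rightarrow> nat \<Rightarrow> layer list \<Rightarrow> nat list" where
  "state xs 0 ls = xs"
| "state xs (Suc n) [] = xs"
| "state xs (Suc n) (l # ls) = state (step xs l) n ls"

abbreviation rewrite_rule :: "expr \<times> expr \<Rightarrow> nat list \<Rightarrow> nat \<Rightarrow> nat \<Rightarrow> layer list \<Rightarrow> layer list option" where
  "rewrite_rule r xs p k ls \<equiv> rewrite (fst r) (snd r) xs p k ls"

abbreviation unrewrite_rule :: "expr \<times> expr \<Rightarrow> nat list \<Rightarrow> nat \<Rightarrow> nat \<Rightarrow> layer list \<Rightarrow> layer list option" where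
  "unrewrite_rule r xs p k ls \<equiv> rewrite (snd r) (fst r) xs p k ls"

text \<open>The default values here and in \<open>wire_at\<close> and \<open>rule_at\<close> cannot
  harm soundness: whichever layer, wire or rule is returned, the rule built from it holds, and it is
  applied only where its layers match.\<close>

fun gen_at :: "nat \<Rightarrow> layer list \<Rightarrow> layer" where
  "gen_at n [] = (0, Over 0 0)"
| "gen_at 0 (l # ls) = l"
| "gen_at (Suc n) (l # ls) = gen_at n ls"

fun wire_at :: "nat \<Rightarrow> nat list \<Rightarrow> nat" where
  "wire_at n [] = 0"
| "wire_at 0 (x # xs) = x"
| "wire_at (Suc n) (x # xs) = wire_at n xs"

fun rule_at :: "nat \<Rightarrow> (expr \<times> expr) list \<Rightarrow> expr \<times> expr" where
  "rule_at n [] = (Idw [], Idw [])"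
| "rule_at 0 (r # rs) = r"
| "rule_at (Suc n) (r # rs) = rule_at n rs"

text \<open>
  \<open>SR\<close> and \<open>SL\<close> interchange two layers, \<open>NF\<close> and \<open>NB\<close> use naturality of the braiding, \<open>CF\<close> and \<open>CB\<close>
  cancel and create inverse braidings, \<open>RW\<close> and \<open>WR\<close> apply the rule number \<open>r\<close> forwards and backwards.
  In a move, \<open>p\<close> is the index of a layer and \<open>k\<close> the number of wires to its left; for \<open>NF\<close> and \<open>NB\<close>
  the layer \<open>p\<close> is the one carrying the generator that is slid through a wire on its right
  (\<open>c\<close> even) or on its left (\<open>c\<close> odd).
\<close>

fun apply_move :: "(expr \<times> expr) list \<Rightarrow> nat list \<Rightarrow> move \<Rightarrow> layer list \<Rightarrow> layer list option" where
  "apply_move rs xs (SR i) ls = swap_right i ls"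
| "apply_move rs xs (SL i) ls = swap_left i ls"
| "apply_move rs xs (NF c p) ls = (case gen_at p ls of (i, g) \<Rightarrow>
     if c = 0 \<or> c = 2 then rewrite_rule (slide c g (wire_at (i + length (gdom g)) (state xs p ls))) xs p i ls
     else rewrite_rule (slide c g (wire_at (i - 1) (state xs p ls))) xs p (i - 1) ls)"
| "apply_move rs xs (NB c p) ls = (case gen_at p ls of (i, g) \<Rightarrow>
     if c = 0 \<or> c = 2 then unrewrite_rule (slide c g (wire_at (i - 1) (state xs p ls))) xs (p - length (gdom g)) (i - 1) ls
     else unrewrite_rule (slide c g (wire_at (i + length (gdom g)) (state xs p ls))) xs (p - length (gdom g)) i ls)"
| "apply_move rs xs (CF p) ls = (case gen_at p ls of
     (i, Over a b) \<Rightarrow> rewrite_rule (cancel 0 a b) xs p i ls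
   | (i, Under a b) \<Rightarrow> rewrite_rule (cancel 1 a b) xs p i ls
   | _ \<Rightarrow> None)"
| "apply_move rs xs (CB c p k) ls =
     unrewrite_rule (cancel c (wire_at k (state xs p ls)) (wire_at (k + 1) (state xs p ls))) xs p k ls"
| "apply_move rs xs (RW r p k) ls = rewrite_rule (rule_at r rs) xs p k ls"
| "apply_move rs xs (WR r p k) ls = unrewrite_rule (rule_at r rs) xs p k ls"

fun apply_moves :: "(expr \<times> expr) list \<Rightarrow> nat list \<Rightarrow> move list \<Rightarrow> layer list \<Rightarrow> layer list option" where
  "apply_moves rs xs [] ls = Some ls"
| "apply_moves rs xs (m # ms) ls = (case apply_move rs xs m ls of None \<Rightarrow> None | Some ls' \<Rightarrow> apply_moves rs xs ms ls')"

fun wf_rule :: "gen list \<Rightarrow> expr \<times> expr \<Rightarrow> bool" where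
  "wf_rule gs (e, e') \<longleftrightarrow> wf_expr gs e \<and> wf_expr gs e' \<and> dm e = dm e' \<and> cd e = cd e'"

text \<open>Only numbers and lists occur here, so the condition can be evaluated without reference
  to the category. Well-formed rules have equal boundaries on both sides, which is what allows
  replacement inside a larger diagram.\<close>

definition check :: "gen list \<Rightarrow> (expr \<times> expr) list \<Rightarrow> move list \<Rightarrow> expr \<times> expr \<Rightarrow> bool" where
  "check gs rs ms r \<longleftrightarrow> list_all (wf_rule gs) rs \<and> wf_rule gs r
     \<and> apply_moves rs (dm (fst r)) ms (lay (fst r)) = Some (lay (snd r))"

context diagrams
begin

text \<open>The second generator lies to the right of everything the first one produces. Before the
  first has run, its position differs by the change in length, hence
  \<open>b - length (gcod g) + length (gdom g)\<close>.\<close>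

lemma lval_swap_right:
  assumes "fits xs (a, g)" "fits (step xs (a, g)) (b, h)" "gok g" "gok h" "a + length (gcod g) \<le> b"
  defines "l1 \<equiv> (b - length (gcod g) + length (gdom g), h)" and "l2 \<equiv> (a, g)"
  shows "fits xs l1" "fits (step xs l1) l2" "step (step xs l1) l2 = step (step xs (a, g)) (b, h)"
    "lval (step xs l1) l2 \<cdot> lval xs l1 = lval (step xs (a, g)) (b, h) \<cdot> lval xs (a, g)"
proof -
  obtain u r where xs: "xs = u @ gdom g @ r" "length u = a"
    using fits_split[OF assms(1)] assms(1) by (metis fits.simps length_take min.absorb2)
  have st: "step xs (a, g) = u @ gcod g @ r" using xs by simp
  define j where "j = b - a - length (gcod g)"
  have f: "fits r (j, h)" using assms(2,5) st xs(2) by (auto simp: j_def)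
  then obtain v w where r: "r = v @ gdom h @ w" "length v = j"
    using fits_split[OF f] by (metis fits.simps length_take min.absorb2)
  have b: "b = a + length (gcod g) + j" using assms(5) by (simp add: j_def)
  have h: "gval g \<in> Mor (gdom g) (gcod g)" "gval h \<in> Mor (gdom h) (gcod h)"
    using assms by (auto simp: gok_def)
  show "fits xs l1" "fits (step xs l1) l2" "step (step xs l1) l2 = step (step xs (a, g)) (b, h)"
    using xs r b by (auto simp: l1_def l2_def)
  show "lval (step xs l1) l2 \<cdot> lval xs l1 = lval (step xs (a, g)) (b, h) \<cdot> lval xs (a, g)"
    using xs r b whisker_exchange[OF h, of u v w] by (simp add: l1_def l2_def)
qed

lemma lval_swap_left:
  assumes "fits xs (a, g)" "fits (step xs (a, g)) (b, h)" "gok g" "gok h" "b + length (gdom h) \<le> a"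
  defines "l1 \<equiv> (b, h)" and "l2 \<equiv> (a - length (gdom h) + length (gcod h), g)"
  shows "fits xs l1" "fits (step xs l1) l2" "step (step xs l1) l2 = step (step xs (a, g)) (b, h)"
    "lval (step xs l1) l2 \<cdot> lval xs l1 = lval (step xs (a, g)) (b, h) \<cdot> lval xs (a, g)"
proof -
  obtain p w where xs: "xs = p @ gdom g @ w" "length p = a"
    using fits_split[OF assms(1)] assms(1) by (metis fits.simps length_take min.absorb2)
  have st: "step xs (a, g) = p @ gcod g @ w" using xs by simp
  have f: "fits p (b, h)" using assms(2)[unfolded st] assms(5) xs(2) by auto
  obtain u v where p: "p = u @ gdom h @ v" "length u = b"
    using fits_split[OF f] f by (metis fits.simps length_take min.absorb2)
  have h: "gval g \<in> Mor (gdom g) (gcod g)" "gval h \<in> Mor (gdom h) (gcod h)"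
    using assms by (auto simp: gok_def)
  have a: "a = b + length (gdom h) + length v" using xs(2) p by simp
  show "fits xs l1" "fits (step xs l1) l2" "step (step xs l1) l2 = step (step xs (a, g)) (b, h)"
    using xs p a by (auto simp: l1_def l2_def)
  show "lval (step xs l1) l2 \<cdot> lval xs l1 = lval (step xs (a, g)) (b, h) \<cdot> lval xs (a, g)"
    using xs p a whisker_exchange[OF h(2,1), of u v w] by (simp add: l1_def l2_def)
qed

lemma run_exchange:
  assumes "fits xs l1" "fits (step xs l1) l2" "step (step xs l1) l2 = step (step xs l1') l2'"
    "fits xs l1'" "fits (step xs l1') l2'"
    "lval (step xs l1) l2 \<cdot> lval xs l1 = lval (step xs l1') l2' \<cdot> lval xs l1'"
    "gok (snd l1)" "gok (snd l2)" "gok (snd l1')" "gok (snd l2')" "ok ls"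
    "out (step (step xs l1') l2') ls = Some ys"
  shows "run xs (l1 # l2 # ls) = run xs (l1' # l2' # ls)"
proof -
  have "run xs (l1 # l2 # ls) = run (step (step xs l1) l2) ls \<cdot> (lval (step xs l1) l2 \<cdot> lval xs l1)"
    unfolding run.simps
    by (rule mor_assoc[OF lval_hom[OF assms(1,7)] lval_hom[OF assms(2,8)] run_hom[of _ ls ys]]) (use assms in simp_all)
  also have "\<dots> = run (step (step xs l1') l2') ls \<cdot> (lval (step xs l1') l2' \<cdot> lval xs l1')"
    unfolding assms(3,6) ..
  also have "\<dots> = run xs (l1' # l2' # ls)"
    unfolding run.simps
    by (rule mor_assoc[OF lval_hom[OF assms(4,9)] lval_hom[OF assms(5,10)] run_hom[of _ ls ys], symmetric]) (use assms in simp_all)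
  finally show ?thesis .
qed

lemma swap_right_sound:
  "swap_right i ls = Some ls' \<Longrightarrow> out xs ls = Some ys \<Longrightarrow> ok ls \<Longrightarrow> out xs ls' = Some ys \<and> ok ls' \<and> run xs ls' = run xs ls"
proof (induction i ls arbitrary: xs ls' rule: swap_right.induct)
  case (1 a g b h ls)
  then have c: "fits xs (a, g)" "fits (step xs (a, g)) (b, h)" "gok g" "gok h" "a + length (gcod g) \<le> b" "ok ls"
    "out (step (step xs (a, g)) (b, h)) ls = Some ys"
    by (auto split: if_splits)
  note s = lval_swap_right[OF c(1-5)]
  show ?case
    using run_exchange[OF s(1,2,3) c(1,2) s(4)] s c 1 by (auto simp del: fits.simps step.simps lval.simps split: if_splits)
next
  case (2 n l ls)
  then show ?case by (auto split: if_splits)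
qed auto

lemma swap_left_sound:
  "swap_left i ls = Some ls' \<Longrightarrow> out xs ls = Some ys \<Longrightarrow> ok ls \<Longrightarrow> out xs ls' = Some ys \<and> ok ls' \<and> run xs ls' = run xs ls"
proof (induction i ls arbitrary: xs ls' rule: swap_left.induct)
  case (1 a g b h ls)
  then have c: "fits xs (a, g)" "fits (step xs (a, g)) (b, h)" "gok g" "gok h" "b + length (gdom h) \<le> a" "ok ls"
    "out (step (step xs (a, g)) (b, h)) ls = Some ys"
    by (auto split: if_splits)
  note s = lval_swap_left[OF c(1-5)]
  show ?case
    using run_exchange[OF s(1,2,3) c(1,2) s(4)] s c 1 by (auto simp del: fits.simps step.simps lval.simps split: if_splits)
next
  case (2 n l ls)
  then show ?case by (auto split: if_splits)
qed auto

definition holds :: "expr \<times> expr \<Rightarrow> bool" where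
  "holds r \<longleftrightarrow> sem (fst r) = sem (snd r)"

lemma rewrite_sound:
  assumes "sig_ok gs" "wf_rule gs (e, e')" "sem e = sem e'"
  shows "rewrite e e' xs p k ls = Some ls' \<Longrightarrow> out xs ls = Some ys \<Longrightarrow> ok ls \<Longrightarrow>
    out xs ls' = Some ys \<and> ok ls' \<and> run xs ls' = run xs ls"
proof (induction p arbitrary: xs ls ls')
  case 0
  then have c: "take (length (lay e)) ls = shift k (lay e)" "k \<le> length xs" "take (length (dm e)) (drop k xs) = dm e"
    "ls' = shift k (lay e') @ drop (length (lay e)) ls"
    by (auto split: if_splits)
  have "xs = take k xs @ dm e @ drop (length (dm e)) (drop k xs)"
    using c(3) by (metis append_take_drop_id)
  then obtain u v where u: "xs = u @ dm e @ v" "length u = k"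
    using c(2) by (metis length_take min.absorb2)
  have "ls = shift k (lay e) @ drop (length (lay e)) ls"
    using c(1) by (metis append_take_drop_id)
  then obtain q where q: "ls = shift k (lay e) @ q" "ls' = shift k (lay e') @ q"
    using c(4) by blast
  have w: "wf_expr gs e" "wf_expr gs e'" "dm e' = dm e" "cd e' = cd e"
    using assms(2) by auto
  note E = run_lay[OF assms(1) w(1)] and E' = run_lay[OF assms(1) w(2)]
  note r = run_lift[of "dm e" "lay e" "cd e" u v] run_lift[of "dm e" "lay e'" "cd e" u v]
  have o: "out (u @ cd e @ v) q = Some ys" "ok q"
    using 0 q r E u by (auto simp: out_append)
  show ?case
    using run_append[of xs "shift k (lay e)" "u @ cd e @ v" q ys] run_append[of xs "shift k (lay e')" "u @ cd e @ v" q ys]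
      E E' r u w o q assms(3) by (simp add: out_append)
next
  case (Suc p)
  then show ?case by (cases ls) (auto split: if_splits)
qed

lemma braid_inv_natural:
  assumes "f \<in> Hom X Y" "g \<in> Hom Z W'"
  shows "inv (\<Phi> Y W') \<cdot> (g \<otimes> f) = (f \<otimes> g) \<cdot> inv (\<Phi> X Z)"
proof -
  note o = hom_obj[OF assms(1)] hom_obj[OF assms(2)]
  note i = braid_inv[OF o(2) o(4)] braid_inv[OF o(1) o(3)]
  note b = braid_hom[OF o(2) o(4)] braid_hom[OF o(1) o(3)]
  note t = tarr_hom[OF assms] tarr_hom[OF assms(2,1)]
  have "inv (\<Phi> Y W') \<cdot> (g \<otimes> f) = inv (\<Phi> Y W') \<cdot> ((g \<otimes> f) \<cdot> (\<Phi> X Z \<cdot> inv (\<Phi> X Z)))"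
    using i t cmp_ident_right by simp
  also have "\<dots> = inv (\<Phi> Y W') \<cdot> ((\<Phi> Y W' \<cdot> (f \<otimes> g)) \<cdot> inv (\<Phi> X Z))"
    using cmp_assoc[OF i(4) b(2) t(2)] braid_natural[OF assms] by simp
  also have "\<dots> = ((inv (\<Phi> Y W') \<cdot> \<Phi> Y W') \<cdot> (f \<otimes> g)) \<cdot> inv (\<Phi> X Z)"
    using cmp_assoc[OF i(4) cmp_hom[OF t(1) b(1)] i(1)] cmp_assoc[OF t(1) b(1) i(1)] by simp
  also have "\<dots> = (f \<otimes> g) \<cdot> inv (\<Phi> X Z)"
    using i cmp_ident_left[OF t(1)] by simp
  finally show ?thesis .
qed

lemma rewrite_rule_sound:
  assumes "sig_ok gs" "wf_rule gs r" "holds r" "out xs ls = Some ys" "ok ls"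
  shows "rewrite_rule r xs p k ls = Some ls' \<Longrightarrow> out xs ls' = Some ys \<and> ok ls' \<and> run xs ls' = run xs ls"
    and "unrewrite_rule r xs p k ls = Some ls' \<Longrightarrow> out xs ls' = Some ys \<and> ok ls' \<and> run xs ls' = run xs ls"
proof -
  obtain e e' where r: "r = (e, e')" by force
  have w: "wf_rule gs (e', e)" "sem e = sem e'" "sem e' = sem e"
    using assms by (auto simp: r holds_def)
  show "rewrite_rule r xs p k ls = Some ls' \<Longrightarrow> out xs ls' = Some ys \<and> ok ls' \<and> run xs ls' = run xs ls"
    using rewrite_sound[OF assms(1) _ w(2) _ assms(4,5)] assms(2) unfolding r fst_conv snd_conv by blast
  show "unrewrite_rule r xs p k ls = Some ls' \<Longrightarrow> out xs ls' = Some ys \<and> ok ls' \<and> run xs ls' = run xs ls"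
    using rewrite_sound[OF assms(1) w(1,3) _ assms(4,5)] unfolding r fst_conv snd_conv by blast
qed

lemma slide_holds:
  assumes "gok g"
  shows "holds (slide c g w)"
proof -
  have g: "gval g \<in> Mor (gdom g) (gcod g)"
    using assms by (simp add: gok_def)
  have w: "\<langle>os w\<rangle> \<in> Hom (os w) (os w)"
    by (simp add: ident_hom)
  show ?thesis
    using braid_natural[OF g w] braid_natural[OF w g] braid_inv_natural[OF g w] braid_inv_natural[OF w g]
    by (simp add: holds_def slide_def)
qed

lemma cancel_holds: "holds (cancel c a b)"
  using braid_inv[of "os a" "os b"] braid_inv[of "os b" "os a"] by (simp add: holds_def cancel_def)

lemma gok_wf: "gok g \<Longrightarrow> \<exists>gs. sig_ok gs \<and> wf_gen gs g"
  by (rule exI[of _ "[g]"], cases g) (auto simp: sig_ok_def)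

lemma rewrite_slide:
  assumes "gok g" "out xs ls = Some ys" "ok ls"
  shows "rewrite_rule (slide c g w) xs p k ls = Some ls' \<Longrightarrow> out xs ls' = Some ys \<and> ok ls' \<and> run xs ls' = run xs ls"
    and "unrewrite_rule (slide c g w) xs p k ls = Some ls' \<Longrightarrow> out xs ls' = Some ys \<and> ok ls' \<and> run xs ls' = run xs ls"
proof -
  obtain gs where gs: "sig_ok gs" "wf_gen gs g"
    using gok_wf[OF assms(1)] by blast
  have wf: "wf_rule gs (slide c g w)"
    using gs by (simp add: slide_def)
  show "rewrite_rule (slide c g w) xs p k ls = Some ls' \<Longrightarrow> out xs ls' = Some ys \<and> ok ls' \<and> run xs ls' = run xs ls"
    and "unrewrite_rule (slide c g w) xs p k ls = Some ls' \<Longrightarrow> out xs ls' = Some ys \<and> ok ls' \<and> run xs ls' = run xs ls"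
    by (rule rewrite_rule_sound[OF gs(1) wf slide_holds[OF assms(1)] assms(2,3)], assumption)+
qed

lemma rewrite_cancel:
  assumes "out xs ls = Some ys" "ok ls"
  shows "rewrite_rule (cancel c a b) xs p k ls = Some ls' \<Longrightarrow> out xs ls' = Some ys \<and> ok ls' \<and> run xs ls' = run xs ls"
    and "unrewrite_rule (cancel c a b) xs p k ls = Some ls' \<Longrightarrow> out xs ls' = Some ys \<and> ok ls' \<and> run xs ls' = run xs ls"
proof -
  have gs: "sig_ok []" by (simp add: sig_ok_def)
  have wf: "wf_rule [] (cancel c a b)"
    by (simp add: cancel_def)
  show "rewrite_rule (cancel c a b) xs p k ls = Some ls' \<Longrightarrow> out xs ls' = Some ys \<and> ok ls' \<and> run xs ls' = run xs ls"
    and "unrewrite_rule (cancel c a b) xs p k ls = Some ls' \<Longrightarrow> out xs ls' = Some ys \<and> ok ls' \<and> run xs ls' = run xs ls"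
    by (rule rewrite_rule_sound[OF gs wf cancel_holds assms], assumption)+
qed

lemma gen_at_ok: "ok ls \<Longrightarrow> gok (snd (gen_at p ls))"
  by (induction p ls rule: gen_at.induct) auto

lemma rule_at_sound:
  assumes "list_all (wf_rule gs) rs" "\<forall>r\<in>set rs. holds r"
  shows "wf_rule gs (rule_at n rs)" "holds (rule_at n rs)"
  using assms by (induction n rs rule: rule_at.induct) (auto simp: holds_def)

lemma apply_move_sound:
  assumes "sig_ok gs" "list_all (wf_rule gs) rs" "\<forall>r\<in>set rs. holds r"
    and "apply_move rs xs m ls = Some ls'" "out xs ls = Some ys" "ok ls"
  shows "out xs ls' = Some ys \<and> ok ls' \<and> run xs ls' = run xs ls"
proof -
  have g: "gok g" if "gen_at p ls = (i, g)" for p i g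
    using gen_at_ok[OF assms(6), of p] that by simp
  note s = rewrite_slide[OF g assms(5,6)]
  note r = rewrite_rule_sound[OF assms(1) rule_at_sound(1)[OF assms(2,3)] rule_at_sound(2)[OF assms(2,3)] assms(5,6)]
  show ?thesis
  proof (cases m)
    case (NF c p)
    obtain i g where ig: "gen_at p ls = (i, g)" by force
    show ?thesis
      using assms(4) s[OF ig] unfolding NF by (auto simp: ig split: if_splits)
  next
    case (NB c p)
    obtain i g where ig: "gen_at p ls = (i, g)" by force
    show ?thesis
      using assms(4) s[OF ig] unfolding NB by (auto simp: ig split: if_splits)
  next
    case (CF p)
    then show ?thesis
      using assms(4) rewrite_cancel[OF assms(5,6)] by (auto split: prod.splits gen.splits)
  next
    case (CB c p k)
    then show ?thesis
      using assms(4) rewrite_cancel[OF assms(5,6)] by auto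
  qed (use assms r swap_right_sound swap_left_sound in auto)
qed

lemma apply_moves_sound:
  assumes "sig_ok gs" "list_all (wf_rule gs) rs" "\<forall>r\<in>set rs. holds r"
  shows "apply_moves rs xs ms ls = Some ls' \<Longrightarrow> out xs ls = Some ys \<Longrightarrow> ok ls \<Longrightarrow> run xs ls' = run xs ls"
proof (induction ms arbitrary: ls)
  case (Cons m ms)
  then show ?case
    using apply_move_sound[OF assms] by (fastforce split: option.splits)
qed simp

text \<open>Each move keeps the value of \<open>run\<close>, and by \<open>run_lay\<close> the first
  and the last list of layers evaluate to the two sides.\<close>

theorem certificate:
  assumes "sig_ok gs" "\<forall>r\<in>set rs. holds r" "check gs rs ms r"
  shows "holds r"
  using apply_moves_sound[OF assms(1) _ assms(2), of "dm (fst r)" ms "lay (fst r)" "lay (snd r)"] assms(3)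
    run_lay[OF assms(1), of "fst r"] run_lay[OF assms(1), of "snd r"]
  by (cases r) (auto simp: check_def holds_def)

end

subsection \<open>Hopf algebras\<close>

text \<open>
  Wire type \<open>0\<close> stands for \<open>H\<close>, type \<open>1\<close> for its dual and the types from \<open>2\<close> on for modules; the numbers of
  the generators are arbitrary. \<open>tna\<close> is the inverse of the antipode.
\<close>

abbreviation "mul \<equiv> Atom (Gen 0 [0, 0] [0])"
abbreviation "uni \<equiv> Atom (Gen 1 [] [0])"
abbreviation "com \<equiv> Atom (Gen 2 [0] [0, 0])"
abbreviation "cou \<equiv> Atom (Gen 3 [0] [])"
abbreviation "ant \<equiv> Atom (Gen 4 [0] [0])"
abbreviation "tna \<equiv> Atom (Gen 5 [0] [0])"

definition "hopf_gens = [Gen 0 [0, 0] [0], Gen 1 [] [0], Gen 2 [0] [0, 0], Gen 3 [0] [], Gen 4 [0] [0], Gen 5 [0] [0]]"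

text \<open>In Sweedler notation, the coaction \<open>h \<otimes> n \<mapsto> (h\<^sub>2 \<otimes> n) \<otimes> h\<^sub>3 S\<^sup>-\<^sup>1(h\<^sub>1)\<close> on the free module \<open>H \<otimes> N\<close>, where \<open>h\<^sub>1\<close> passes
  below and \<open>h\<^sub>3\<close> above the other wires.\<close>

abbreviation "freeC \<equiv> Idw [0, 1] \<oslash> mul \<odot> Idw [0, 1, 0] \<oslash> tna \<odot> Unders [0] [0, 1, 0] \<odot> Idw [0, 0] \<oslash> Atom (Over 0 1) \<odot> Idw [0] \<oslash> com \<oslash> Idw [1] \<odot> com \<oslash> Idw [1]"

definition "r_assoc = (mul \<odot> mul \<oslash> Idw [0], mul \<odot> Idw [0] \<oslash> mul)"
definition "r_unitL = (mul \<odot> uni \<oslash> Idw [0], Idw [0])"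
definition "r_unitR = (mul \<odot> Idw [0] \<oslash> uni, Idw [0])"
definition "r_coassoc = (com \<oslash> Idw [0] \<odot> com, Idw [0] \<oslash> com \<odot> com)"
definition "r_counitL = (cou \<oslash> Idw [0] \<odot> com, Idw [0])"
definition "r_counitR = (Idw [0] \<oslash> cou \<odot> com, Idw [0])"
definition "r_bialg =
  (com \<odot> mul,
   mul \<oslash> mul \<odot> Idw [0] \<oslash> Atom (Over 0 0) \<oslash> Idw [0] \<odot> com \<oslash> com)"
definition "r_comuni = (com \<odot> uni, uni \<oslash> uni)"
definition "r_coumul = (cou \<odot> mul, cou \<oslash> cou)"
definition "r_couuni = (cou \<odot> uni, Idw [])"
definition "r_antL = (mul \<odot> ant \<oslash> Idw [0] \<odot> com, uni \<odot> cou)"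
definition "r_antR = (mul \<odot> Idw [0] \<oslash> ant \<odot> com, uni \<odot> cou)"
definition "r_ST = (ant \<odot> tna, Idw [0])"
definition "r_TS = (tna \<odot> ant, Idw [0])"
text \<open>The antipode law with a bystander, \<open>h_1 (S(h_2) x) = eps(h) x\<close>; reading the
  diagram upside down gives \<open>r_antR3d\<close>.\<close>

definition "r_antR3 =
  (mul \<odot> Idw [0] \<oslash> mul \<odot> Idw [0] \<oslash> ant \<oslash> Idw [0] \<odot> com \<oslash> Idw [0],
   cou \<oslash> Idw [0])"
definition "r_antmul = (ant \<odot> mul, mul \<odot> Atom (Over 0 0) \<odot> ant \<oslash> ant)"
definition "r_antR3d =
  (((mul \<oslash> Idw [0] \<odot> Idw [0] \<oslash> ant \<oslash> Idw [0]) \<odot> Idw [0] \<oslash> com) \<odot> com,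
   uni \<oslash> Idw [0])"
definition "r_antcom = (com \<odot> ant, (ant \<oslash> ant \<odot> Atom (Over 0 0)) \<odot> com)"
definition "r_antcou = (cou \<odot> ant, cou)"
definition "r_tnacou = (cou \<odot> tna, cou)"
definition "r_tnamul = (tna \<odot> mul, mul \<odot> tna \<oslash> tna \<odot> Atom (Under 0 0))"
definition "r_tnacom = (com \<odot> tna, tna \<oslash> tna \<odot> Atom (Under 0 0) \<odot> com)"
definition "r_tnaR =
  (mul \<odot> Idw [0] \<oslash> tna \<odot> Atom (Under 0 0) \<odot> com,
   uni \<odot> cou)"
definition "r_tnaL =
  (mul \<odot> tna \<oslash> Idw [0] \<odot> Atom (Under 0 0) \<odot> com,
   uni \<odot> cou)"
definition "r_antuni = (ant \<odot> uni, uni)"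
definition "r_tnauni = (tna \<odot> uni, uni)"
text \<open>In the rules for the free module, wire type 1 is an arbitrary object \<open>N\<close>:
  no generator in \<open>hopf_gens\<close> has a wire of this type, so the slot of the dual is still
  free.\<close>

definition "r_free_modass =
  (mul \<oslash> Idw [1] \<odot> mul \<oslash> Idw [0, 1],
   mul \<oslash> Idw [1] \<odot> Idw [0] \<oslash> mul \<oslash> Idw [1])"
definition "r_free_modun = (mul \<oslash> Idw [1] \<odot> uni \<oslash> Idw [0, 1], Idw [0, 1])"
definition "r_rho_counit = (Idw [0, 1] \<oslash> cou \<odot> freeC, Idw [0, 1])"
definition "r_rho_coassoc =
  (freeC \<oslash> Idw [0] \<odot> freeC,
   Idw [0, 1] \<oslash> com \<odot> freeC)"
definition "r_rho_yd =
  (Idw [0, 1] \<oslash> mul \<odot> freeC \<oslash> Idw [0] \<odot> Unders [0] [0, 1] \<odot> Idw [0] \<oslash> mul \<oslash> Idw [1] \<odot> com \<oslash> Idw [0, 1],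
   (mul \<oslash> Idw [1]) \<oslash> mul \<odot> Idw [0] \<oslash> Overs [0] [0, 1] \<oslash> Idw [0] \<odot> com \<oslash> freeC)"

locale hopf_diagrams = diagrams +
  assumes sig_hopf: "sig_ok hopf_gens"
    and assoc: "holds r_assoc" and unitL: "holds r_unitL" and unitR: "holds r_unitR"
    and coassoc: "holds r_coassoc" and counitL: "holds r_counitL" and counitR: "holds r_counitR"
    and bialg: "holds r_bialg" and comuni: "holds r_comuni" and coumul: "holds r_coumul" and couuni: "holds r_couuni"
    and antL: "holds r_antL" and antR: "holds r_antR" and ST: "holds r_ST" and TS: "holds r_TS"
begin


lemma antR3: "holds r_antR3"
  by (rule certificate[OF sig_hopf, where rs = "[r_assoc, r_antR, r_unitL]" and ms = "[
    WR 0 2 0, RW 1 0 0, RW 2 1 0]"],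
    simp add: assoc antR unitL, code_simp)

text \<open>Uniqueness of convolution inverses, written out: up to crossings both sides arise from
  \<open>S(h_1 k_1) h_2 k_2 S(k_3) S(h_3)\<close>, collapsed from the right or from the
  left.\<close>

lemma antmul: "holds r_antmul"
  by (rule certificate[OF sig_hopf, where rs = "[r_counitR, r_unitR, r_antR, r_antR3, r_coassoc, r_assoc, r_bialg, r_antL, r_unitL, r_coumul, r_counitL]" and ms = "[
    WR 0 0 0, NF 0 1, SL 2, SL 3, WR 1 5 0, WR 2 4 1, SR 3, SR 2, NB 0 2, WR 0 1 2, SL 2, SL 3,
    SL 4, SL 5, SL 6, NF 1 7, SR 8, NF 0 2, SL 3, SL 4, WR 3 8 2, SR 4, SR 3, NB 0 3, NB 0 8,
    NB 1 9, SR 6, SR 5, SR 4, NB 0 4, NB 1 11, SL 1, SL 2, SR 7, SR 8, SR 9, SR 10, SR 11, SR 12,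
    SR 6, SR 5, SR 2, SR 13, SR 7, SR 6, SR 4, SR 3, WR 4 2 3, SL 3, WR 4 0 0, SR 1, SR 2, SR 3,
    SR 4, SR 5, WR 5 12 1, SL 11, SL 10, SL 9, SL 13, SL 12, SL 11, SL 10, WR 5 14 0, SL 13,
    SL 12, SL 11, NF 1 3, SL 4, WR 6 4 0, NF 0 2, SL 3, SL 4, SL 5, SL 6, RW 7 4 0, SR 5, SR 6,
    SR 7, SR 8, RW 8 9 0, RW 9 3 0, SL 2, SL 1, RW 10 0 0, NB 1 2, RW 10 0 1]"],
    simp add: counitR unitR antR antR3 coassoc assoc bialg antL unitL coumul counitL, code_simp)

lemma antR3d: "holds r_antR3d"
  by (rule certificate[OF sig_hopf, where rs = "[r_coassoc, r_antR, r_counitL]" and ms = "[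
    WR 0 0 0, RW 1 1 0, RW 2 0 0]"],
    simp add: coassoc antR counitL, code_simp)

text \<open>The same argument upside down: both sides are convolution inverses of
  \<open>com\<close>.\<close>

lemma antcom: "holds r_antcom"
  by (rule certificate[OF sig_hopf, where rs = "[r_unitR, r_counitR, r_antR, r_antR3d, r_coassoc, r_assoc, r_bialg, r_antL, r_counitL, r_comuni, r_unitL]" and ms = "[
    WR 0 2 0, NB 1 2, WR 1 0 0, SL 1, SL 2, WR 2 3 2, NF 1 5, WR 0 7 3, SL 8, SL 9, SR 6, SR 5,
    NB 0 5, SL 4, NB 1 9, WR 3 4 3, SR 7, NF 0 8, NF 1 11, SL 10, SL 11, SL 12, SL 9, SL 13, SL 8,
    SL 7, SL 6, SL 5, SR 2, SR 1, SR 3, SR 2, WR 4 1 1, SL 2, SL 3, WR 4 0 0, WR 5 14 1,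
    WR 5 12 0, SR 13, SL 11, SL 10, SL 9, SL 8, SL 7, SL 6, NB 0 13, SL 10, SL 9, SL 8, SL 7,
    WR 6 3 0, NF 1 7, NF 0 6, SL 7, RW 7 1 0, RW 8 0 0, RW 9 0 0, SR 0, SR 1, SR 2, SR 3, SL 5,
    SL 6, SR 4, RW 10 5 0, SR 4, SR 3, NB 0 3, NB 1 4, SR 0, SR 1, SR 2, SR 3, NF 0 4, RW 10 4 1,
    NF 1 2, NF 0 1, SL 2]"],
    simp add: unitR counitR antR antR3d coassoc assoc bialg antL counitL comuni unitL, code_simp)

lemma antcou: "holds r_antcou"
  by (rule certificate[OF sig_hopf, where rs = "[r_counitR, r_coumul, r_antL, r_couuni]" and ms = "[
    WR 0 0 0, SL 1, SL 2, WR 1 2 0, RW 2 0 0, RW 3 1 0]"],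
    simp add: counitR coumul antL couuni, code_simp)

lemma tnacou: "holds r_tnacou"
  by (rule certificate[OF sig_hopf, where rs = "[r_antcou, r_ST]" and ms = "[
    WR 0 1 0, RW 1 0 0]"],
    simp add: antcou ST, code_simp)

text \<open>This is \<open>antmul\<close> conjugated by the inverse antipode; the crossing changes
  sides and is inverted in doing so, hence \<open>Under\<close>. The same happens in
  \<open>tnacom\<close>.\<close>

lemma tnamul: "holds r_tnamul"
  by (rule certificate[OF sig_hopf, where rs = "[r_ST, r_antmul, r_TS]" and ms = "[
    CB 1 0 0, WR 0 1 1, WR 0 1 0, SR 2, WR 1 3 0, RW 2 4 0]"],
    simp add: ST antmul TS, code_simp)

lemma tnacom: "holds r_tnacom"
  by (rule certificate[OF sig_hopf, where rs = "[r_TS, r_antcom, r_ST]" and ms = "[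
    WR 0 2 1, WR 0 2 0, SR 3, CB 0 4 0, NF 1 3, NF 0 2, SL 3, WR 1 1 0, RW 2 0 0]"],
    simp add: TS antcom ST, code_simp)

text \<open>The composite of S and its inverse is inserted on both legs; \<open>tnacom\<close> then
  reads the twisted coproduct as the coproduct of \<open>S^-1(h)\<close>, and the antipode law for
  that element remains.\<close>

lemma tnaR: "holds r_tnaR"
  by (rule certificate[OF sig_hopf, where rs = "[r_ST, r_tnacom, r_TS, r_antL, r_tnacou]" and ms = "[
    WR 0 2 1, WR 0 2 0, SR 3, WR 1 0 0, RW 2 3 1, RW 3 1 0, RW 4 0 0]"],
    simp add: ST tnacom TS antL tnacou, code_simp)

lemma tnaL: "holds r_tnaL"
  by (rule certificate[OF sig_hopf, where rs = "[r_ST, r_tnacom, r_TS, r_antR, r_tnacou]" and ms = "[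
    WR 0 2 1, WR 0 2 0, SR 3, WR 1 0 0, SL 3, RW 2 2 0, RW 3 1 0, RW 4 0 0]"],
    simp add: ST tnacom TS antR tnacou, code_simp)

lemma antuni: "holds r_antuni"
  by (rule certificate[OF sig_hopf, where rs = "[r_unitR, r_comuni, r_antL, r_couuni]" and ms = "[
    WR 0 2 0, SR 1, WR 1 0 0, RW 2 1 0, RW 3 0 0]"],
    simp add: unitR comuni antL couuni, code_simp)

lemma tnauni: "holds r_tnauni"
  by (rule certificate[OF sig_hopf, where rs = "[r_antuni, r_TS]" and ms = "[
    WR 0 0 0, RW 1 1 0]"],
    simp add: antuni TS, code_simp)

lemma free_modass: "holds r_free_modass"
  by (rule certificate[OF sig_hopf, where rs = "[r_assoc]" and ms = "[
    RW 0 0 0]"],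
    simp add: assoc, code_simp)

lemma free_modun: "holds r_free_modun"
  by (rule certificate[OF sig_hopf, where rs = "[r_unitL]" and ms = "[
    RW 0 0 0]"],
    simp add: unitL, code_simp)

lemma rho_counit: "holds r_rho_counit"
  by (rule certificate[OF sig_hopf, where rs = "[r_coumul, r_tnacou, r_counitR, r_counitL]" and ms = "[
    RW 0 7 2, SR 7, RW 1 6 3, NB 2 6, SR 5, SR 4, SR 3, NB 0 3, RW 2 1 1, NB 2 3, NB 2 2, RW 3 0 0]"],
    simp add: coumul tnacou counitR counitL, code_simp)

lemma rho_coassoc: "holds r_rho_coassoc"
  by (rule certificate[OF sig_hopf, where rs = "[r_coassoc, r_tnacom, r_bialg]" and ms = "[
    SL 7, SL 6, SL 5, SL 4, NB 3 4, SL 9, SL 8, SL 7, SL 6, NB 3 6, NB 2 10, NB 2 16, NB 2 9,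
    NB 2 8, NB 2 7, SL 5, NB 2 5, NB 2 15, NB 2 14, SL 12, SL 11, SL 10, SL 9, SL 8, SL 7, SL 6,
    NB 3 6, SL 2, RW 0 1 1, SR 6, SR 5, SR 4, SL 3, RW 0 2 2, SL 4, SL 5, SL 6, SL 7, SL 8, SL 12,
    SL 13, SL 14, SL 15, SL 16, SL 3, SL 4, SL 5, SL 6, SL 11, SL 12, SL 13, SL 14, SL 15, SL 2,
    SL 3, SL 4, SL 11, SL 1, SL 10, SL 9, SL 8, SL 7, SR 9, NB 3 12, SL 12, SR 1, SR 4, SR 3,
    SR 2, SR 7, SR 6, SR 5, SR 4, SR 3, SR 8, SR 7, SR 6, SR 5, SR 4, SR 15, SR 14, SR 9, SR 8,
    SR 7, SR 6, SR 5, WR 0 0 0, SR 1, SR 2, SR 3, SR 4, NF 3 7, NF 2 6, SL 7, WR 1 5 0, NF 2 6,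
    NF 2 7, NF 0 2, SL 3, SL 4, SL 5, SL 6, NF 3 7, CB 1 10 3, NF 3 8, NF 2 6, SL 7, WR 2 7 2,
    NF 2 3, NF 2 4, NF 2 5]"],
    simp add: coassoc tnacom bialg, code_simp)

text \<open>On \<open>k \<otimes> n\<close> the left side is \<open>h_3 k_2 \<otimes> n \<otimes>
  h_4 k_3 S^-1(k_1) S^-1(h_2) h_1\<close>, and \<open>S^-1(h_2) h_1\<close> cancels by
  \<open>tnaL\<close>. No symmetry is available yet: the cancelling legs are brought together by
  naturality and by inverse pairs of crossings alone.\<close>

lemma rho_yd: "holds r_rho_yd"
  by (rule certificate[OF sig_hopf, where rs = "[r_bialg, r_tnamul, r_assoc, r_coassoc, r_tnaL, r_counitL, r_unitR]" and ms = "[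
    SL 3, NB 3 3, SL 5, NB 3 5, NB 2 12, NB 2 11, NB 2 10, SL 8, SL 7, SL 6, SL 5, SL 4, NB 3 4,
    RW 0 1 1, SL 5, RW 1 4 1, NB 3 5, NB 2 6, NB 1 4, SL 8, NF 3 7, SR 9, SR 10, SR 11, SL 15,
    SL 14, SL 13, NF 2 12, SR 14, SR 15, SR 16, NF 2 17, NF 2 19, RW 0 9 3, SR 8, SR 7, SR 6,
    SR 5, NB 0 5, SL 14, NF 3 13, SL 16, NF 3 15, SL 18, NF 3 17, NF 3 20, SR 22, NF 0 23, SL 25,
    SR 27, NF 3 26, SL 28, NF 3 29, SR 31, RW 2 32 2, RW 2 33 2, RW 2 32 3, RW 2 31 4, SL 3, SL 6,
    SL 12, SL 14, SL 16, SL 27, SL 28, SL 2, SL 5, SL 11, SL 13, SL 15, SL 26, SL 4, SL 12, SL 14,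
    SL 3, SL 13, SL 2, SR 19, SR 18, SR 17, NF 3 15, SL 14, NB 2 10, SL 7, SL 6, SL 5, SL 4, SL 3,
    SR 10, NF 3 8, SL 7, SL 6, SL 5, SR 13, SR 12, SR 11, SR 10, NF 3 8, SL 7, SL 6, NF 3 11,
    SL 10, SL 9, SL 8, SL 7, SL 6, CF 13, SR 12, SR 13, SR 14, NF 2 15, SL 17, SR 11, SR 12,
    NB 1 15, SL 15, SL 16, SR 18, SR 19, SR 20, SR 21, NF 2 22, NF 2 24, SR 23, NF 3 21, SL 20,
    SL 19, SL 18, CF 17, NF 3 21, SL 20, SL 19, SL 18, SL 17, SR 23, NB 2 23, SL 20, SL 19, SL 18,
    SR 24, SR 23, NF 3 21, SL 20, SR 16, NF 3 14, SL 13, SL 12, SL 11, SL 10, SL 9, SL 8, SR 17,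
    SR 16, NB 2 16, SL 13, SL 12, SR 18, SR 19, SR 17, SR 20, SR 18, SR 21, SR 19, SR 22, SR 20,
    SR 23, SR 21, SR 16, SR 24, SR 22, SR 17, SR 25, SR 24, SR 23, SR 18, SR 26, SR 25, SR 24,
    SR 19, SR 27, SR 26, SR 25, SR 20, SR 28, SR 27, SR 26, SR 23, SR 22, SR 21, SR 20, WR 3 0 0,
    WR 2 25 4, SL 26, SL 27, SL 28, WR 2 29 2, NB 2 20, NB 2 18, NB 2 16, SL 13, NB 2 13, SL 10,
    SL 9, NB 2 9, NB 2 7, SL 4, NF 3 9, SR 10, SR 11, SR 12, SR 13, SR 14, NF 2 15, NF 2 16,
    NF 3 2, NF 2 17, NF 3 10, SR 11, NF 3 8, SR 9, NF 3 5, SR 6, SR 7, RW 4 1 0, RW 5 0 0, SL 3,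
    SL 2, NB 3 2, SL 5, NB 3 5, SL 7, NB 3 7, NB 2 14, NB 2 13, NB 2 12, SL 10, SL 9, SL 8, SL 7,
    SL 6, NB 3 6, SR 0, NF 2 1, NF 2 1, SR 1, SR 2, NF 2 3, SR 3, NF 2 4, NF 2 4, NF 2 4, SL 4,
    SL 5, SL 6, SL 7, SL 8, SL 9, SL 10, SR 12, SR 13, SL 11, RW 6 12 3, SR 2, SL 11, SR 3,
    NF 2 4, NF 2 5, NF 2 6]"],
    simp add: bialg tnamul assoc coassoc tnaL counitL unitR, code_simp)

end

subsection \<open>Dual objects\<close>

abbreviation "evl \<equiv> Atom (Gen 6 [1, 0] [])"
abbreviation "dbs \<equiv> Atom (Gen 7 [] [0, 1])"
definition "snake_gens = [Gen 6 [1, 0] [], Gen 7 [] [0, 1]]"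

definition "r_sym a b = (Atom (Over b a) \<odot> Atom (Over a b), Idw [a, b])"
definition "r_und a b = (Atom (Under a b), Atom (Over a b))"
definition "r_snake1 = (Idw [0] \<oslash> evl \<odot> dbs \<oslash> Idw [0], Idw [0])"
definition "r_snake2 = (evl \<oslash> Idw [1] \<odot> Idw [1] \<oslash> dbs, Idw [1])"
definition "r_monodromy = (Atom (Over 1 2) \<odot> Atom (Over 2 1), Idw [2, 1])"
definition "r_snake_ev =
  (evl \<odot> (evl \<oslash> Idw [1] \<odot> Idw [1] \<oslash> dbs) \<oslash> Idw [0],
   evl)"

locale coev_diagrams = diagrams +
  assumes sig_coev: "sig_ok snake_gens" and snake1: "holds r_snake1"
begin

text \<open>Paired with H, the second snake identity reduces to the first. Since \<open>ev\<close>
  determines morphisms into the dual, this is enough to obtain it in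
  \<open>coev_snake2\<close>.\<close>

lemma snake_ev: "holds r_snake_ev"
  by (rule certificate[OF sig_coev, where rs = "[r_snake1]" and ms = "[
    SR 1, RW 0 0 1]"],
    simp add: snake1, code_simp)

end


locale snake_diagrams = diagrams +
  assumes sig_snake: "sig_ok snake_gens" and snake1: "holds r_snake1" and snake2: "holds r_snake2"
    and sym: "holds (r_sym 2 0)"
begin

text \<open>The dual wire is prolonged by a zigzag, and the trivial double crossing of type 2 with H
  is inserted on the H leg. Wire 2 then passes around \<open>evl\<close> as a whole, and only the
  zigzag is left.\<close>

lemma monodromy: "holds r_monodromy"
  by (rule certificate[OF sig_snake, where rs = "[r_snake2, r_sym 2 0]" and ms = "[
    WR 0 2 1, SR 1, SR 0, WR 1 2 1, NB 0 5, NB 1 3, RW 0 0 1]"],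
    simp add: snake2 sym, code_simp)

end

subsection \<open>Symmetric wires\<close>

definition "r_unit_yd =
  (mul \<odot> uni \<oslash> Idw [0] \<odot> Unders [0] [] \<odot> Idw [0] \<oslash> cou \<odot> com,
   cou \<oslash> mul \<odot> Idw [0] \<oslash> Overs [0] [] \<oslash> Idw [0] \<odot> com \<oslash> uni)"

locale light_diagrams = hopf_diagrams +
  assumes sym: "a < 2 \<or> b < 2 \<Longrightarrow> holds (r_sym a b)"
begin

lemma und:
  assumes "a < 2 \<or> b < 2"
  shows "holds (r_und a b)"
proof -
  have "\<Phi> (os b) (os a) \<cdot> \<Phi> (os a) (os b) = \<langle>os a \<boxtimes> os b\<rangle>" "\<Phi> (os a) (os b) \<cdot> \<Phi> (os b) (os a) = \<langle>os b \<boxtimes> os a\<rangle>"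
    using sym[of a b] sym[of b a] assms by (auto simp: r_sym_def holds_def)
  then have "inv (\<Phi> (os b) (os a)) = \<Phi> (os a) (os b)"
    by (intro arr_invI(1)[of _ "os b \<boxtimes> os a" "os a \<boxtimes> os b"]) (simp_all add: braid_hom)
  then show ?thesis
    by (simp add: r_und_def holds_def)
qed

lemma unit_yd: "holds r_unit_yd"
  by (rule certificate[OF sig_hopf, where rs = "[r_unitL, r_counitR, r_counitL, r_unitR]" and ms = "[
    RW 0 2 0, RW 1 0 0, WR 2 0 0, WR 3 1 1, SL 2]"],
    simp add: unitL counitR counitL unitR, code_simp)

end

subsection \<open>Yetter-Drinfel'd modules\<close>

abbreviation "actM \<equiv> Atom (Gen 14 [0, 2] [2])"
abbreviation "coactM \<equiv> Atom (Gen 15 [2] [2, 0])"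
abbreviation "actN \<equiv> Atom (Gen 16 [0, 3] [3])"
abbreviation "coactN \<equiv> Atom (Gen 17 [3] [3, 0])"
abbreviation "actP \<equiv> Atom (Gen 18 [0, 4] [4])"
abbreviation "coactP \<equiv> Atom (Gen 19 [4] [4, 0])"
abbreviation "actQ \<equiv> Atom (Gen 20 [0, 5] [5])"
abbreviation "coactQ \<equiv> Atom (Gen 21 [5] [5, 0])"
abbreviation "morF \<equiv> Atom (Gen 22 [2] [3])"
abbreviation "morG \<equiv> Atom (Gen 23 [4] [5])"

abbreviation "tenA \<equiv> actM \<oslash> actN \<odot> Idw [0] \<oslash> Overs [0] [2] \<oslash> Idw [3] \<odot> com \<oslash> Idw [2] \<oslash> Idw [3]"
abbreviation "tenC \<equiv> Idw [2] \<oslash> Idw [3] \<oslash> (mul \<odot> Atom (Over 0 0)) \<odot> Idw [2] \<oslash> Overs [0] [3] \<oslash> Idw [0] \<odot> coactM \<oslash> coactN"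
abbreviation "tenA' \<equiv> actN \<oslash> actP \<odot> Idw [0] \<oslash> Overs [0] [3] \<oslash> Idw [4] \<odot> com \<oslash> Idw [3] \<oslash> Idw [4]"
abbreviation "tenC' \<equiv> Idw [3] \<oslash> Idw [4] \<oslash> (mul \<odot> Atom (Over 0 0)) \<odot> Idw [3] \<oslash> Overs [0] [4] \<oslash> Idw [0] \<odot> coactN \<oslash> coactP"
abbreviation "brd \<equiv> Idw [3] \<oslash> actM \<odot> coactN \<oslash> Idw [2] \<odot> Overs [2] [3]"
text \<open>The inverse of \<open>brd\<close>: acting with \<open>S(n_1)\<close> undoes acting with
  \<open>n_1\<close>, after which the crossing is reversed.\<close>

abbreviation "dirb \<equiv> Unders [3] [2] \<odot> Idw [3] \<oslash> actM \<odot> Idw [3] \<oslash> ant \<oslash> Idw [2] \<odot> coactN \<oslash> Idw [2]"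

definition "yd_gens = hopf_gens @ [Gen 14 [0, 2] [2], Gen 15 [2] [2, 0], Gen 16 [0, 3] [3], Gen 17 [3] [3, 0], Gen 18 [0, 4] [4], Gen 19 [4] [4, 0]]"
definition "mor_gens = hopf_gens @ [Gen 14 [0, 2] [2], Gen 15 [2] [2, 0], Gen 16 [0, 3] [3], Gen 17 [3] [3, 0], Gen 18 [0, 4] [4], Gen 19 [4] [4, 0], Gen 20 [0, 5] [5], Gen 21 [5] [5, 0], Gen 22 [2] [3], Gen 23 [4] [5]]"

definition "r_modass_M = (actM \<odot> mul \<oslash> Idw [2], actM \<odot> Idw [0] \<oslash> actM)"
definition "r_modun_M = (actM \<odot> uni \<oslash> Idw [2], Idw [2])"
definition "r_coass_M =
  (coactM \<oslash> Idw [0] \<odot> coactM,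
   Idw [2] \<oslash> com \<odot> coactM)"
definition "r_coun_M = (Idw [2] \<oslash> cou \<odot> coactM, Idw [2])"
definition "r_yd_M =
  (Idw [2] \<oslash> mul \<odot> coactM \<oslash> Idw [0] \<odot> Unders [0] [2] \<odot> Idw [0] \<oslash> actM \<odot> com \<oslash> Idw [2],
   actM \<oslash> mul \<odot> Idw [0] \<oslash> Overs [0] [2] \<oslash> Idw [0] \<odot> com \<oslash> coactM)"
definition "r_modass_N = (actN \<odot> mul \<oslash> Idw [3], actN \<odot> Idw [0] \<oslash> actN)"
definition "r_modun_N = (actN \<odot> uni \<oslash> Idw [3], Idw [3])"
definition "r_coass_N =
  (coactN \<oslash> Idw [0] \<odot> coactN,
   Idw [3] \<oslash> com \<odot> coactN)"
definition "r_coun_N = (Idw [3] \<oslash> cou \<odot> coactN, Idw [3])"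
definition "r_yd_N =
  (Idw [3] \<oslash> mul \<odot> coactN \<oslash> Idw [0] \<odot> Unders [0] [3] \<odot> Idw [0] \<oslash> actN \<odot> com \<oslash> Idw [3],
   actN \<oslash> mul \<odot> Idw [0] \<oslash> Overs [0] [3] \<oslash> Idw [0] \<odot> com \<oslash> coactN)"
definition "r_modass_P = (actP \<odot> mul \<oslash> Idw [4], actP \<odot> Idw [0] \<oslash> actP)"
definition "r_modun_P = (actP \<odot> uni \<oslash> Idw [4], Idw [4])"
definition "r_coass_P =
  (coactP \<oslash> Idw [0] \<odot> coactP,
   Idw [4] \<oslash> com \<odot> coactP)"
definition "r_coun_P = (Idw [4] \<oslash> cou \<odot> coactP, Idw [4])"
definition "r_yd_P =
  (Idw [4] \<oslash> mul \<odot> coactP \<oslash> Idw [0] \<odot> Unders [0] [4] \<odot> Idw [0] \<oslash> actP \<odot> com \<oslash> Idw [4],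
   actP \<oslash> mul \<odot> Idw [0] \<oslash> Overs [0] [4] \<oslash> Idw [0] \<odot> com \<oslash> coactP)"
text \<open>The form that the Yetter-Drinfel'd condition takes once H is symmetric: its inverse
  crossing is replaced by a crossing. The later calculations rewrite with this form.\<close>

definition "r_yds_M =
  (Idw [2] \<oslash> mul \<odot> coactM \<oslash> Idw [0] \<odot> Overs [0] [2] \<odot> Idw [0] \<oslash> actM \<odot> com \<oslash> Idw [2],
   actM \<oslash> mul \<odot> Idw [0] \<oslash> Overs [0] [2] \<oslash> Idw [0] \<odot> com \<oslash> coactM)"
definition "r_yds_N =
  (Idw [3] \<oslash> mul \<odot> coactN \<oslash> Idw [0] \<odot> Overs [0] [3] \<odot> Idw [0] \<oslash> actN \<odot> com \<oslash> Idw [3],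
   actN \<oslash> mul \<odot> Idw [0] \<oslash> Overs [0] [3] \<oslash> Idw [0] \<odot> com \<oslash> coactN)"
definition "r_unit_act_left =
  (cou \<oslash> actM \<odot> Idw [0] \<oslash> Overs [0] [] \<oslash> Idw [2] \<odot> com \<oslash> Idw [] \<oslash> Idw [2],
   actM)"
definition "r_unit_act_right =
  (actM \<oslash> cou \<odot> Idw [0] \<oslash> Overs [0] [2] \<oslash> Idw [] \<odot> com \<oslash> Idw [2] \<oslash> Idw [],
   actM)"
definition "r_unit_coact_left =
  (Idw [] \<oslash> Idw [2] \<oslash> (mul \<odot> Atom (Over 0 0)) \<odot> Idw [] \<oslash> Overs [0] [2] \<oslash> Idw [0] \<odot> uni \<oslash> coactM,
   coactM)"
definition "r_unit_coact_right =
  (Idw [2] \<oslash> Idw [] \<oslash> (mul \<odot> Atom (Over 0 0)) \<odot> Idw [2] \<oslash> Overs [0] [] \<oslash> Idw [0] \<odot> coactM \<oslash> uni,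
   coactM)"
definition "r_ten_modass =
  (tenA \<odot> mul \<oslash> Idw [2, 3],
   tenA \<odot> Idw [0] \<oslash> tenA)"
definition "r_ten_modun = (tenA \<odot> uni \<oslash> Idw [2, 3], Idw [2, 3])"
definition "r_ten_coun = (Idw [2, 3] \<oslash> cou \<odot> tenC, Idw [2, 3])"
definition "r_ten_coass = (tenC \<oslash> Idw [0] \<odot> tenC, Idw [2, 3] \<oslash> com \<odot> tenC)"
definition "r_braid_inv_left = (dirb \<odot> brd, Idw [2, 3])"
definition "r_braid_inv_right = (brd \<odot> dirb, Idw [3, 2])"
definition "r_ten_yd =
  (Idw [2, 3] \<oslash> mul \<odot> tenC \<oslash> Idw [0] \<odot> Unders [0] [2, 3] \<odot> Idw [0] \<oslash> tenA \<odot> com \<oslash> Idw [2, 3],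
   tenA \<oslash> mul \<odot> Idw [0] \<oslash> Overs [0] [2, 3] \<oslash> Idw [0] \<odot> com \<oslash> tenC)"
definition "r_braid_lin =
  (brd \<odot> tenA,
   (actN \<oslash> actM \<odot> Idw [0] \<oslash> Overs [0] [3] \<oslash> Idw [2] \<odot> com \<oslash> Idw [3] \<oslash> Idw [2]) \<odot> Idw [0] \<oslash> brd)"
definition "r_braid_colin =
  ((Idw [3] \<oslash> Idw [2] \<oslash> (mul \<odot> Atom (Over 0 0)) \<odot> Idw [3] \<oslash> Overs [0] [2] \<oslash> Idw [0] \<odot> coactN \<oslash> coactM) \<odot> brd,
   brd \<oslash> Idw [0] \<odot> tenC)"
definition "r_ten_act_assoc =
  (tenA \<oslash> actP \<odot> Idw [0] \<oslash> Overs [0] [2, 3] \<oslash> Idw [4] \<odot> com \<oslash> Idw [2, 3] \<oslash> Idw [4],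
   actM \<oslash> tenA' \<odot> Idw [0] \<oslash> Overs [0] [2] \<oslash> Idw [3, 4] \<odot> com \<oslash> Idw [2] \<oslash> Idw [3, 4])"
definition "r_ten_coact_assoc =
  (Idw [2, 3] \<oslash> Idw [4] \<oslash> (mul \<odot> Atom (Over 0 0)) \<odot> Idw [2, 3] \<oslash> Overs [0] [4] \<oslash> Idw [0] \<odot> tenC \<oslash> coactP,
   Idw [2] \<oslash> Idw [3, 4] \<oslash> (mul \<odot> Atom (Over 0 0)) \<odot> Idw [2] \<oslash> Overs [0] [3, 4] \<oslash> Idw [0] \<odot> coactM \<oslash> tenC')"
definition "r_braid_hexR =
  (Idw [3, 4] \<oslash> actM \<odot> tenC' \<oslash> Idw [2] \<odot> Overs [2] [3, 4],
   Idw [3] \<oslash> (Idw [4] \<oslash> actM \<odot> coactP \<oslash> Idw [2] \<odot> Overs [2] [4]) \<odot> brd \<oslash> Idw [4])"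
definition "r_braid_hexL =
  (Idw [4] \<oslash> tenA \<odot> coactP \<oslash> Idw [2, 3] \<odot> Overs [2, 3] [4],
   (Idw [4] \<oslash> actM \<odot> coactP \<oslash> Idw [2] \<odot> Overs [2] [4]) \<oslash> Idw [3] \<odot> Idw [2] \<oslash> (Idw [4] \<oslash> actN \<odot> coactP \<oslash> Idw [3] \<odot> Overs [3] [4]))"

locale yd_diagrams = light_diagrams +
  assumes sig_yd: "sig_ok yd_gens"
    and modass_M: "holds r_modass_M" and modun_M: "holds r_modun_M" and coass_M: "holds r_coass_M" and coun_M: "holds r_coun_M" and yd_M: "holds r_yd_M"
    and modass_N: "holds r_modass_N" and modun_N: "holds r_modun_N" and coass_N: "holds r_coass_N" and coun_N: "holds r_coun_N" and yd_N: "holds r_yd_N"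
    and modass_P: "holds r_modass_P" and modun_P: "holds r_modun_P" and coass_P: "holds r_coass_P" and coun_P: "holds r_coun_P" and yd_P: "holds r_yd_P"
begin

lemma yds_M: "holds r_yds_M"
  by (rule certificate[OF sig_yd, where rs = "[r_und 0 2, r_yd_M]" and ms = "[
    WR 0 2 0, RW 1 0 0]"],
    simp add: und yd_M, code_simp)

lemma yds_N: "holds r_yds_N"
  by (rule certificate[OF sig_yd, where rs = "[r_und 0 3, r_yd_N]" and ms = "[
    WR 0 2 0, RW 1 0 0]"],
    simp add: und yd_N, code_simp)

lemma unit_act_left: "holds r_unit_act_left"
  by (rule certificate[OF sig_yd, where rs = "[r_counitL]" and ms = "[
    RW 0 0 0]"],
    simp add: counitL, code_simp)

lemma unit_act_right: "holds r_unit_act_right"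
  by (rule certificate[OF sig_yd, where rs = "[r_counitR]" and ms = "[
    SR 2, NB 0 2, RW 0 0 0]"],
    simp add: counitR, code_simp)

lemma unit_coact_left: "holds r_unit_coact_left"
  by (rule certificate[OF sig_yd, where rs = "[r_unitR]" and ms = "[
    SR 0, NF 0 1, NF 0 1, RW 0 1 1]"],
    simp add: unitR, code_simp)

lemma unit_coact_right: "holds r_unit_coact_right"
  by (rule certificate[OF sig_yd, where rs = "[r_unitL]" and ms = "[
    NF 1 1, RW 0 1 1]"],
    simp add: unitL, code_simp)

lemma ten_modass: "holds r_ten_modass"
  by (rule certificate[OF sig_yd, where rs = "[r_bialg, r_modass_M, r_modass_N]" and ms = "[
    RW 0 0 0, NF 0 4, SR 3, SR 4, SL 6, RW 1 5 0, RW 2 7 1, SR 0, SR 6, SR 2, SR 1, NB 1 5, SR 2,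
    SR 4, SR 3]"],
    simp add: bialg modass_M modass_N, code_simp)

lemma ten_modun: "holds r_ten_modun"
  by (rule certificate[OF sig_yd, where rs = "[r_comuni, r_modun_M, r_modun_N]" and ms = "[
    RW 0 0 0, SR 0, SR 1, RW 1 2 0, NF 0 0, RW 2 0 1]"],
    simp add: comuni modun_M modun_N, code_simp)

lemma ten_coun: "holds r_ten_coun"
  by (rule certificate[OF sig_yd, where rs = "[r_coumul, r_coun_N, r_coun_M]" and ms = "[
    RW 0 4 2, NB 1 4, SR 2, RW 1 1 2, NB 0 2, RW 2 0 0]"],
    simp add: coumul coun_N coun_M, code_simp)

lemma ten_coass: "holds r_ten_coass"
  by (rule certificate[OF sig_yd, where rs = "[r_coass_M, r_coass_N, r_sym 0 0, r_bialg]" and ms = "[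
    SR 5, SL 4, SL 3, NB 1 3, SL 6, SL 5, SL 4, SL 3, SL 2, SL 1, RW 0 0 0, RW 1 2 3, SL 3, SL 7,
    SL 8, SL 9, SL 6, SL 5, SL 4, SR 1, NF 0 2, NF 1 4, WR 2 7 3, NF 1 5, NF 0 3, SL 4, WR 3 4 2]"],
    simp add: coass_M coass_N sym bialg, code_simp)

lemma braid_inv_left: "holds r_braid_inv_left"
  by (rule certificate[OF sig_yd, where rs = "[r_modass_M, r_coass_N, r_antL, r_coun_N, r_modun_M]" and ms = "[
    SL 2, SL 3, WR 0 4 1, NB 1 1, SL 2, NB 1 2, SL 4, NB 1 4, NB 1 6, RW 1 0 1, SR 2, SR 3,
    RW 2 1 2, RW 3 0 1, SL 0, NF 1 1, RW 4 1 1, CF 0]"],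
    simp add: modass_M coass_N antL coun_N modun_M, code_simp)

lemma braid_inv_right: "holds r_braid_inv_right"
  by (rule certificate[OF sig_yd, where rs = "[r_modass_M, r_coass_N, r_antR, r_modun_M, r_coun_N]" and ms = "[
    CF 3, SL 2, WR 0 3 1, SL 1, RW 1 0 0, RW 2 1 1, RW 3 2 1, RW 4 0 0]"],
    simp add: modass_M coass_N antR modun_M coun_N, code_simp)

text \<open>The factor \<open>(h_3 n)_1 (h_2 m)_1 h_1\<close> is rearranged from the right: first
  the condition for \<open>M\<close> is applied, then the one for \<open>N\<close>. The opposite
  product in the tensor coaction is what puts \<open>(h_2 m)_1\<close> next to
  \<open>h_1\<close>.\<close>

lemma ten_yd: "holds r_ten_yd"
  by (rule certificate[OF sig_yd, where rs = "[r_und 0 2, r_und 0 3, r_assoc, r_coassoc, r_yds_M, r_sym 0 0, r_yds_N]" and ms = "[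
    RW 0 5 0, RW 1 6 1, SL 6, NB 1 6, NB 1 9, RW 2 13 2, SL 4, SL 5, SL 6, SL 10, WR 3 0 0, SR 1,
    NF 1 4, NB 0 12, NB 0 10, SL 7, SL 6, RW 4 2 0, SR 6, SR 7, NF 0 8, NF 0 10, SL 1, NB 1 3,
    RW 3 0 0, SL 4, SL 5, WR 5 11 2, NB 0 11, SL 8, SL 7, NF 0 12, SR 5, SR 11, SR 6, SR 1,
    WR 2 15 2, NF 1 9, NF 0 2, NF 0 3, SL 4, NB 1 12, SR 9, RW 6 5 2, SL 9, NF 1 10, SR 4, NB 0 4,
    NB 0 3, NF 1 10, SL 9, SL 8, SR 7, RW 5 6 2, RW 2 13 2, SL 1, SL 5, SR 6, NF 0 7, SL 9,
    RW 5 10 2, SR 5, SR 4, SR 6, SR 5, SR 3, SR 7, SR 6, SR 4, SR 9, SR 8, SR 7, SR 6, SR 5,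
    SR 10, SR 9, SR 8, SR 7, SR 6, WR 3 0 0, SR 1, SR 2, SR 3, SR 4, SR 5, SR 6, SR 7]"],
    simp add: und assoc coassoc yds_M sym yds_N, code_simp)

text \<open>Linearity rests on the Yetter-Drinfel'd condition of \<open>N\<close>, whose coaction
  occurs in the braiding; colinearity, next, on that of \<open>M\<close>, whose action occurs in
  it.\<close>

lemma braid_lin: "holds r_braid_lin"
  by (rule certificate[OF sig_yd, where rs = "[r_sym 0 2, r_modass_M, r_yds_N]" and ms = "[
    SR 2, NF 0 3, NF 1 2, RW 0 1 1, SL 4, NF 1 2, SR 0, WR 1 6 1, NB 1 4, RW 2 1 0, SR 1, NB 1 1,
    RW 1 6 1, SR 5, SR 4, SR 3, NF 1 0]"],
    simp add: sym modass_M yds_N, code_simp)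

lemma braid_colin: "holds r_braid_colin"
  by (rule certificate[OF sig_yd, where rs = "[r_coass_N, r_yds_M, r_sym 2 0]" and ms = "[
    NB 1 1, SL 3, SL 2, NB 1 2, RW 0 0 1, SL 1, NF 1 2, NF 1 0, NF 1 4, RW 1 2 1, SR 2, SR 1,
    NB 0 1, NB 1 3, NB 1 5, RW 2 6 2, NB 1 2, SR 4, NB 1 4, SR 8, SR 7, SR 6, SR 2, WR 0 1 2,
    NF 1 2, SR 3, SR 4, NF 1 5]"],
    simp add: coass_N yds_M sym, code_simp)

lemma ten_act_assoc: "holds r_ten_act_assoc"
  by (rule certificate[OF sig_yd, where rs = "[r_coassoc]" and ms = "[
    SL 2, SL 1, RW 0 0 0, SL 3, SL 4, NF 0 1, SL 2]"],
    simp add: coassoc, code_simp)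

lemma ten_coact_assoc: "holds r_ten_coact_assoc"
  by (rule certificate[OF sig_yd, where rs = "[r_assoc]" and ms = "[
    SR 4, NF 0 5, NF 0 7, SR 3, NF 0 4, NF 0 6, SR 2, SR 3, SR 5, SR 4, WR 0 9 3, NB 1 9, SR 6,
    SR 5]"],
    simp add: assoc, code_simp)

text \<open>\<open>m\<close> meets \<open>N\<close> before \<open>P\<close>, so \<open>n_1\<close>
  acts before \<open>p_1\<close>; by the module law this is the action of \<open>p_1 n_1\<close>,
  the opposite product in the tensor coaction. The other hexagon comes from coassociativity for
  \<open>P\<close>.\<close>

lemma braid_hexR: "holds r_braid_hexR"
  by (rule certificate[OF sig_yd, where rs = "[r_modass_M]" and ms = "[
    SL 1, NB 1 1, NB 1 4, RW 0 8 2, NF 1 3, NF 1 4, SR 5, NF 1 0, NB 0 4]"],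
    simp add: modass_M, code_simp)

lemma braid_hexL: "holds r_braid_hexL"
  by (rule certificate[OF sig_yd, where rs = "[r_sym 2 0, r_coass_P]" and ms = "[
    NB 1 2, NB 1 4, RW 0 5 2, NB 1 1, SR 3, NB 1 3, SR 7, SR 6, SR 5, SR 1, WR 1 0 2, NF 1 1,
    SR 2, SR 3, NF 1 0, NF 1 3]"],
    simp add: sym coass_P, code_simp)

end

section \<open>Morphisms of Yetter-Drinfel'd modules and naturality of the braiding\<close>

definition "r_linf = (morF \<odot> actM, actN \<odot> Idw [0] \<oslash> morF)"
definition "r_ling = (morG \<odot> actP, actQ \<odot> Idw [0] \<oslash> morG)"
definition "r_colf = (coactN \<odot> morF, morF \<oslash> Idw [0] \<odot> coactM)"
definition "r_colg = (coactQ \<odot> morG, morG \<oslash> Idw [0] \<odot> coactP)"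
definition "r_mor_lin =
  (morF \<oslash> morG \<odot> actM \<oslash> actP \<odot> Idw [0] \<oslash> Overs [0] [2] \<oslash> Idw [4] \<odot> com \<oslash> Idw [2] \<oslash> Idw [4],
   (actN \<oslash> actQ \<odot> Idw [0] \<oslash> Overs [0] [3] \<oslash> Idw [5] \<odot> com \<oslash> Idw [3] \<oslash> Idw [5]) \<odot> Idw [0] \<oslash> morF \<oslash> morG)"
definition "r_mor_colin =
  ((Idw [3] \<oslash> Idw [5] \<oslash> (mul \<odot> Atom (Over 0 0)) \<odot> Idw [3] \<oslash> Overs [0] [5] \<oslash> Idw [0] \<odot> coactN \<oslash> coactQ) \<odot> morF \<oslash> morG,
   (morF \<oslash> morG) \<oslash> Idw [0] \<odot> Idw [2] \<oslash> Idw [4] \<oslash> (mul \<odot> Atom (Over 0 0)) \<odot> Idw [2] \<oslash> Overs [0] [4] \<oslash> Idw [0] \<odot> coactM \<oslash> coactP)"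
definition "r_braid_nat =
  ((Idw [5] \<oslash> actN \<odot> coactQ \<oslash> Idw [3] \<odot> Overs [3] [5]) \<odot> morF \<oslash> morG,
   morG \<oslash> morF \<odot> Idw [4] \<oslash> actM \<odot> coactP \<oslash> Idw [2] \<odot> Overs [2] [4])"

locale yd_morphism_diagrams = light_diagrams +
  assumes sig_mor: "sig_ok mor_gens"
    and linf: "holds r_linf" and ling: "holds r_ling" and colf: "holds r_colf" and colg: "holds r_colg"
begin

lemma mor_lin: "holds r_mor_lin"
  by (rule certificate[OF sig_mor, where rs = "[r_linf, r_ling]" and ms = "[
    SL 3, RW 0 2 0, RW 1 4 1, NB 1 2, SR 0, SR 3, SR 2, SR 1]"],
    simp add: linf ling, code_simp)

lemma mor_colin: "holds r_mor_colin"
  by (rule certificate[OF sig_mor, where rs = "[r_colf, r_colg]" and ms = "[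
    SL 1, RW 0 0 0, RW 1 2 2, NF 1 3, SR 1, SR 2, SR 4, SR 3, SR 5, SR 4]"],
    simp add: colf colg, code_simp)

lemma braid_nat: "holds r_braid_nat"
  by (rule certificate[OF sig_mor, where rs = "[r_colg, r_linf]" and ms = "[
    NB 1 3, RW 0 1 1, SR 0, SR 1, NF 0 2, NF 0 3, WR 1 4 1, NF 1 1, SR 2, SR 3, NF 1 0]"],
    simp add: colg linf, code_simp)

end

subsection \<open>The dual Hopf algebra\<close>

abbreviation "mulB \<equiv> Atom (Gen 8 [1, 1] [1])"
abbreviation "uniB \<equiv> Atom (Gen 9 [] [1])"
abbreviation "comB \<equiv> Atom (Gen 10 [1] [1, 1])"
abbreviation "couB \<equiv> Atom (Gen 11 [1] [])"
abbreviation "lact \<equiv> Atom (Gen 12 [0, 1] [1])"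
abbreviation "ract \<equiv> Atom (Gen 13 [0, 1] [0])"
text \<open>Placeholders for arbitrary morphisms with these boundaries. They serve to show that the
  comultiplication and the left action given by \<open>THE\<close> exist and are unique.\<close>

abbreviation "pair3 \<equiv> Atom (Gen 27 [1, 0, 0] [])"
abbreviation "copr \<equiv> Atom (Gen 28 [1] [1, 1])"
abbreviation "lact' \<equiv> Atom (Gen 29 [0, 1] [1])"
abbreviation "pair3' \<equiv> Atom (Gen 30 [0, 0, 1] [])"

text \<open>\<open>crossE\<close> is the passage of \<open>h\<close> past \<open>b\<close> in the double; \<open>thetaE\<close> is its closed form
  \<open>h b = \<langle>b, S\<^sup>-\<^sup>1(h\<^sub>3) _ h\<^sub>1\<rangle> h\<^sub>2\<close>.\<close>

abbreviation "evl_barE \<equiv> evl \<odot> Atom (Over 0 1)"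
abbreviation "pair_mulE \<equiv> evl \<oslash> evl \<odot> Idw [1] \<oslash> Atom (Over 1 0) \<oslash> Idw [0] \<odot> Idw [1] \<oslash> Idw [1] \<oslash> com"
abbreviation "pair_comE \<equiv> evl \<odot> Idw [1] \<oslash> (mul \<odot> Atom (Over 0 0))"
abbreviation "pair_lactE \<equiv> evl_barE \<odot> (mul \<odot> Atom (Over 0 0) \<odot> mul \<oslash> tna \<odot> Idw [0] \<oslash> com) \<oslash> Idw [1]"
abbreviation "ract_defE \<equiv> Idw [0] \<oslash> evl_barE \<odot> Idw [0] \<oslash> (mul \<odot> Atom (Over 0 0)) \<oslash> Idw [1] \<odot> Atom (Under 0 0) \<oslash> tna \<oslash> Idw [1] \<odot> (com \<oslash> Idw [0] \<odot> com) \<oslash> Idw [1]"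
abbreviation "thetaE \<equiv> Atom (Over 0 1) \<odot> Idw [0] \<oslash> (evl \<odot> Idw [1] \<oslash> (mul \<odot> Idw [0] \<oslash> mul)) \<oslash> Idw [1] \<odot> Idw [0] \<oslash> Atom (Over 0 1) \<oslash> Idw [0, 0, 1] \<odot> Overs [0] [0, 0, 1, 0] \<oslash> Idw [1] \<odot> Idw [0] \<oslash> Idw [0] \<oslash> tna \<oslash> Idw [1] \<oslash> dbs \<odot> (Idw [0] \<oslash> com \<odot> com) \<oslash> Idw [1]"
abbreviation "crossE \<equiv> lact \<oslash> ract \<odot> Idw [0] \<oslash> Atom (Over 0 1) \<oslash> Idw [1] \<odot> com \<oslash> comB"
abbreviation "mulDE \<equiv> mulB \<oslash> mul \<odot> Idw [1] \<oslash> lact \<oslash> ract \<oslash> Idw [0] \<odot> Idw [1] \<oslash> Idw [0] \<oslash> Atom (Over 0 1) \<oslash> Idw [1] \<oslash> Idw [0] \<odot> Idw [1] \<oslash> com \<oslash> comB \<oslash> Idw [0]"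

definition "dual_gens = hopf_gens @ [Gen 6 [1, 0] [], Gen 7 [] [0, 1], Gen 8 [1, 1] [1], Gen 9 [] [1], Gen 10 [1] [1, 1], Gen 11 [1] [], Gen 12 [0, 1] [1], Gen 13 [0, 1] [0]]"

definition "r_pair_com =
  (evl \<oslash> evl \<odot> Idw [1] \<oslash> Atom (Over 1 0) \<oslash> Idw [0] \<odot> (pair3 \<oslash> Idw [1] \<oslash> Idw [1] \<odot> Idw [1] \<oslash> (Idw [0] \<oslash> Atom (Over 1 0) \<oslash> Idw [1] \<odot> dbs \<oslash> dbs)) \<oslash> Idw [0] \<oslash> Idw [0],
   pair3)"
definition "r_copair_com =
  ((evl \<oslash> evl \<odot> Idw [1] \<oslash> Atom (Over 1 0) \<oslash> Idw [0] \<odot> copr \<oslash> Idw [0] \<oslash> Idw [0]) \<oslash> Idw [1] \<oslash> Idw [1] \<odot> Idw [1] \<oslash> (Idw [0] \<oslash> Atom (Over 1 0) \<oslash> Idw [1] \<odot> dbs \<oslash> dbs),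
   copr)"
definition "r_pair_lact =
  (evl_barE \<odot> Idw [0] \<oslash> (Idw [1] \<oslash> pair3' \<odot> (Atom (Over 0 1) \<odot> dbs) \<oslash> Idw [0] \<oslash> Idw [1]),
   pair3')"
definition "r_copair_lact =
  (Idw [1] \<oslash> (evl_barE \<odot> Idw [0] \<oslash> lact') \<odot> (Atom (Over 0 1) \<odot> dbs) \<oslash> Idw [0] \<oslash> Idw [1],
   lact')"

locale pair_diagrams = light_diagrams +
  assumes sig_pair: "sig_ok snake_gens" and snake1: "holds r_snake1" and snake2: "holds r_snake2"
begin

text \<open>Together with \<open>copair_com\<close> it says that transposing along two copies of
  \<open>dbs\<close> and pairing with two copies of \<open>evl\<close> undo each other;
  \<open>pair_lact\<close> and \<open>copair_lact\<close> say the same for one copy and the flipped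
  pairing.\<close>

lemma pair_com:
  assumes "gok (Gen 27 [1, 0, 0] [])"
  shows "holds r_pair_com"
  by (rule certificate[where gs = "snake_gens @ [Gen 27 [1, 0, 0] []]" and rs = "[r_sym 0 1, r_sym 1 0, r_snake1, r_sym 0 0]" and ms = "[
    NB 0 0, NB 0 3, NB 0 3, NB 0 3, SL 2, SL 1, RW 0 9 2, WR 0 8 2, NB 0 8, NB 0 6, SL 3, SL 2,
    WR 0 7 3, SR 6, SR 5, NB 0 5, WR 0 11 3, SR 10, NB 0 10, SR 7, NB 0 7, SL 4, SR 8, SR 7, SR 9,
    SR 11, SR 10, SL 14, NB 1 14, NB 1 11, NB 1 11, NF 0 8, NF 0 7, SL 9, SR 6, NF 0 7, NF 0 5,
    SL 7, SL 11, SR 4, SR 3, SR 2, SR 5, SL 10, SL 9, SL 8, NB 1 8, NB 1 6, SR 3, SR 1, SR 2,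
    SR 4, SR 3, NF 0 2, SL 4, RW 1 1 2, NF 0 0, RW 2 0 1, NF 0 4, NF 0 3, SL 5, SR 2, NF 0 3,
    SL 7, SR 1, SR 2, SL 6, SL 5, NB 1 5, NF 0 3, SL 5, NF 0 6, SL 8, RW 1 2 2, SL 1, SL 2,
    RW 3 3 3, NF 0 0, NF 0 0, RW 2 0 2]"],
    use assms sig_pair in \<open>simp add: sig_ok_def\<close>, simp add: sym snake1, code_simp)

lemma copair_com:
  assumes "gok (Gen 28 [1] [1, 1])"
  shows "holds r_copair_com"
  by (rule certificate[where gs = "snake_gens @ [Gen 28 [1] [1, 1]]" and rs = "[r_sym 0 1, r_snake2]" and ms = "[
    NB 0 0, NB 0 3, NB 0 3, NB 0 3, SL 2, SL 1, RW 0 9 2, SL 8, SL 7, SL 6, NB 1 6, NB 1 5,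
    NB 1 4, NB 1 3, SL 13, SR 10, NF 0 11, SL 8, NF 0 9, SL 11, SL 6, SL 7, RW 0 8 3, SL 4, SL 5,
    SL 6, SL 7, SL 8, WR 0 7 3, SR 6, SR 5, NB 0 5, SR 7, SR 6, SR 8, SL 14, SL 13, SL 12, SL 11,
    NB 1 11, NB 1 9, NB 1 7, WR 0 9 1, NB 0 9, SL 6, WR 0 10 2, SR 9, NB 0 9, SR 10, SL 13,
    NB 1 13, NB 1 11, SR 1, SR 2, SR 3, SR 4, SR 0, NF 1 4, NF 0 2, RW 0 4 1, NF 0 1, RW 1 1 0,
    SL 5, NF 1 6, SL 4, NF 0 2, NF 0 4, RW 0 6 2, NF 0 1, NF 0 1, RW 1 1 1]"],
    use assms sig_pair in \<open>simp add: sig_ok_def\<close>, simp add: sym snake2, code_simp)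

lemma pair_lact:
  assumes "gok (Gen 30 [0, 0, 1] [])"
  shows "holds r_pair_lact"
  by (rule certificate[where gs = "snake_gens @ [Gen 30 [0, 0, 1] []]" and rs = "[r_sym 0 0, r_sym 1 0, r_sym 0 1, r_sym 1 1, r_snake1]" and ms = "[
    NB 0 0, WR 0 1 2, WR 1 5 2, SR 4, NB 0 4, WR 2 3 3, WR 3 8 3, SR 7, SR 6, NB 0 6, NB 0 12,
    NB 0 9, SL 5, RW 1 6 0, SR 5, NB 0 5, NB 0 3, RW 4 0 0]"],
    use assms sig_pair in \<open>simp add: sig_ok_def\<close>, simp add: sym snake1, code_simp)

lemma copair_lact:
  assumes "gok (Gen 29 [0, 1] [1])"
  shows "holds r_copair_lact"
  by (rule certificate[where gs = "snake_gens @ [Gen 29 [0, 1] [1]]" and rs = "[r_sym 0 1, r_snake2]" and ms = "[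
    SR 1, SR 0, NF 1 4, NF 0 2, RW 0 4 1, NF 0 1, RW 1 1 0]"],
    use assms sig_pair in \<open>simp add: sig_ok_def\<close>, simp add: sym snake2, code_simp)

end

definition "r_pmul = (evl \<odot> mulB \<oslash> Idw [0], pair_mulE)"
definition "r_puni = (evl \<odot> uniB \<oslash> Idw [0], cou)"
definition "r_pcom =
  (evl \<oslash> evl \<odot> Idw [1] \<oslash> Atom (Over 1 0) \<oslash> Idw [0] \<odot> comB \<oslash> Idw [0] \<oslash> Idw [0],
   pair_comE)"
definition "r_pcou = (couB, evl \<odot> Idw [1] \<oslash> uni)"
definition "r_plact = (evl_barE \<odot> Idw [0] \<oslash> lact, pair_lactE)"
definition "r_pract = (ract, ract_defE)"
definition "r_mulB_exp =
  (mulB,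
   pair_mulE \<oslash> Idw [1] \<odot> Idw [1] \<oslash> Idw [1] \<oslash> dbs)"
definition "r_uniB_exp = (uniB, cou \<oslash> Idw [1] \<odot> dbs)"
definition "r_comB_exp =
  (comB,
   pair_comE \<oslash> Idw [1] \<oslash> Idw [1] \<odot> Idw [1] \<oslash> (Idw [0] \<oslash> Atom (Over 1 0) \<oslash> Idw [1] \<odot> dbs \<oslash> dbs))"
definition "r_lact_exp =
  (lact,
   Idw [1] \<oslash> pair_lactE \<odot> (Atom (Over 0 1) \<odot> dbs) \<oslash> Idw [0] \<oslash> Idw [1])"
definition "r_theta = (crossE, thetaE)"
definition "r_comB_uniB = (comB \<odot> uniB, uniB \<oslash> uniB)"
definition "r_lact_uniB = (lact \<odot> Idw [0] \<oslash> uniB, uniB \<oslash> cou)"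
definition "r_lact_uni = (lact \<odot> uni \<oslash> Idw [1], Idw [1])"
definition "r_ract_uniB = (ract \<odot> Idw [0] \<oslash> uniB, Idw [0])"
definition "r_ract_uni = (ract \<odot> uni \<oslash> Idw [1], uni \<oslash> couB)"
definition "r_mulB_unitL = (mulB \<odot> uniB \<oslash> Idw [1], Idw [1])"
definition "r_mulB_unitR = (mulB \<odot> Idw [1] \<oslash> uniB, Idw [1])"
definition "r_comB_counitR = (Idw [1] \<oslash> couB \<odot> comB, Idw [1])"
definition "r_dmul1 =
  (mulDE \<odot> Idw [1] \<oslash> uni \<oslash> uniB \<oslash> Idw [0],
   Idw [1, 0])"
definition "r_dmul2 =
  (mulDE \<odot> uniB \<oslash> Idw [0] \<oslash> uniB \<oslash> Idw [0],
   uniB \<oslash> mul)"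
definition "r_dmul3 =
  (mulDE \<odot> Idw [1] \<oslash> uni \<oslash> Idw [1] \<oslash> uni,
   mulB \<oslash> uni)"
definition "r_dmul4 = (mulDE \<odot> uniB \<oslash> Idw [0] \<oslash> Idw [1] \<oslash> uni, crossE)"

locale dual_diagrams = light_diagrams +
  assumes sig_dual: "sig_ok dual_gens" and snake1: "holds r_snake1" and snake2: "holds r_snake2"
    and pmul: "holds r_pmul" and puni: "holds r_puni" and pcom: "holds r_pcom" and pcou: "holds r_pcou" and plact: "holds r_plact" and pract: "holds r_pract"
begin

text \<open>The structure of the dual is given through its pairings only. Transposing them along
  \<open>dbs\<close> yields explicit formulas, here and in the next three lemmas, which can be
  substituted in diagrams where nothing is paired.\<close>

lemma mulB_exp: "holds r_mulB_exp"
  by (rule certificate[OF sig_dual, where rs = "[r_snake2, r_sym 0 1, r_pmul, r_sym 0 0]" and ms = "[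
    WR 0 1 0, NB 0 1, WR 1 4 1, NB 0 4, NB 1 6, SL 0, SL 1, NF 1 2, RW 2 4 1, NB 0 4, NB 0 3,
    NB 0 2, RW 1 7 2, WR 3 6 2, NB 0 6, NB 0 4, SR 4, SL 8, NB 1 8, SR 5, NF 1 8, NF 0 6,
    RW 1 8 1, NF 1 5, NF 1 7, SR 9, SR 10, NF 0 3, RW 1 5 2, SR 2, NF 0 3, RW 3 5 1, WR 1 7 1,
    SR 1, NF 0 2, SR 3, NF 0 4, NF 0 0, NF 0 0]"],
    simp add: snake2 sym pmul, code_simp)

lemma uniB_exp: "holds r_uniB_exp"
  by (rule certificate[OF sig_dual, where rs = "[r_snake2, r_puni]" and ms = "[
    WR 0 1 0, SR 0, RW 1 1 0]"],
    simp add: snake2 puni, code_simp)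

lemma comB_exp: "holds r_comB_exp"
  by (rule certificate[OF sig_dual, where rs = "[r_snake2, r_sym 0 1, r_pcom, r_sym 0 0, r_sym 1 0]" and ms = "[
    WR 0 1 1, NB 0 1, NB 0 1, WR 1 6 2, NB 0 6, NB 0 4, SR 4, NB 1 8, SR 5, WR 0 1 0, NB 0 1,
    WR 1 4 1, NB 0 4, NB 1 6, SL 0, SL 4, SL 3, SL 2, SL 1, SL 5, SL 6, NF 1 7, SR 9, SL 4, SL 5,
    SL 3, WR 1 8 4, SR 7, NB 0 11, SL 2, SL 3, SL 4, NF 1 5, NF 1 6, SR 7, RW 2 8 2, RW 3 7 3,
    WR 4 2 1, NB 0 9, NB 0 7, NB 0 5, NF 1 7, NF 1 9, SR 11, NF 0 5, RW 1 7 2, SR 4, NF 0 5,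
    RW 1 7 1, SR 3, SR 4, NF 0 5, SR 7, SR 2, NF 0 3, SL 5, WR 3 7 1, SR 8, WR 1 9 2, SR 1, SR 2,
    NF 0 3, NF 0 3, NF 0 3, NF 0 0]"],
    simp add: snake2 sym pcom, code_simp)

lemma lact_exp: "holds r_lact_exp"
  by (rule certificate[OF sig_dual, where rs = "[r_snake2, r_plact, r_sym 0 1, r_sym 1 0]" and ms = "[
    WR 0 1 0, NB 0 1, SL 0, NF 1 1, RW 1 3 0, SL 2, NB 1 2, SL 4, SL 3, SL 5, NB 1 5, SL 6,
    WR 2 7 1, NB 0 7, SL 9, NB 1 9, NF 0 8, NB 1 11, SL 4, NF 0 3, RW 3 2 1, SL 1]"],
    simp add: snake2 plact sym, code_simp)

text \<open>Since \<open>comB\<close> pairs to the opposite product,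
  \<open>h_1 \<triangleright> b_1\<close> and \<open>h_2 \<triangleleft> b_2\<close> combine to
  \<open><b, S^-1(h_5) h_3 S^-1(h_2) _ h_1> h_4\<close>. The middle factor
  \<open>h_3 S^-1(h_2)\<close> cancels by \<open>tnaR\<close>.\<close>

lemma theta: "holds r_theta"
  by (rule certificate[OF sig_dual, where rs = "[r_lact_exp, r_sym 1 0, r_sym 0 0, r_pract, r_und 0 0, r_sym 0 1, r_pcom, r_assoc, r_coassoc, r_tnaR, r_unitL, r_counitL]" and ms = "[
    RW 0 3 0, SL 2, SL 3, SL 4, SR 3, WR 1 4 1, SL 7, NB 0 7, SL 7, SR 6, SL 8, SL 9, WR 2 12 2,
    NB 0 12, NB 1 14, RW 3 13 1, RW 4 15 1, SR 15, SL 1, SL 2, SL 3, SL 4, SL 5, SL 6, SL 7, SL 8,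
    SL 12, SL 11, NB 1 11, SL 14, SL 13, SL 12, NB 1 12, SL 16, SL 15, NB 1 15, SR 13, SR 12,
    SL 17, SL 18, SL 16, SL 17, SL 15, NF 0 13, NF 0 15, SL 19, SR 14, SL 18, NB 1 18, SR 15,
    SL 9, SL 10, SL 11, SL 12, SL 13, SL 14, SR 8, SR 7, SR 6, SR 9, SR 8, SR 7, SR 10, SR 9,
    SR 8, SR 11, SR 12, SR 13, SR 10, SR 9, SR 11, SR 10, SR 12, SR 11, SR 5, SR 6, SR 7, SR 8,
    SR 9, SR 10, SR 4, SR 3, SR 5, SR 4, SR 6, SR 5, SR 7, SR 8, SR 9, SR 6, SR 7, SR 8, SR 2,
    SR 3, SR 4, SR 5, SR 6, SR 7, SR 1, SR 2, SR 3, SR 4, SR 5, SR 6, NF 1 19, SR 21, NF 0 17,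
    RW 2 19 3, SR 18, WR 5 20 3, SL 15, NF 1 16, NF 1 17, RW 6 18 2, NB 0 18, NB 0 19, SL 6, SL 5,
    SL 4, SL 7, SL 6, SL 5, SL 8, SL 7, SL 6, SL 9, SL 8, SL 7, SL 10, SL 9, SL 8, SL 11, SL 12,
    SL 10, SL 11, SL 9, SL 10, SL 13, SL 12, SL 11, SL 14, NF 1 15, SL 13, RW 7 17 2, NB 0 16,
    NB 0 14, NB 0 17, NB 0 15, SR 4, SL 3, SL 2, SL 1, RW 8 0 0, RW 8 2 2, SL 4, SL 5, SL 6, SL 7,
    SL 8, SL 9, SL 10, SL 11, SL 12, SR 6, SR 5, SR 4, WR 8 1 1, SR 2, NF 0 10, NF 0 9, WR 7 12 1,
    SR 8, NB 1 12, SR 9, SR 7, SR 8, SR 6, SR 7, SR 5, SR 6, SR 12, SR 11, SR 10, SR 9, SR 8,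
    SR 7, NF 0 4, WR 4 4 1, RW 9 3 1, NB 0 4, SL 6, SL 5, SL 7, SL 8, SL 9, SL 10, SL 11, NB 1 5,
    SR 4, NF 0 7, SR 6, SL 9, NB 1 9, NF 0 8, RW 2 10 1, NB 0 10, SR 9, SR 5, SR 6, RW 10 7 0,
    SL 2, RW 11 1 1, SR 4, SR 3, SR 2, WR 1 12 0, SL 11, NF 1 12, SL 10, SL 9, NF 0 10, SL 12,
    NF 1 13, SL 8, NF 0 9, SL 11, NF 0 6, SR 8, NF 0 9, NF 0 11, RW 5 13 3, SR 5, NF 0 6, SR 8,
    SR 9, NF 0 10, SR 12, NF 0 13, WR 2 15 3, NB 0 15, SL 12, NB 0 12, SL 9, SL 8, NB 0 8, SL 5,
    SR 12, SR 11, NB 0 11, SR 8, SR 13, NB 0 13, SL 10, SR 9, SR 10, SR 11, NB 0 15, SR 15,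
    NF 0 3, NF 0 3, NF 0 3, NF 0 3]"],
    simp add: lact_exp sym pract und pcom assoc coassoc tnaR unitL counitL, code_simp)

lemma comB_uniB: "holds r_comB_uniB"
  by (rule certificate[OF sig_dual, where rs = "[r_uniB_exp, r_comB_exp, r_sym 0 1, r_sym 0 0, r_sym 1 0, r_snake1, r_coumul]" and ms = "[
    RW 0 0 0, RW 1 2 0, NB 0 2, NB 0 5, NB 0 5, NB 0 5, SL 4, SL 3, RW 2 11 2, SL 10, RW 3 9 1,
    SR 7, NB 0 7, SL 4, SL 9, NB 0 9, SL 6, SL 5, WR 2 9 1, NB 0 9, SL 6, WR 2 10 2, SR 9, NB 0 9,
    SR 10, SL 13, NB 1 13, SL 1, NB 1 11, SL 2, SL 3, SL 4, SL 5, SL 6, NF 1 7, SR 8, SR 9, SL 0,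
    NB 0 1, NB 0 1, SL 5, SL 4, SL 3, SL 2, SL 6, SL 5, SL 7, SL 6, SL 8, SL 7, NB 0 11, SL 8,
    SR 11, NB 0 11, SR 12, NB 0 12, NB 0 12, SL 1, NB 0 2, NB 0 2, SR 6, NF 0 7, NF 0 5, SL 7,
    SR 4, SR 3, SR 5, SL 9, SL 8, NB 1 8, NB 1 6, SR 6, NF 0 7, RW 3 9 1, NF 0 5, SL 7, RW 4 8 2,
    SR 7, NB 0 7, NB 0 7, SR 2, SR 3, RW 5 4 0, RW 6 3 0, SR 3, NB 1 3, SR 1, WR 0 2 0, WR 0 0 0,
    NF 0 1]"],
    simp add: uniB_exp comB_exp sym snake1 coumul, code_simp)

lemma lact_uniB: "holds r_lact_uniB"
  by (rule certificate[OF sig_dual, where rs = "[r_uniB_exp, r_lact_exp, r_sym 1 0, r_sym 0 1, r_sym 0 0, r_snake1, r_coumul, r_tnacou, r_counitR]" and ms = "[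
    NB 0 0, RW 0 0 0, RW 1 3 0, SL 2, SL 3, NB 1 5, SR 3, SR 4, WR 2 5 1, SL 8, NB 0 8, NB 1 9,
    SR 7, WR 3 11 2, NB 0 11, NB 1 13, SL 1, RW 2 12 1, SR 2, SR 3, NF 0 4, SL 5, SL 6, SR 7,
    SL 8, NF 1 9, SR 10, SR 11, SR 12, SR 13, SL 0, NB 0 1, NB 0 1, SR 5, SR 4, SR 3, SR 2, SR 6,
    NF 0 7, NF 0 5, SL 7, SR 4, SR 3, SR 5, SL 9, SL 8, NB 1 8, NB 1 6, SR 8, SR 7, SR 6, SR 5,
    SR 7, NF 0 8, RW 4 10 1, NF 0 6, SL 8, RW 2 9 2, SR 8, SR 7, SR 9, SR 8, WR 2 9 2, SR 12,
    NB 0 12, NB 0 12, SR 1, SR 2, SR 3, SR 4, SR 5, SR 6, SR 7, NF 0 11, NF 0 10, SL 12, RW 2 9 2,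
    NF 0 8, RW 5 8 1, RW 6 7 1, NB 1 7, SR 5, NB 0 7, RW 7 4 2, SR 3, SR 2, RW 8 1 2, RW 6 2 0,
    SL 1, NB 1 3, WR 0 0 0]"],
    simp add: uniB_exp lact_exp sym snake1 coumul tnacou counitR, code_simp)

lemma lact_uni: "holds r_lact_uni"
  by (rule certificate[OF sig_dual, where rs = "[r_lact_exp, r_sym 1 0, r_comuni, r_tnauni, r_sym 0 0, r_unitL, r_unitR, r_sym 0 1, r_snake2]" and ms = "[
    RW 0 1 0, SR 2, WR 1 3 1, NB 0 6, SR 5, SR 1, RW 2 0 0, NB 0 1, SL 2, SR 5, SR 4, NB 0 4,
    SR 2, RW 3 1 0, NB 1 2, SR 1, NF 0 4, SR 3, SL 6, NB 1 6, NF 0 5, RW 4 7 1, NB 0 7, SR 2,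
    SR 3, RW 5 4 0, SL 0, NF 1 1, RW 6 1 0, NF 1 3, NF 0 1, RW 7 3 1, NF 0 0, RW 8 0 0]"],
    simp add: lact_exp sym comuni tnauni unitL unitR snake2, code_simp)

lemma ract_uniB: "holds r_ract_uniB"
  by (rule certificate[OF sig_dual, where rs = "[r_uniB_exp, r_pract, r_und 0 0, r_sym 1 0, r_sym 0 0, r_snake1, r_coumul, r_tnacou, r_counitL, r_counitR]" and ms = "[
    NB 0 0, RW 0 0 0, RW 1 3 0, RW 2 5 0, NB 1 3, SL 4, NB 1 4, SL 6, NF 0 4, NB 1 8, SR 6, SR 5,
    SR 4, NF 0 7, SR 6, NB 1 10, SR 7, RW 3 9 1, WR 4 8 1, NB 0 11, SR 1, SR 2, SR 3, SR 4, SR 5,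
    SR 6, SR 7, SR 8, SR 0, SR 1, SR 2, SR 3, SR 4, SR 5, NF 0 9, NF 0 8, SL 10, RW 4 7 2, NF 0 6,
    RW 5 6 1, RW 6 5 1, NB 1 5, SR 3, NB 0 5, RW 7 2 2, SL 2, RW 8 1 0, RW 9 0 0]"],
    simp add: uniB_exp pract und sym snake1 coumul tnacou counitL counitR, code_simp)

lemma ract_uni: "holds r_ract_uni"
  by (rule certificate[OF sig_dual, where rs = "[r_pract, r_und 0 0, r_comuni, r_sym 0 0, r_tnauni, r_unitL, r_pcou]" and ms = "[
    RW 0 1 0, RW 1 3 0, SR 3, RW 2 0 0, NB 0 1, NB 1 3, NB 0 5, NB 0 4, NF 0 4, RW 3 6 1, NB 0 6,
    SL 2, RW 4 1 0, SR 1, RW 5 2 0, RW 2 0 0, NF 1 1, SL 0, NF 0 1, WR 6 1 1]"],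
    simp add: pract und comuni sym tnauni unitL pcou, code_simp)

lemma mulB_unitL: "holds r_mulB_unitL"
  by (rule certificate[OF sig_dual, where rs = "[r_mulB_exp, r_sym 0 1, r_sym 0 0, r_uniB_exp, r_sym 1 0, r_snake1, r_counitL, r_snake2]" and ms = "[
    RW 0 1 0, NB 0 1, NB 0 1, NB 0 6, SL 4, NB 0 4, SL 2, RW 1 8 1, WR 2 6 1, NB 0 6, SL 3,
    WR 1 7 2, SR 6, NB 0 6, SR 7, SL 11, SL 10, NB 1 10, NB 1 8, WR 1 9 1, NB 0 9, NB 1 11,
    RW 3 0 0, SL 1, SL 2, SL 3, SL 4, NF 1 5, SR 6, SR 7, SL 0, NB 0 1, NB 0 1, SL 5, SL 4,
    NB 1 4, NB 1 3, SL 8, SL 7, NF 0 5, SR 7, NF 0 8, RW 2 10 2, NF 0 3, SL 5, NF 0 6, SL 8,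
    RW 4 9 3, SR 8, NB 0 8, SR 5, NB 0 5, NB 0 6, NB 0 5, SR 1, RW 5 2 0, RW 6 1 0, NF 1 3,
    NF 0 1, RW 1 3 1, NF 0 0, RW 7 0 0]"],
    simp add: mulB_exp sym uniB_exp snake1 counitL snake2, code_simp)

lemma mulB_unitR: "holds r_mulB_unitR"
  by (rule certificate[OF sig_dual, where rs = "[r_mulB_exp, r_sym 0 1, r_sym 0 0, r_uniB_exp, r_sym 1 0, r_snake1, r_counitR, r_snake2]" and ms = "[
    NB 0 0, RW 0 2 0, NB 0 2, NB 0 2, SL 1, NB 0 7, SL 5, NB 0 5, SL 3, SL 2, RW 1 9 1, WR 2 7 1,
    NB 0 7, SL 4, SL 3, WR 1 8 2, SR 7, NB 0 7, SL 4, WR 1 9 3, SR 8, SR 7, NB 0 7, SR 9, SR 8,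
    SR 10, SL 14, SL 13, NB 1 13, NB 1 11, NB 1 9, WR 1 10 1, NB 0 10, NB 1 12, RW 3 0 0, SL 1,
    SL 2, SL 8, SL 9, SL 7, SL 8, SL 6, NF 0 4, NF 0 6, SL 10, SR 5, SL 9, NB 1 9, SR 6, SL 0,
    NB 0 1, NB 0 1, SL 5, SL 4, NB 1 4, NB 1 3, SL 4, NB 0 9, SL 7, NB 0 7, SL 5, NB 0 5, SL 3,
    NF 0 5, RW 4 7 2, WR 2 4 1, NB 0 9, NB 0 7, SR 1, SR 3, SR 4, NF 0 5, NF 0 4, SL 6, RW 2 3 2,
    NF 0 2, RW 5 2 1, RW 6 1 0, NF 1 3, NF 0 1, RW 1 3 1, NF 0 0, RW 7 0 0]"],
    simp add: mulB_exp sym uniB_exp snake1 counitR snake2, code_simp)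

lemma comB_counitR: "holds r_comB_counitR"
  by (rule certificate[OF sig_dual, where rs = "[r_comB_exp, r_sym 0 1, r_sym 0 0, r_pcou, r_snake1, r_unitL, r_snake2]" and ms = "[
    RW 0 0 0, NB 0 0, NB 0 3, NB 0 3, NB 0 3, SL 2, SL 1, RW 1 9 2, SL 8, RW 2 7 1, SR 5, NB 0 5,
    SL 2, SL 7, NB 0 7, SL 4, SL 3, WR 1 7 1, NB 0 7, SL 4, WR 1 8 2, SR 7, NB 0 7, SR 8, SL 11,
    NB 1 11, NB 1 9, NB 0 9, RW 3 8 0, NB 0 8, SL 7, SL 6, SL 5, SL 4, SL 8, SL 7, SL 6, SL 9,
    WR 2 7 1, NB 0 7, SL 10, SL 9, NB 1 9, SL 3, SL 2, NF 1 4, SR 6, SL 3, SR 7, NB 0 6, NB 0 7,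
    SL 1, NF 1 2, RW 4 2 0, RW 5 1 0, NF 1 3, NF 0 1, RW 1 3 1, NF 0 0, RW 6 0 0]"],
    simp add: comB_exp sym pcou snake1 unitL snake2, code_simp)

text \<open>Four special products describe the double: \<open>(b 1)(1 h)\<close>,
  \<open>(1 h)(1 k)\<close>, \<open>(b 1)(c 1)\<close> and \<open>(1 h)(b 1)\<close>, in the order
  \<open>dmul1\<close> to \<open>dmul4\<close>. For a module they yield the factorisation of its
  structure, the actions of H and of the dual, and the exchange rule between them.\<close>

lemma dmul1: "holds r_dmul1"
  by (rule certificate[OF sig_dual, where rs = "[r_sym 1 0, r_sym 1 1, r_comB_uniB, r_lact_uniB, r_ract_uniB, r_mulB_unitR, r_counitL, r_unitL]" and ms = "[
    NB 0 0, NB 0 2, NB 0 2, SL 1, NB 1 5, SR 3, NB 0 3, NB 0 8, NB 0 7, NB 0 6, SL 4, SL 3,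
    RW 0 11 2, WR 1 10 2, NB 0 10, NB 0 8, SL 5, SL 4, SR 8, NB 0 8, SL 5, SL 12, NB 1 12, SR 9,
    NB 0 9, SL 6, NB 0 10, SL 7, SR 10, NB 0 10, SR 11, NB 0 11, WR 0 12 1, NB 0 12, NB 1 14,
    WR 0 13 1, NB 0 16, SL 2, RW 2 1 0, SR 2, NF 1 3, SR 3, SR 4, SR 1, NF 0 2, RW 3 2 0, NF 0 4,
    NF 0 4, RW 4 4 1, NF 1 3, SR 4, SR 5, SR 6, NF 0 2, NF 0 2, NF 0 2, RW 5 2 2, RW 6 1 0,
    NF 0 2, RW 0 1 1, NF 0 0, RW 7 0 1]"],
    simp add: sym comB_uniB lact_uniB ract_uniB mulB_unitR counitL unitL, code_simp)

lemma dmul2: "holds r_dmul2"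
  by (rule certificate[OF sig_dual, where rs = "[r_sym 1 0, r_sym 1 1, r_comB_uniB, r_lact_uniB, r_ract_uniB, r_mulB_unitL, r_counitL]" and ms = "[
    NB 0 1, NB 0 1, NB 1 4, SR 2, NB 0 6, NB 0 5, NB 0 4, RW 0 9 2, WR 1 8 2, NB 0 8, NB 0 6,
    SR 6, SL 10, NB 1 10, SR 7, SL 2, RW 2 1 0, SR 2, NF 1 3, SR 3, SR 4, SR 5, SR 1, NF 0 2,
    NF 0 2, RW 3 2 1, NB 0 2, SR 3, SL 4, NB 0 7, SR 7, SR 8, NF 0 4, NF 0 4, NF 0 4, RW 4 4 2,
    SL 1, SL 3, SL 4, SL 0, SL 2, NF 1 1, SL 2, RW 5 1 0, RW 6 1 1]"],
    simp add: sym comB_uniB lact_uniB ract_uniB mulB_unitL counitL, code_simp)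

lemma dmul3: "holds r_dmul3"
  by (rule certificate[OF sig_dual, where rs = "[r_sym 1 1, r_sym 1 0, r_sym 0 1, r_unitR, r_comuni, r_lact_uni, r_ract_uni, r_comB_counitR]" and ms = "[
    NB 0 0, NB 0 2, NB 0 2, NB 0 2, SL 1, SL 5, NB 1 5, SR 3, NB 0 3, NB 1 9, SR 7, SR 6, SR 5,
    SR 4, SR 3, SL 10, NF 0 8, WR 0 4 3, SR 9, SR 8, SR 7, NB 0 7, SL 13, SL 12, NB 1 12, SR 9,
    NB 0 9, SL 6, WR 0 7 3, NB 1 15, SR 12, SR 11, SR 10, NB 0 10, WR 1 12 2, SR 11, NB 0 11,
    SR 12, SL 15, NB 1 15, NB 1 13, NB 0 14, NB 0 15, SR 1, SR 2, SR 6, SR 7, WR 0 4 4, SR 7,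
    NB 0 7, NB 0 9, SL 6, SL 12, SL 11, SL 13, WR 2 12 1, NB 0 12, SL 14, NB 1 14, SR 3, SR 4,
    SR 5, NF 1 9, SR 11, SL 8, SL 7, SR 12, NB 0 11, SL 8, NB 0 12, SL 9, NF 0 6, NF 0 6,
    RW 3 6 1, RW 4 0 0, NB 0 1, SR 2, SR 3, SR 4, WR 2 5 1, NB 0 8, SR 7, NB 1 10, RW 2 9 0, SR 1,
    SR 6, SR 7, SR 5, NB 0 5, NB 0 7, SL 4, SR 0, SR 2, SR 3, SR 7, NB 0 7, SR 4, NF 0 3,
    RW 0 2 1, NF 0 1, RW 5 1 1, NF 1 5, NF 0 4, NF 0 6, RW 0 3 1, SL 2, RW 0 3 2, NF 0 1, NF 0 1,
    RW 6 1 2, NB 0 1, NB 0 1, SR 3, SR 2, NB 1 5, SR 1, RW 7 0 1, SR 0, NF 0 1]"],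
    simp add: sym unitR comuni lact_uni ract_uni comB_counitR, code_simp)

lemma dmul4: "holds r_dmul4"
  by (rule certificate[OF sig_dual, where rs = "[r_mulB_unitL, r_unitR]" and ms = "[
    NB 0 1, NB 0 1, NB 0 1, SL 4, NB 1 4, SR 2, NB 1 7, SR 5, SR 4, SR 3, SL 8, NF 0 6, SR 5,
    SR 4, SL 9, SL 8, NB 1 8, SR 5, NB 1 10, SR 7, SR 6, SL 9, NB 1 9, SR 1, SR 2, SR 3, SR 4,
    SL 6, SR 0, SR 1, SR 2, SR 3, SR 5, RW 0 4 0, SR 4, NF 0 5, NF 0 5, RW 1 5 1]"],
    simp add: mulB_unitL unitR, code_simp)

end

subsection \<open>Modules over the double\<close>

abbreviation "alphaM \<equiv> Atom (Gen 24 [1, 0, 2] [2])"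
abbreviation "star \<equiv> Atom (Gen 25 [1, 2] [2])"
abbreviation "alphaN \<equiv> Atom (Gen 26 [1, 0, 3] [3])"

text \<open>\<open>starM\<close> is \<open>b m = m\<^sub>0 \<langle>b, m\<^sub>1\<rangle>\<close>, and \<open>coS\<close> recovers the coaction from such an action as \<open>m \<mapsto> \<Sum> e\<^sup>i m \<otimes> e\<^sub>i\<close>.\<close>

abbreviation "starM \<equiv> Idw [2] \<oslash> evl \<odot> Atom (Over 1 2) \<oslash> Idw [0] \<odot> Idw [1] \<oslash> coactM"
abbreviation "starN \<equiv> Idw [3] \<oslash> evl \<odot> Atom (Over 1 3) \<oslash> Idw [0] \<odot> Idw [1] \<oslash> coactN"
abbreviation "alM \<equiv> starM \<odot> Idw [1] \<oslash> actM"
abbreviation "alN \<equiv> starN \<odot> Idw [1] \<oslash> actN"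
abbreviation "alS \<equiv> star \<odot> Idw [1] \<oslash> actM"
abbreviation "coS \<equiv> Overs [0] [2] \<odot> Idw [0] \<oslash> star \<odot> dbs \<oslash> Idw [2]"
abbreviation "actAl \<equiv> alphaM \<odot> uniB \<oslash> Idw [0] \<oslash> Idw [2]"
abbreviation "starAl \<equiv> alphaM \<odot> Idw [1] \<oslash> uni \<oslash> Idw [2]"

definition "dual_yd_gens = dual_gens @ [Gen 14 [0, 2] [2], Gen 15 [2] [2, 0], Gen 16 [0, 3] [3], Gen 17 [3] [3, 0]]"
definition "star_gens = dual_gens @ [Gen 14 [0, 2] [2], Gen 25 [1, 2] [2]]"
definition "alpha_gens = dual_gens @ [Gen 24 [1, 0, 2] [2]]"
definition "lin_gens = dual_gens @ [Gen 14 [0, 2] [2], Gen 15 [2] [2, 0], Gen 16 [0, 3] [3], Gen 17 [3] [3, 0], Gen 22 [2] [3]]"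
definition "alpha_lin_gens = dual_gens @ [Gen 24 [1, 0, 2] [2], Gen 26 [1, 0, 3] [3], Gen 22 [2] [3]]"

definition "r_star_mul = (starM \<odot> mulB \<oslash> Idw [2], starM \<odot> Idw [1] \<oslash> starM)"
definition "r_star_uni = (starM \<odot> uniB \<oslash> Idw [2], Idw [2])"
definition "r_star_cross =
  (actM \<odot> Idw [0] \<oslash> starM,
   starM \<odot> Idw [1] \<oslash> actM \<odot> crossE \<oslash> Idw [2])"
definition "r_coact_star =
  (Overs [0] [2] \<odot> Idw [0] \<oslash> starM \<odot> dbs \<oslash> Idw [2],
   coactM)"
definition "r_al_tensor =
  (alM \<oslash> alN \<odot> Idw [1, 0] \<oslash> Overs [1, 0] [2] \<oslash> Idw [3] \<odot> (Idw [1] \<oslash> Overs [1] [0] \<oslash> Idw [0] \<odot> comB \<oslash> com) \<oslash> Idw [2] \<oslash> Idw [3],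
   (Idw [2, 3] \<oslash> evl \<odot> Overs [1] [2, 3] \<oslash> Idw [0] \<odot> Idw [1] \<oslash> tenC) \<odot> Idw [1] \<oslash> tenA)"
definition "r_al_unit =
  (couB \<oslash> cou,
   (Idw [] \<oslash> evl \<odot> Overs [1] [] \<oslash> Idw [0] \<odot> Idw [1] \<oslash> uni) \<odot> Idw [1] \<oslash> cou)"
definition "r_al_braid =
  (Overs [2] [3] \<odot> actM \<oslash> starN \<odot> Idw [0] \<oslash> Overs [1] [2] \<oslash> Idw [3] \<odot> dbs \<oslash> Idw [2] \<oslash> Idw [3],
   brd)"

locale dual_yd_diagrams = dual_diagrams + yd_diagrams +
  assumes sig_dual_yd: "sig_ok dual_yd_gens"
begin

lemma star_mul: "holds r_star_mul"
  by (rule certificate[OF sig_dual_yd, where rs = "[r_sym 2 0, r_pmul, r_sym 0 0, r_coass_M]" and ms = "[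
    WR 0 2 1, NB 0 5, SR 0, SR 1, RW 1 2 0, NB 1 2, SL 3, SR 5, WR 2 2 3, SR 5, NB 0 5, NB 0 7,
    SL 4, WR 3 0 2, NF 0 1, SL 2, NF 0 5, RW 0 4 1, NF 0 2, RW 0 1 2]"],
    simp add: sym pmul coass_M, code_simp)

lemma star_uni: "holds r_star_uni"
  by (rule certificate[OF sig_dual_yd, where rs = "[r_puni, r_coun_M]" and ms = "[
    SR 0, NF 0 1, RW 0 1 1, RW 1 0 0]"],
    simp add: puni coun_M, code_simp)

text \<open>By \<open>theta\<close> the right side is
  \<open>(h_2 m)_0 <b, S^-1(h_3) (h_2 m)_1 h_1>\<close>. The Yetter-Drinfel'd condition makes it
  \<open>h_1 m_0 <b, S^-1(h_3) h_2 m_1>\<close>, where \<open>S^-1(h_3) h_2\<close> cancels by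
  \<open>tnaL\<close>. The moves follow this calculation backwards.\<close>

lemma star_cross: "holds r_star_cross"
  by (rule certificate[OF sig_dual_yd, where rs = "[r_sym 2 0, r_counitR, r_unitL, r_sym 1 0, r_sym 0 0, r_sym 0 2, r_tnaL, r_und 0 0, r_coassoc, r_assoc, r_sym 0 1, r_yds_M, r_snake1, r_theta]" and ms = "[
    WR 0 1 2, NB 0 4, NF 1 2, SL 1, SR 4, NB 0 4, WR 1 0 0, WR 2 3 3, NB 0 3, NB 0 3, NB 0 3,
    WR 0 6 3, SR 5, SR 4, WR 3 6 2, SR 5, WR 4 6 1, NB 0 13, NB 0 11, NB 0 9, SL 10, NF 0 8,
    NB 1 12, SR 9, RW 5 11 1, SR 7, SR 8, NB 0 7, SL 4, SR 7, NB 0 7, NB 1 3, SL 2, WR 6 1 1,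
    RW 7 2 1, NB 1 3, SR 4, SR 3, NF 1 5, SR 7, SR 8, NB 0 6, SR 6, SR 7, WR 8 0 0, SR 1, SR 9,
    SR 10, RW 9 11 0, SR 8, SR 9, WR 4 10 1, NB 0 13, WR 10 13 1, WR 5 14 2, NF 0 11, NF 0 13,
    NF 0 15, RW 4 10 1, SL 9, RW 3 10 2, SL 8, SL 9, RW 0 10 3, SL 7, SL 8, NF 1 9, SL 6, NF 0 4,
    NF 0 6, RW 4 8 2, SL 3, SL 4, SL 5, SL 6, NF 0 2, NF 0 3, WR 11 4 2, NB 0 4, NB 0 3, SR 4,
    SR 6, SR 5, NB 1 9, SR 7, SR 6, SL 1, RW 8 0 0, WR 12 7 4, NB 0 7, NB 0 7, NB 0 7, NB 0 7,
    WR 0 14 5, SR 13, SR 12, SR 11, SR 10, SR 9, SR 8, WR 3 13 4, SR 12, SR 11, SR 10, SR 9,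
    WR 4 12 3, SR 11, SR 10, WR 4 11 2, SR 23, NB 0 23, SR 20, NB 0 20, SR 17, NB 0 17, SR 14,
    NB 0 14, SL 16, SL 17, SL 15, NF 0 13, NF 0 15, NF 0 17, RW 4 19 3, NB 0 19, NB 0 17, NB 0 15,
    RW 5 16 2, RW 10 15 1, SL 6, SL 5, SL 4, SL 3, NF 0 12, RW 4 11 2, SL 10, SL 9, SL 8, SL 12,
    SL 11, SL 10, SL 9, SL 7, SL 8, SL 6, SL 5, SL 4, SL 7, SL 6, SL 5, NF 1 13, SR 15, SL 12,
    SL 11, SL 10, SR 16, NB 0 15, SL 12, SL 11, NB 0 16, SL 13, SL 12, SL 9, SL 10, SL 11, SL 8,
    SL 9, SL 7, SL 8, SL 6, SL 10, WR 4 9 2, NB 0 9, SL 11, NB 1 11, SR 17, SR 18, NB 0 17, SL 14,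
    NB 0 18, SL 15, SL 13, SL 14, SL 12, NF 0 10, SL 13, NB 1 13, WR 3 12 0, SL 11, NF 1 12,
    SL 10, SL 9, NF 0 10, SL 12, NF 1 13, SL 8, NF 0 9, SL 11, NF 0 6, SR 8, NF 0 9, NF 0 11,
    RW 10 13 3, SR 5, NF 0 6, SR 8, SR 9, NF 0 10, SR 12, NF 0 13, WR 4 15 3, NB 0 15, SL 12,
    NB 0 12, SL 9, SL 8, NB 0 8, SL 5, SR 12, SR 11, NB 0 11, SR 8, SR 13, NB 0 13, SL 10, SR 9,
    SR 10, SR 11, NB 0 15, SR 15, NF 0 3, NF 0 3, NF 0 3, NF 0 3, WR 13 0 0, NF 0 8, RW 0 7 1]"],
    simp add: sym counitR unitL tnaL und coassoc assoc yds_M snake1 theta, code_simp)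

lemma coact_star: "holds r_coact_star"
  by (rule certificate[OF sig_dual_yd, where rs = "[r_snake1]" and ms = "[
    SR 0, SL 3, NF 0 1, RW 0 1 1]"],
    simp add: snake1, code_simp)

text \<open>The comultiplication of the dual pairs to the opposite product, so
  \<open><b_1, m_1> <b_2, n_1> = <b, n_1 m_1>\<close>, which is the pairing of \<open>b\<close> with
  the tensor coaction.\<close>

lemma al_tensor: "holds r_al_tensor"
  by (rule certificate[OF sig_dual_yd, where rs = "[r_sym 0 0, r_sym 2 0, r_sym 3 0, r_pcom, r_sym 0 3]" and ms = "[
    WR 0 2 2, SR 4, NB 1 7, NB 1 5, NB 1 6, NB 1 5, SL 8, SL 6, SL 7, WR 1 5 3, SR 9, SR 8,
    NB 0 8, SR 10, NB 0 10, SL 7, NB 0 12, SL 9, SL 8, SR 10, SR 11, WR 2 13 2, SR 12, WR 1 13 1,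
    NB 0 18, NB 0 16, SR 0, SR 1, SR 2, SR 3, SR 8, SR 9, SR 7, NB 0 7, SR 8, SR 7, SR 10, SR 9,
    SR 8, SR 4, SR 5, SR 6, SR 7, SR 11, SR 12, SR 10, SR 11, SR 8, SR 9, SR 10, RW 3 11 0, SR 8,
    NF 0 9, WR 4 11 3, SR 10, NB 0 10, SR 11, NB 1 14, NB 1 12, NF 1 3, SR 4, NF 0 12, NF 0 14,
    RW 1 11 1, SL 10, RW 2 11 2, NF 1 2, RW 0 1 1]"],
    simp add: sym pcom, code_simp)

lemma al_unit: "holds r_al_unit"
  by (rule certificate[OF sig_dual_yd, where rs = "[r_pcou]" and ms = "[
    RW 0 0 0, SR 1, SR 0]"],
    simp add: pcou, code_simp)

text \<open>With \<open>d = \<Sum> e_i \<otimes> e^i\<close>, acting with \<open>e^i\<close> on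
  \<open>n\<close> gives \<open>n_0 <e^i, n_1>\<close>, and by the snake identity the sum replaces
  \<open>e_i\<close> by \<open>n_1\<close>.\<close>

lemma al_braid: "holds r_al_braid"
  by (rule certificate[OF sig_dual_yd, where rs = "[r_sym 0 1, r_sym 3 0, r_sym 2 0, r_snake1]" and ms = "[
    WR 0 1 0, NB 1 4, SR 3, WR 1 5 2, SR 4, WR 2 5 1, NB 0 10, NB 0 8, SR 6, NB 0 6, NF 1 3,
    NF 0 2, SR 1, SR 0, SL 4, NB 1 4, SR 2, SL 6, NF 0 4, SL 7, SR 3, SL 6, NB 1 6, SR 1, NF 0 4,
    SL 6, RW 1 3 2, NF 0 2, RW 3 2 1]"],
    simp add: sym snake1, code_simp)

end

section \<open>Compatible actions of H and of its dual\<close>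

definition "r_st_mul = (star \<odot> mulB \<oslash> Idw [2], star \<odot> Idw [1] \<oslash> star)"
definition "r_st_uni = (star \<odot> uniB \<oslash> Idw [2], Idw [2])"
definition "r_st_cross =
  (actM \<odot> Idw [0] \<oslash> star,
   star \<odot> Idw [1] \<oslash> actM \<odot> crossE \<oslash> Idw [2])"
definition "r_al_mul = (alS \<odot> mulDE \<oslash> Idw [2], alS \<odot> Idw [1, 0] \<oslash> alS)"
definition "r_al_uni = (alS \<odot> (uniB \<oslash> uni) \<oslash> Idw [2], Idw [2])"
definition "r_al_H = (alS \<odot> uniB \<oslash> Idw [0] \<oslash> Idw [2], actM)"
definition "r_al_B = (alS \<odot> Idw [1] \<oslash> uni \<oslash> Idw [2], star)"
definition "r_co_coun = (Idw [2] \<oslash> cou \<odot> coS, Idw [2])"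
definition "r_co_coass = (coS \<oslash> Idw [0] \<odot> coS, Idw [2] \<oslash> com \<odot> coS)"
definition "r_co_yd =
  (Idw [2] \<oslash> mul \<odot> coS \<oslash> Idw [0] \<odot> Unders [0] [2] \<odot> Idw [0] \<oslash> actM \<odot> com \<oslash> Idw [2],
   actM \<oslash> mul \<odot> Idw [0] \<oslash> Overs [0] [2] \<oslash> Idw [0] \<odot> com \<oslash> coS)"
definition "r_star_coG =
  (Idw [2] \<oslash> evl \<odot> Atom (Over 1 2) \<oslash> Idw [0] \<odot> Idw [1] \<oslash> coS,
   star)"

text \<open>The pivot of the correspondence: a Yetter-Drinfel'd module yields such a pair of actions
  through \<open>starM\<close>, a module over the double through restriction. The lemmas here lead
  from the pair to either side.\<close>

locale star_diagrams = dual_diagrams +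
  assumes sig_star: "sig_ok star_gens"
    and modass_M: "holds r_modass_M" and modun_M: "holds r_modun_M" and st_mul: "holds r_st_mul" and st_uni: "holds r_st_uni" and st_cross: "holds r_st_cross"
begin

lemma al_mul: "holds r_al_mul"
  by (rule certificate[OF sig_star, where rs = "[r_sym 1 1, r_modass_M, r_st_mul, r_st_cross]" and ms = "[
    SR 3, WR 0 2 3, NB 0 5, SR 6, SR 7, SR 5, SR 6, RW 1 5 3, SR 4, SR 3, SR 2, SL 6, NF 0 4,
    RW 0 3 3, SL 4, SR 1, SR 0, RW 2 7 0, WR 3 1 1]"],
    simp add: sym modass_M st_mul st_cross, code_simp)

lemma al_uni: "holds r_al_uni"
  by (rule certificate[OF sig_star, where rs = "[r_st_uni, r_modun_M]" and ms = "[
    SR 0, SR 1, RW 0 2 0, RW 1 0 0]"],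
    simp add: st_uni modun_M, code_simp)

lemma al_H: "holds r_al_H"
  by (rule certificate[OF sig_star, where rs = "[r_st_uni]" and ms = "[
    SR 0, RW 0 1 0]"],
    simp add: st_uni, code_simp)

lemma al_B: "holds r_al_B"
  by (rule certificate[OF sig_star, where rs = "[r_modun_M]" and ms = "[
    RW 0 0 1]"],
    simp add: modun_M, code_simp)

lemma co_coun: "holds r_co_coun"
  by (rule certificate[OF sig_star, where rs = "[r_uniB_exp, r_st_uni]" and ms = "[
    NB 0 3, SL 1, WR 0 0 0, RW 1 0 0]"],
    simp add: uniB_exp st_uni, code_simp)

text \<open>Applying \<open>coS\<close> twice acts with the products \<open>e^j e^i\<close>; the
  formula for \<open>mulB\<close> turns them into actions of single \<open>e^k\<close> together with
  the coproduct of \<open>e_k\<close>.\<close>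

lemma co_coass: "holds r_co_coass"
  by (rule certificate[OF sig_star, where rs = "[r_sym 1 0, r_st_mul, r_sym 0 1, r_mulB_exp, r_sym 0 0, r_snake1]" and ms = "[
    SL 2, WR 0 3 1, NB 1 6, SL 1, SL 2, WR 1 3 2, WR 2 2 2, NB 0 5, RW 3 3 1, NB 0 3, SL 2,
    NB 0 2, NB 0 2, NB 0 10, SL 8, SL 7, NB 0 7, SL 5, NB 0 5, SL 3, RW 2 13 2, WR 4 10 2,
    NB 0 10, SL 7, NB 0 7, SL 4, WR 2 11 3, SR 10, NB 0 10, SR 7, NB 0 7, SR 8, SR 7, SR 11,
    SL 16, SL 15, SL 14, NB 1 14, NB 1 12, SR 9, SR 8, WR 2 14 2, NB 0 14, SL 11, NB 0 11,
    WR 4 15 3, SR 14, NB 0 14, SR 11, SR 12, SR 15, NB 1 18, NB 1 16, SR 13, SL 1, NB 0 2, NB 0 2,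
    SL 6, SL 5, NB 1 5, NB 1 4, SL 9, SL 8, NF 0 6, SR 8, NF 0 9, RW 4 11 2, NF 0 4, SL 6, NF 0 7,
    SL 9, RW 0 10 3, SR 9, NB 0 9, SR 6, NB 0 6, NF 0 5, RW 4 7 1, SR 6, SR 7, SR 8, RW 2 9 0,
    SR 2, SR 4, SR 5, SR 6, SR 7, SL 0, NB 0 1, NB 0 1, SL 5, SL 4, NB 1 4, NB 1 3, SL 4, SL 8,
    SL 7, SL 6, SL 5, SL 4, SL 3, SR 7, NF 0 8, RW 4 10 4, NF 0 6, SL 8, RW 0 9 5, WR 4 4 4,
    SR 10, NB 0 10, SR 7, NB 0 7, SL 7, RW 2 8 1, SR 1, SR 3, SR 4, SR 5, NF 0 4, SL 6, RW 4 3 2,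
    NF 0 2, RW 5 2 1, RW 5 2 0, SR 1, NF 0 2]"],
    simp add: sym st_mul mulB_exp snake1, code_simp)

text \<open>The converse of \<open>star_cross\<close>: with the coaction
  \<open>m \<mapsto> \<Sum> e^i m \<otimes> e_i\<close>, the exchange rule turns
  \<open>h_1 (e^i m) \<otimes> h_2 e_i\<close> into
  \<open>e^j (h_2 m) \<otimes> h_4 S^-1(h_3) e_j h_1\<close>, where \<open>h_4 S^-1(h_3)\<close>
  cancels by \<open>tnaR\<close>.\<close>

lemma co_yd: "holds r_co_yd"
  by (rule certificate[OF sig_star, where rs = "[r_und 0 2, r_sym 1 0, r_counitR, r_unitL, r_sym 0 1, r_sym 0 0, r_tnaR, r_und 0 0, r_coassoc, r_assoc, r_snake1, r_theta, r_sym 1 1, r_st_cross]" and ms = "[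
    RW 0 2 0, SL 2, WR 1 3 1, NB 1 6, NB 0 7, SL 1, SL 4, SL 2, SL 3, WR 2 1 1, WR 3 4 0,
    WR 4 9 0, SL 8, NF 0 7, RW 1 6 1, NF 0 5, NB 1 4, NF 0 5, NF 0 4, SR 3, WR 5 9 1, NF 0 8,
    WR 5 10 2, NB 0 10, NF 0 7, NF 0 9, NF 0 6, NF 0 8, SR 5, SR 7, SR 6, SR 4, SR 5, NF 0 3,
    NF 0 3, WR 6 2 2, RW 7 3 2, NB 0 4, SL 5, SL 4, WR 8 1 1, WR 8 0 0, SL 6, SL 7, SL 8, NF 1 9,
    SL 5, SL 6, SL 7, RW 9 11 3, NB 0 10, NB 0 11, SL 11, NF 1 12, SL 10, RW 9 14 2, NB 0 13,
    NB 0 14, NF 1 14, SR 16, NB 0 15, SR 15, NF 1 17, SR 19, NB 0 18, SR 18, SL 9, NF 1 10, SL 8,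
    NF 0 6, NF 0 8, RW 5 10 3, RW 9 10 2, WR 1 5 1, NB 0 12, NB 0 10, NB 0 8, WR 10 11 2, NB 0 11,
    NB 0 11, WR 5 14 3, SR 13, SR 12, WR 1 13 2, SR 19, NB 0 19, SR 16, NB 0 16, RW 5 16 1, SR 15,
    SR 16, RW 4 17 0, SL 10, SL 9, SL 8, SL 7, SL 6, SL 5, WR 4 17 0, SL 16, SL 15, NF 0 14,
    SL 16, RW 1 13 2, SL 12, SL 13, SL 11, SL 12, SL 10, SL 11, SL 9, SL 10, WR 1 11 2, SR 10,
    NB 0 10, WR 5 12 1, NB 0 12, SL 9, NF 1 7, NF 1 9, SR 11, SR 12, SL 8, SL 6, SL 7, SR 10,
    NB 0 10, NB 0 12, SL 9, NF 0 5, NF 0 5, SR 4, SL 3, SL 2, SL 1, SL 19, SL 18, WR 1 19 1,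
    SL 17, NF 0 18, SL 20, NF 1 21, SL 16, RW 5 17 3, SL 15, SL 16, SL 17, SL 18, NF 1 19, SL 14,
    SL 15, SL 16, SL 17, SL 13, SL 12, NF 0 13, SL 15, NF 0 10, SR 12, NF 0 13, NF 0 15, NF 0 17,
    RW 4 19 4, SR 9, NF 0 10, SR 12, SR 13, NF 0 14, SR 16, NF 0 17, SR 19, NF 0 20, NF 0 8,
    SL 10, SR 11, NF 0 12, SL 14, NF 0 15, SL 17, NF 0 18, SL 20, RW 5 7 2, SL 6, SL 7, SR 18,
    NB 0 18, SR 15, NB 0 15, SR 12, NB 0 12, SL 9, WR 5 20 4, NB 0 20, SL 17, NB 0 17, SL 14,
    NB 0 14, SL 11, SL 10, WR 1 15 5, SR 14, SR 19, SR 18, NB 0 18, SR 15, SR 20, NB 0 20, SL 17,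
    SR 16, SR 17, SR 18, NB 0 22, SR 22, NF 0 5, SR 5, NF 0 6, SR 6, NF 0 7, SR 7, NF 0 8, NF 0 8,
    SL 4, SL 5, NF 1 6, SL 3, NF 1 4, NF 1 2, WR 11 3 1, NB 1 3, NB 0 5, NB 0 4, RW 1 7 2,
    WR 12 6 2, NB 0 6, SL 8, NB 1 8, SL 11, NF 0 9, SL 11, NF 0 8, SL 10, SR 7, NF 0 8, SR 6,
    NF 0 7, SL 9, NF 1 10, SR 12, SR 5, NF 0 6, SL 8, SR 4, SR 5, NF 0 6, NF 0 8, RW 12 10 3,
    WR 1 11 3, SR 3, SR 4, NF 0 5, NF 0 6, NF 0 7, NF 0 2, SL 3, NF 1 4, WR 13 5 2, NB 0 4, SR 4,
    NF 0 8, NF 0 7, NF 1 6, NF 1 8, SR 10, SL 7, RW 5 5 1, NB 0 8, SL 4, SL 5, SL 3, NF 0 1,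
    NF 0 1]"],
    simp add: und sym counitR unitL tnaR coassoc assoc snake1 theta st_cross, code_simp)

lemma star_coG: "holds r_star_coG"
  by (rule certificate[OF sig_star, where rs = "[r_snake2]" and ms = "[
    NB 0 4, SL 1, RW 0 0 0]"],
    simp add: snake2, code_simp)

end

section \<open>Restriction of a module over the double to H and to the dual\<close>

definition "r_alp_mul =
  (alphaM \<odot> mulDE \<oslash> Idw [2],
   alphaM \<odot> Idw [1, 0] \<oslash> alphaM)"
definition "r_alp_uni = (alphaM \<odot> (uniB \<oslash> uni) \<oslash> Idw [2], Idw [2])"
definition "r_go_factor = (alphaM, starAl \<odot> Idw [1] \<oslash> actAl)"
definition "r_go_act = (actAl \<odot> mul \<oslash> Idw [2], actAl \<odot> Idw [0] \<oslash> actAl)"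
definition "r_go_actun = (actAl \<odot> uni \<oslash> Idw [2], Idw [2])"
definition "r_go_star =
  (starAl \<odot> mulB \<oslash> Idw [2],
   starAl \<odot> Idw [1] \<oslash> starAl)"
definition "r_go_starun = (starAl \<odot> uniB \<oslash> Idw [2], Idw [2])"
definition "r_go_cross =
  (actAl \<odot> Idw [0] \<oslash> starAl,
   starAl \<odot> Idw [1] \<oslash> actAl \<odot> crossE \<oslash> Idw [2])"

locale alpha_diagrams = dual_diagrams +
  assumes sig_alpha: "sig_ok alpha_gens"
    and alp_mul: "holds r_alp_mul" and alp_uni: "holds r_alp_uni"
begin

text \<open>\<open>b \<otimes> h\<close> is the product \<open>(b 1)(1 h)\<close>, so the two
  restrictions determine the whole structure.\<close>

lemma go_factor: "holds r_go_factor"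
  by (rule certificate[OF sig_alpha, where rs = "[r_dmul1, r_alp_mul]" and ms = "[
    WR 0 0 0, NB 0 0, NB 0 2, NB 0 2, SL 1, RW 1 5 0, NB 0 4, SR 4, SL 0, NF 1 1, SR 1, SR 2,
    NF 0 3, NF 0 0]"],
    simp add: dmul1 alp_mul, code_simp)

lemma go_act: "holds r_go_act"
  by (rule certificate[OF sig_alpha, where rs = "[r_dmul2, r_alp_mul]" and ms = "[
    SL 0, WR 0 0 0, NB 0 1, NB 0 1, RW 1 4 0, SL 0, NF 1 1, SR 1, SR 2, NF 0 0]"],
    simp add: dmul2 alp_mul, code_simp)

lemma go_actun: "holds r_go_actun"
  by (rule certificate[OF sig_alpha, where rs = "[r_alp_uni]" and ms = "[
    SL 0, RW 0 0 0]"],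
    simp add: alp_uni, code_simp)

lemma go_star: "holds r_go_star"
  by (rule certificate[OF sig_alpha, where rs = "[r_dmul3, r_alp_mul]" and ms = "[
    WR 0 0 0, NB 0 0, NB 0 2, NB 0 2, NB 0 2, SL 1, RW 1 6 0, NB 0 4, SR 4, SR 5, SL 0, NF 1 1,
    SR 1, SR 2, SR 3, NF 0 4, NF 0 0, NF 0 0]"],
    simp add: dmul3 alp_mul, code_simp)

lemma go_starun: "holds r_go_starun"
  by (rule certificate[OF sig_alpha, where rs = "[r_alp_uni]" and ms = "[
    RW 0 0 0]"],
    simp add: alp_uni, code_simp)

text \<open>The product \<open>(1 h)(b 1)\<close> acts in two ways: factor by factor, and as
  \<open>crossE\<close>, whose action \<open>go_factor\<close> splits again.\<close>

lemma go_cross: "holds r_go_cross"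
  by (rule certificate[OF sig_alpha, where rs = "[r_alp_mul, r_dmul4, r_go_factor]" and ms = "[
    NB 0 0, NB 0 0, SL 3, SL 2, SL 1, SL 0, NB 0 1, WR 0 5 0, NF 0 1, NF 0 1, NF 0 1, RW 1 0 0,
    RW 2 5 0]"],
    simp add: alp_mul dmul4 go_factor, code_simp)

end

section \<open>Linear maps over the double against linear and colinear maps\<close>

definition "r_lin_al = (morF \<odot> alM, alN \<odot> Idw [1, 0] \<oslash> morF)"

locale lin_diagrams = dual_diagrams +
  assumes sig_lin: "sig_ok lin_gens"
    and linf: "holds r_linf" and colf: "holds r_colf"
begin

lemma lin_al: "holds r_lin_al"
  by (rule certificate[OF sig_lin, where rs = "[r_sym 2 0, r_colf, r_linf, r_sym 3 0]" and ms = "[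
    WR 0 2 1, NB 0 5, SR 3, NB 0 3, WR 1 1 1, RW 2 0 1, NF 0 4, RW 3 3 1]"],
    simp add: sym colf linf, code_simp)

end

definition "r_alf = (morF \<odot> alphaM, alphaN \<odot> Idw [1, 0] \<oslash> morF)"
definition "r_lin_H =
  (morF \<odot> actAl,
   (alphaN \<odot> uniB \<oslash> Idw [0] \<oslash> Idw [3]) \<odot> Idw [0] \<oslash> morF)"
definition "r_colin_B =
  ((Overs [0] [3] \<odot> Idw [0] \<oslash> (alphaN \<odot> Idw [1] \<oslash> uni \<oslash> Idw [3]) \<odot> dbs \<oslash> Idw [3]) \<odot> morF,
   morF \<oslash> Idw [0] \<odot> Overs [0] [2] \<odot> Idw [0] \<oslash> starAl \<odot> dbs \<oslash> Idw [2])"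

locale alpha_lin_diagrams = dual_diagrams +
  assumes sig_alpha_lin: "sig_ok alpha_lin_gens"
    and alf: "holds r_alf"
begin

lemma lin_H: "holds r_lin_H"
  by (rule certificate[OF sig_alpha_lin, where rs = "[r_alf]" and ms = "[
    RW 0 1 0, SR 0]"],
    simp add: alf, code_simp)

lemma colin_B: "holds r_colin_B"
  by (rule certificate[OF sig_alpha_lin, where rs = "[r_alf]" and ms = "[
    NB 0 2, NB 0 2, SL 0, SL 1, SL 2, SL 3, WR 0 4 1, NF 1 5, NF 0 1, NF 0 1]"],
    simp add: alf, code_simp)

end

subsection \<open>Categories of structured objects\<close>

text \<open>The common shape of both categories: morphisms are morphisms of C tagged with source and
  target. An isomorphism between two such categories can then leave the underlying morphisms
  unchanged.\<close>

definition concrete_cat ::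
    "('o, 'a, 'x) braided_cat_scheme \<Rightarrow> 'p set \<Rightarrow> ('p \<Rightarrow> 'o) \<Rightarrow> ('p \<Rightarrow> 'p \<Rightarrow> 'a \<Rightarrow> bool) \<Rightarrow> ('p \<Rightarrow> 'p \<Rightarrow> 'p) \<Rightarrow> 'p
      \<Rightarrow> ('p \<Rightarrow> 'p \<Rightarrow> 'a) \<Rightarrow> ('p, 'p \<times> 'a \<times> 'p) braided_cat" where
  "concrete_cat C P U mor tens one br = \<lparr>
     Obj = P,
     Arr = {(X, f, Y). X \<in> P \<and> Y \<in> P \<and> mor X Y f},
     src = (\<lambda>(X, f, Y). X),
     tgt = (\<lambda>(X, f, Y). Y),
     ident = (\<lambda>X. (X, \<langle>U X\<rangle>\<^bsub>C\<^esub>, X)),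
     cmp = (\<lambda>(Y', g, Z) (X, f, Y). (X, g \<cdot>\<^bsub>C\<^esub> f, Z)),
     tobj = tens,
     tarr = (\<lambda>(X, f, Y) (X', g, Y'). (tens X X', f \<otimes>\<^bsub>C\<^esub> g, tens Y Y')),
     uobj = one,
     braid = (\<lambda>X Y. (tens X Y, br X Y, tens Y X)) \<rparr>"

locale concrete_braided = strict_braided_category C
  for C :: "('o, 'a, 'x) braided_cat_scheme" (structure) +
  fixes P :: "'p set" and U :: "'p \<Rightarrow> 'o" and mor :: "'p \<Rightarrow> 'p \<Rightarrow> 'a \<Rightarrow> bool" and tens :: "'p \<Rightarrow> 'p \<Rightarrow> 'p"
    and one :: 'p and br :: "'p \<Rightarrow> 'p \<Rightarrow> 'a"
  assumes U_obj: "X \<in> P \<Longrightarrow> U X \<in> Obj C"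
    and mor_hom: "X \<in> P \<Longrightarrow> Y \<in> P \<Longrightarrow> mor X Y f \<Longrightarrow> f \<in> Hom (U X) (U Y)"
    and mor_id: "X \<in> P \<Longrightarrow> mor X X \<langle>U X\<rangle>"
    and mor_cmp: "X \<in> P \<Longrightarrow> Y \<in> P \<Longrightarrow> Z \<in> P \<Longrightarrow> mor X Y f \<Longrightarrow> mor Y Z g \<Longrightarrow> mor X Z (g \<cdot> f)"
    and tens_P: "X \<in> P \<Longrightarrow> Y \<in> P \<Longrightarrow> tens X Y \<in> P"
    and U_tens: "X \<in> P \<Longrightarrow> Y \<in> P \<Longrightarrow> U (tens X Y) = U X \<boxtimes> U Y"
    and mor_tens: "X \<in> P \<Longrightarrow> Y \<in> P \<Longrightarrow> X' \<in> P \<Longrightarrow> Y' \<in> P \<Longrightarrow> mor X Y f \<Longrightarrow> mor X' Y' g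
        \<Longrightarrow> mor (tens X X') (tens Y Y') (f \<otimes> g)"
    and one_P: "one \<in> P" and U_one: "U one = \<I>"
    and tens_assoc: "X \<in> P \<Longrightarrow> Y \<in> P \<Longrightarrow> Z \<in> P \<Longrightarrow> tens (tens X Y) Z = tens X (tens Y Z)"
    and tens_one: "X \<in> P \<Longrightarrow> tens one X = X" "X \<in> P \<Longrightarrow> tens X one = X"
    and br_mor: "X \<in> P \<Longrightarrow> Y \<in> P \<Longrightarrow> mor (tens X Y) (tens Y X) (br X Y)"
    and br_inv: "X \<in> P \<Longrightarrow> Y \<in> P \<Longrightarrow> \<exists>g. mor (tens Y X) (tens X Y) g \<and> g \<cdot> br X Y = \<langle>U X \<boxtimes> U Y\<rangle> \<and> br X Y \<cdot> g = \<langle>U Y \<boxtimes> U X\<rangle>"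
    and br_natural: "X \<in> P \<Longrightarrow> Y \<in> P \<Longrightarrow> X' \<in> P \<Longrightarrow> Y' \<in> P \<Longrightarrow> mor X Y f \<Longrightarrow> mor X' Y' g
        \<Longrightarrow> br Y Y' \<cdot> (f \<otimes> g) = (g \<otimes> f) \<cdot> br X X'"
    and br_hexagon_right: "X \<in> P \<Longrightarrow> Y \<in> P \<Longrightarrow> Z \<in> P \<Longrightarrow> br X (tens Y Z) = (\<langle>U Y\<rangle> \<otimes> br X Z) \<cdot> (br X Y \<otimes> \<langle>U Z\<rangle>)"
    and br_hexagon_left: "X \<in> P \<Longrightarrow> Y \<in> P \<Longrightarrow> Z \<in> P \<Longrightarrow> br (tens X Y) Z = (br X Z \<otimes> \<langle>U Y\<rangle>) \<cdot> (\<langle>U X\<rangle> \<otimes> br Y Z)"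
begin

abbreviation K :: "('p, 'p \<times> 'a \<times> 'p) braided_cat" where
  "K \<equiv> concrete_cat C P U mor tens one br"

lemma Hom_concrete: "a \<in> Hom\<^bsub>K\<^esub> X Y \<longleftrightarrow> (\<exists>f. a = (X, f, Y) \<and> X \<in> P \<and> Y \<in> P \<and> mor X Y f)"
  by (cases a) (auto simp: Hom_def concrete_cat_def)

lemma concrete_simps [simp]:
  "Obj K = P" "a \<in> Arr K \<longleftrightarrow> (\<exists>X f Y. a = (X, f, Y) \<and> X \<in> P \<and> Y \<in> P \<and> mor X Y f)"
  "src K (X, f, Y) = X" "tgt K (X, f, Y) = Y" "ident K X = (X, \<langle>U X\<rangle>, X)"
  "cmp K (Y', g, Z) (X, f, Y) = (X, g \<cdot> f, Z)" "tobj K = tens"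
  "tarr K (X, f, Y) (X', g, Y') = (tens X X', f \<otimes> g, tens Y Y')" "uobj K = one"
  "braid K X Y = (tens X Y, br X Y, tens Y X)"
  by (auto simp: concrete_cat_def)

lemma concrete_braid_iso:
  assumes "X \<in> P" "Y \<in> P"
  shows "is_iso K (\<Phi>\<^bsub>K\<^esub> X Y)"
proof -
  obtain g where "mor (tens Y X) (tens X Y) g" "g \<cdot> br X Y = \<langle>U X \<boxtimes> U Y\<rangle>" "br X Y \<cdot> g = \<langle>U Y \<boxtimes> U X\<rangle>"
    using br_inv[OF assms] by blast
  then have "inverses K (\<Phi>\<^bsub>K\<^esub> X Y) (tens Y X, g, tens X Y)"
    using assms by (simp add: inverses_def Hom_concrete tens_P br_mor U_tens)
  then show ?thesis by (auto simp: is_iso_def)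
qed

lemma concrete_tarr_assoc:
  assumes "f \<in> Arr K" "g \<in> Arr K" "h \<in> Arr K"
  shows "(f \<otimes>\<^bsub>K\<^esub> g) \<otimes>\<^bsub>K\<^esub> h = f \<otimes>\<^bsub>K\<^esub> g \<otimes>\<^bsub>K\<^esub> h"
  using assms tarr_assoc hom_arr[OF mor_hom] by (fastforce simp: tens_assoc)

lemma concrete_braided_category: "strict_braided_category K"
  by (unfold_locales; (rule concrete_tarr_assoc; assumption)?; (rule concrete_braid_iso; simp)?;
      auto simp: Hom_concrete mor_id one_P tens_P U_tens U_obj U_one tarr_ident tens_assoc tens_one tarr_unit_left tarr_unit_right
        hom_arr[OF mor_hom] br_mor br_natural br_hexagon_right br_hexagon_left
      intro: mor_cmp mor_tens cmp_ident_left[OF mor_hom] cmp_ident_right[OF mor_hom] cmp_assoc[OF mor_hom mor_hom mor_hom]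
        interchange[OF mor_hom mor_hom mor_hom mor_hom])

lemma isomorphic_concrete:
  fixes Q :: "'q set" and U' mor' tens' one' br' F G
  assumes F: "\<And>X. X \<in> P \<Longrightarrow> F X \<in> Q" and G: "\<And>Y. Y \<in> Q \<Longrightarrow> G Y \<in> P"
    and GF: "\<And>X. X \<in> P \<Longrightarrow> G (F X) = X" and FG: "\<And>Y. Y \<in> Q \<Longrightarrow> F (G Y) = Y"
    and U': "\<And>X. X \<in> P \<Longrightarrow> U' (F X) = U X"
    and mor': "\<And>X Y f. X \<in> P \<Longrightarrow> Y \<in> P \<Longrightarrow> mor' (F X) (F Y) f \<longleftrightarrow> mor X Y f"
    and tens': "\<And>X Y. X \<in> P \<Longrightarrow> Y \<in> P \<Longrightarrow> tens' (F X) (F Y) = F (tens X Y)"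
    and one': "one' = F one"
    and br': "\<And>X Y. X \<in> P \<Longrightarrow> Y \<in> P \<Longrightarrow> br' (F X) (F Y) = br X Y"
  shows "isomorphic_braided_categories K (concrete_cat C Q U' mor' tens' one' br')"
proof -
  \<comment> \<open>Each object of \<open>Q\<close> is written as \<open>F X\<close>. Every axiom
    for \<open>Q\<close> thereby becomes the one for \<open>P\<close>, because \<open>F\<close>
    changes neither the underlying objects nor the underlying morphisms.\<close>
  have ex: "\<exists>X\<in>P. Y = F X" if "Y \<in> Q" for Y
    using G[OF that] FG[OF that] by metis
  interpret Q: concrete_braided C Q U' mor' tens' one' br'
    by (unfold_locales; auto dest!: ex simp: F U' U_obj mor' mor_hom mor_id tens' tens_P U_tens mor_tens one' one_P U_one
        tens_assoc tens_one br' br_mor br_inv br_natural br_hexagon_right br_hexagon_left intro: mor_cmp)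
  let ?f = "\<lambda>(X, f, Y). (F X, f, F Y)" and ?g = "\<lambda>(X, f, Y). (G X, f, G Y)"
  have "braided_functor K Q.K F ?f"
    by unfold_locales (auto simp: Hom_concrete Q.Hom_concrete F mor' U' one'[symmetric] tens' br' one_P tens_P)
  moreover have G1: "G one' = one"
    using GF[OF one_P] by (simp add: one')
  have "braided_functor Q.K K G ?g"
    by unfold_locales (auto dest!: ex simp: G1 Hom_concrete Q.Hom_concrete GF F mor' U' one'[symmetric] tens' br' one_P tens_P)
  ultimately show ?thesis
    unfolding isomorphic_braided_categories_def
    using concrete_braided_category Q.concrete_braided_category
    by (intro conjI exI[of _ F] exI[of _ ?f] exI[of _ G] exI[of _ ?g]) (auto simp: GF FG)
qed

end

section \<open>Interpretation of the diagrams for the given Hopf algebra\<close>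

locale double_setting = strict_braided_category C + hopf_algebra C H
  for C :: "('o, 'a) braided_cat" (structure) and H :: "('o, 'a) hopf_data" +
  fixes Hd HH :: 'o and ev evH :: 'a
  assumes fin: "finite_object C (ob H) Hd ev HH evH"
    and bij: "is_iso C \<S>\<^bsub>H\<^esub>"
    and yd_sym: "yd_module C H (M, \<mu>, \<rho>) \<Longrightarrow> \<Phi> (ob H) M = inv (\<Phi> M (ob H))"
begin

abbreviation "YD \<equiv> yd_module C H"
abbreviation "ten \<equiv> yd_tensor C H"
abbreviation "br \<equiv> yd_braiding C"
abbreviation "B \<equiv> dual_op C H Hd ev"
abbreviation "DH \<equiv> drinfeld_double C H Hd ev"
abbreviation "DM \<equiv> double_module C H Hd ev"
abbreviation "la \<equiv> double_left_action C H Hd ev"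
abbreviation "ra \<equiv> double_right_action C H Hd ev"
abbreviation "evb \<equiv> ev_bar C H Hd ev"
abbreviation "resH \<equiv> restrict_to_H C H Hd ev"
abbreviation "resB \<equiv> restrict_to_dual C H Hd"

lemmas inv_antipode = arr_inv[OF bij antipode_hom]

lemma hopf_diagramsI:
  assumes "\<And>t. os t \<in> Obj C" "os 0 = ob H"
    and "vs 0 = \<nabla>\<^bsub>H\<^esub>" "vs 1 = \<eta>\<^bsub>H\<^esub>" "vs 2 = \<Delta>\<^bsub>H\<^esub>" "vs 3 = \<epsilon>\<^bsub>H\<^esub>" "vs 4 = \<S>\<^bsub>H\<^esub>" "vs 5 = inv \<S>\<^bsub>H\<^esub>"
  shows "hopf_diagrams C os vs"
proof -
  interpret diagrams C os vs
    by unfold_locales (rule assms)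
  note [simp] = assms(2-) assms(4)[simplified] ob_obj tobj_unit_right
  show ?thesis
  proof
    show "sig_ok hopf_gens"
      using mult_hom unit_hom comult_hom counit_hom antipode_hom inv_antipode(1)
      by (simp add: sig_ok_def hopf_gens_def gok_def)
  qed (simp_all add: holds_def r_assoc_def r_unitL_def r_unitR_def r_coassoc_def r_counitL_def r_counitR_def
      r_bialg_def r_comuni_def r_coumul_def r_couuni_def r_antL_def r_antR_def r_ST_def r_TS_def
      mult_assoc mult_unit_left mult_unit_right comult_coassoc comult_counit_left comult_counit_right
      comult_mult comult_unit counit_mult counit_unit antipode_left antipode_right inv_antipode)
qed

lemma free_yd_module:
  assumes N: "N \<in> Obj C"
  shows "\<exists>\<mu> \<rho>. YD (ob H \<boxtimes> N, \<mu>, \<rho>)"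
proof -
  define os where "os = (\<lambda>_::nat. N)(0 := ob H)"
  \<comment> \<open>The default value of this chain of updates is the product, which thereby serves
    as generator 0.\<close>
  define vs where "vs = (\<lambda>_::nat. \<nabla>\<^bsub>H\<^esub>)(1 := \<eta>\<^bsub>H\<^esub>, 2 := \<Delta>\<^bsub>H\<^esub>, 3 := \<epsilon>\<^bsub>H\<^esub>, 4 := \<S>\<^bsub>H\<^esub>, 5 := inv \<S>\<^bsub>H\<^esub>)"
  interpret D: hopf_diagrams C os vs
    by (rule hopf_diagramsI) (simp_all add: os_def vs_def N ob_obj)
  have v [simp]: "vs 0 = \<nabla>\<^bsub>H\<^esub>" "vs 1 = \<eta>\<^bsub>H\<^esub>" "vs (Suc 0) = \<eta>\<^bsub>H\<^esub>" "vs 2 = \<Delta>\<^bsub>H\<^esub>" "vs 3 = \<epsilon>\<^bsub>H\<^esub>" "os 0 = ob H" "os 1 = N" "os (Suc 0) = N" "vs 4 = \<S>\<^bsub>H\<^esub>" "vs 5 = inv \<S>\<^bsub>H\<^esub>"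
    by (simp_all add: vs_def os_def)
  note [simp] = N ob_obj tobj_unit_right tobj_obj
  let ?\<mu> = "D.sem (mul \<oslash> Idw [1])" and ?\<rho> = "D.sem freeC"
  have wf: "wf_expr hopf_gens (mul \<oslash> Idw [1])" "wf_expr hopf_gens freeC"
    by code_simp+
  have h: "?\<mu> \<in> Hom (ob H \<boxtimes> (ob H \<boxtimes> N)) (ob H \<boxtimes> N)" "?\<rho> \<in> Hom (ob H \<boxtimes> N) ((ob H \<boxtimes> N) \<boxtimes> ob H)"
    using D.sem_hom[OF D.sig_hopf wf(1)] D.sem_hom[OF D.sig_hopf wf(2)] by (simp_all add: tobj_assoc)
  have "left_module C H (ob H \<boxtimes> N) ?\<mu>"
    using D.free_modass D.free_modun h(1)
    by (simp add: left_module_def D.holds_def r_free_modass_def r_free_modun_def)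
  moreover have "right_comodule C H (ob H \<boxtimes> N) ?\<rho>"
    using D.rho_coassoc D.rho_counit h(2)
    by (simp add: right_comodule_def D.holds_def r_rho_coassoc_def r_rho_counit_def)
  ultimately have "YD (ob H \<boxtimes> N, ?\<mu>, ?\<rho>)"
    using D.rho_yd by (simp add: yd_module_def D.holds_def r_rho_yd_def)
  then show ?thesis by blast
qed

text \<open>
  The hypothesis only concerns objects that carry a Yetter-Drinfel'd structure; \<open>N\<close> is a retract of
  the free such object \<open>H \<otimes> N\<close>.
\<close>

lemma braid_sym:
  assumes N: "N \<in> Obj C"
  shows "\<Phi> N (ob H) \<cdot> \<Phi> (ob H) N = \<langle>ob H \<boxtimes> N\<rangle>" "\<Phi> (ob H) N \<cdot> \<Phi> N (ob H) = \<langle>N \<boxtimes> ob H\<rangle>"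
proof -
  let ?K = "ob H \<boxtimes> N"
  note [simp] = N ob_obj tobj_obj
  \<comment> \<open>Unit and counit of H provide the retraction, since the counit after the unit is
    the identity of \<I>.\<close>
  have i: "\<eta>\<^bsub>H\<^esub> \<otimes> \<langle>N\<rangle> \<in> Hom N ?K" and r: "\<epsilon>\<^bsub>H\<^esub> \<otimes> \<langle>N\<rangle> \<in> Hom ?K N"
    using tarr_hom[OF unit_hom ident_hom[OF N]] tarr_hom[OF counit_hom ident_hom[OF N]] by (simp_all add: tobj_unit_left)
  have ri: "(\<epsilon>\<^bsub>H\<^esub> \<otimes> \<langle>N\<rangle>) \<cdot> (\<eta>\<^bsub>H\<^esub> \<otimes> \<langle>N\<rangle>) = \<langle>N\<rangle>"
    using interchange[OF unit_hom counit_hom ident_hom[OF N] ident_hom[OF N]] cmp_ident_left[OF ident_hom[OF N]]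
    by (simp add: counit_unit tarr_unit_left hom_arr[OF ident_hom])
  define i where "i = \<eta>\<^bsub>H\<^esub> \<otimes> \<langle>N\<rangle>"
  define r where "r = \<epsilon>\<^bsub>H\<^esub> \<otimes> \<langle>N\<rangle>"
  note ir = i[folded i_def] r[folded r_def] ri[folded i_def r_def]
  note A = ident_hom[OF ob_obj]
  note iA = tarr_hom[OF A ir(1)] and rA = tarr_hom[OF ir(2) A] and rA' = tarr_hom[OF A ir(2)]
  have sK: "\<Phi> ?K (ob H) \<cdot> \<Phi> (ob H) ?K = \<langle>ob H \<boxtimes> ?K\<rangle>"
    using free_yd_module[OF N] yd_sym braid_inv[of ?K "ob H"] by auto
  have b: "\<Phi> (ob H) N \<in> Hom (ob H \<boxtimes> N) (N \<boxtimes> ob H)" "\<Phi> N (ob H) \<in> Hom (N \<boxtimes> ob H) (ob H \<boxtimes> N)"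
    "\<Phi> (ob H) ?K \<in> Hom (ob H \<boxtimes> ?K) (?K \<boxtimes> ob H)" "\<Phi> ?K (ob H) \<in> Hom (?K \<boxtimes> ob H) (ob H \<boxtimes> ?K)"
    by (simp_all add: braid_hom)
  have e: "(\<langle>ob H\<rangle> \<otimes> r) \<cdot> (\<langle>ob H\<rangle> \<otimes> i) = \<langle>ob H \<boxtimes> N\<rangle>"
    using interchange[OF A A ir(1,2)] ir(3) cmp_ident_left[OF A] by (simp add: tarr_ident)
  \<comment> \<open>The composite of \<open>i\<close> and \<open>r\<close> is inserted and
    \<open>r\<close> is pulled through both crossings; the double crossing then takes place on
    \<open>?K\<close>, where it is trivial.\<close>
  have "\<Phi> N (ob H) \<cdot> \<Phi> (ob H) N = \<Phi> N (ob H) \<cdot> (\<Phi> (ob H) N \<cdot> ((\<langle>ob H\<rangle> \<otimes> r) \<cdot> (\<langle>ob H\<rangle> \<otimes> i)))"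
    using cmp_ident_right[OF b(1)] e by simp
  also have "\<dots> = \<Phi> N (ob H) \<cdot> ((r \<otimes> \<langle>ob H\<rangle>) \<cdot> (\<Phi> (ob H) ?K \<cdot> (\<langle>ob H\<rangle> \<otimes> i)))"
    using cmp_assoc[OF iA rA' b(1)] braid_natural[OF A ir(2)] cmp_assoc[OF iA b(3) rA] by simp
  also have "\<dots> = (\<langle>ob H\<rangle> \<otimes> r) \<cdot> (\<Phi> ?K (ob H) \<cdot> (\<Phi> (ob H) ?K \<cdot> (\<langle>ob H\<rangle> \<otimes> i)))"
    using cmp_assoc[OF cmp_hom[OF iA b(3)] rA b(2)] braid_natural[OF ir(2) A] cmp_assoc[OF cmp_hom[OF iA b(3)] b(4) rA'] by simp
  also have "\<dots> = \<langle>ob H \<boxtimes> N\<rangle>"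
    using cmp_assoc[OF iA b(3,4)] sK cmp_ident_left[OF iA] e by simp
  finally show 1: "\<Phi> N (ob H) \<cdot> \<Phi> (ob H) N = \<langle>ob H \<boxtimes> N\<rangle>" .
  note j = braid_inv[OF ob_obj N]
  \<comment> \<open>A left inverse of an isomorphism is its inverse, which gives the other
    composite.\<close>
  have "\<Phi> N (ob H) = inv (\<Phi> (ob H) N)"
    using cmp_assoc[OF j(1) b(1,2)] 1 j(3) cmp_ident_right[OF b(2)] cmp_ident_left[OF j(1)] by simp
  then show "\<Phi> (ob H) N \<cdot> \<Phi> N (ob H) = \<langle>N \<boxtimes> ob H\<rangle>"
    using j by simp
qed

subsection \<open>The dual object\<close>

abbreviation coev :: 'a where
  "coev \<equiv> dual_basis C (ob H) Hd ev HH evH"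

lemma Hd_obj: "Hd \<in> Obj C"
  and ev_hom: "ev \<in> Hom (Hd \<boxtimes> ob H) \<I>"
  and ev_ex1: "X \<in> Obj C \<Longrightarrow> f \<in> Hom (X \<boxtimes> ob H) \<I> \<Longrightarrow> \<exists>!g. g \<in> Hom X Hd \<and> ev \<cdot> (g \<otimes> \<langle>ob H\<rangle>) = f"
  using fin by (auto simp: finite_object_def inner_hom_def)

lemmas objs = ob_obj Hd_obj tobj_obj unit_obj tobj_unit_right tobj_unit_left

lemma ev_eqI:
  assumes "f \<in> Hom X Hd" "g \<in> Hom X Hd" "ev \<cdot> (f \<otimes> \<langle>ob H\<rangle>) = ev \<cdot> (g \<otimes> \<langle>ob H\<rangle>)"
  shows "f = g"
proof -
  have "ev \<cdot> (f \<otimes> \<langle>ob H\<rangle>) \<in> Hom (X \<boxtimes> ob H) \<I>"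
    using cmp_hom[OF tarr_hom[OF assms(1) ident_hom[OF ob_obj]] ev_hom] .
  from ev_ex1[OF hom_obj(1)[OF assms(1)] this] show ?thesis
    using assms by metis
qed

text \<open>\<open>coev\<close> is the preimage of \<open>u\<close> under \<open>p\<close>. The
  evaluation \<open>evH\<close> turns \<open>p\<close> into
  \<open>\<langle>ob H\<rangle> \<otimes> ev\<close> and \<open>u\<close> into the identity, so
  evaluating \<open>p \<cdot> coev = u\<close> gives the snake identity.\<close>

lemma coev_hom: "coev \<in> Hom \<I> (ob H \<boxtimes> Hd)"
    and coev_snake: "(\<langle>ob H\<rangle> \<otimes> ev) \<cdot> (coev \<otimes> \<langle>ob H\<rangle>) = \<langle>ob H\<rangle>"
proof -
  have h: "evH \<in> Hom (HH \<boxtimes> ob H) (ob H)" "HH \<in> Obj C"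
    and iso: "is_iso C (dual_basis_morphism C (ob H) Hd ev HH evH)"
    and ex: "X \<in> Obj C \<Longrightarrow> f \<in> Hom (X \<boxtimes> ob H) (ob H) \<Longrightarrow> \<exists>!g. g \<in> Hom X HH \<and> evH \<cdot> (g \<otimes> \<langle>ob H\<rangle>) = f" for X f
    using fin by (auto simp: finite_object_def inner_hom_def)
  note [simp] = ob_obj Hd_obj tobj_obj unit_obj
  note A = ident_hom[OF ob_obj]
  define p where "p = dual_basis_morphism C (ob H) Hd ev HH evH"
  have "\<langle>ob H\<rangle> \<otimes> ev \<in> Hom ((ob H \<boxtimes> Hd) \<boxtimes> ob H) (ob H)"
    using tarr_hom[OF A ev_hom] by (simp add: tobj_assoc tobj_unit_right)
  from theI'[OF ex[OF _ this]] have p: "p \<in> Hom (ob H \<boxtimes> Hd) HH" "evH \<cdot> (p \<otimes> \<langle>ob H\<rangle>) = \<langle>ob H\<rangle> \<otimes> ev"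
    by (simp_all add: p_def dual_basis_morphism_def)
  define u where "u = (THE u. u \<in> Hom \<I> HH \<and> evH \<cdot> (u \<otimes> \<langle>ob H\<rangle>) = \<langle>ob H\<rangle>)"
  have "\<langle>ob H\<rangle> \<in> Hom (\<I> \<boxtimes> ob H) (ob H)"
    using A by (simp add: tobj_unit_left)
  from theI'[OF ex[OF _ this]] have u: "u \<in> Hom \<I> HH" "evH \<cdot> (u \<otimes> \<langle>ob H\<rangle>) = \<langle>ob H\<rangle>"
    by (simp_all add: u_def)
  note i = arr_inv[OF iso[folded p_def] p(1)]
  have c: "coev = inv p \<cdot> u"
    by (simp add: dual_basis_def p_def u_def)
  show ch: "coev \<in> Hom \<I> (ob H \<boxtimes> Hd)"
    using cmp_hom[OF u(1) i(1)] c by simp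
  have pc: "p \<cdot> coev = u"
    using cmp_assoc[OF u(1) i(1) p(1)] i(3) cmp_ident_left[OF u(1)] c by simp
  have "(\<langle>ob H\<rangle> \<otimes> ev) \<cdot> (coev \<otimes> \<langle>ob H\<rangle>) = evH \<cdot> ((p \<otimes> \<langle>ob H\<rangle>) \<cdot> (coev \<otimes> \<langle>ob H\<rangle>))"
    using cmp_assoc[OF tarr_hom[OF ch A] tarr_hom[OF p(1) A] h(1)] p(2) by simp
  also have "\<dots> = evH \<cdot> (u \<otimes> \<langle>ob H\<rangle>)"
    using interchange[OF ch p(1) A A] pc cmp_ident_left[OF A] by simp
  finally show "(\<langle>ob H\<rangle> \<otimes> ev) \<cdot> (coev \<otimes> \<langle>ob H\<rangle>) = \<langle>ob H\<rangle>"
    using u by simp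
qed

text \<open>The fixed part of the interpretations: modules and morphisms are added by updates at
  types from 2 and numbers from 14 on. Unassigned types denote the unit object, since each type must
  denote some object; in \<open>baseV\<close> the default is the product, hence generator 0.\<close>

definition baseO :: "nat \<Rightarrow> 'o" where
  "baseO = (\<lambda>_. \<I>)(0 := ob H, 1 := Hd)"

definition baseV :: "nat \<Rightarrow> 'a" where
  "baseV = (\<lambda>_. \<nabla>\<^bsub>H\<^esub>)(1 := \<eta>\<^bsub>H\<^esub>, 2 := \<Delta>\<^bsub>H\<^esub>, 3 := \<epsilon>\<^bsub>H\<^esub>, 4 := \<S>\<^bsub>H\<^esub>, 5 := inv \<S>\<^bsub>H\<^esub>, 6 := ev, 7 := coev,
     8 := \<nabla>\<^bsub>B\<^esub>, 9 := \<eta>\<^bsub>B\<^esub>, 10 := \<Delta>\<^bsub>B\<^esub>, 11 := \<epsilon>\<^bsub>B\<^esub>,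
     12 := la, 13 := ra)"

lemma baseO_simps [simp]: "baseO 0 = ob H" "baseO (Suc 0) = Hd" "baseO t \<in> Obj C"
  by (simp_all add: baseO_def ob_obj Hd_obj unit_obj)

lemma baseV_simps [simp]:
  "baseV 0 = \<nabla>\<^bsub>H\<^esub>" "baseV (Suc 0) = \<eta>\<^bsub>H\<^esub>" "baseV 2 = \<Delta>\<^bsub>H\<^esub>" "baseV 3 = \<epsilon>\<^bsub>H\<^esub>" "baseV 4 = \<S>\<^bsub>H\<^esub>" "baseV 5 = inv \<S>\<^bsub>H\<^esub>"
  "baseV 6 = ev" "baseV 7 = coev" "baseV 8 = \<nabla>\<^bsub>B\<^esub>" "baseV 9 = \<eta>\<^bsub>B\<^esub>"
  "baseV 10 = \<Delta>\<^bsub>B\<^esub>" "baseV 11 = \<epsilon>\<^bsub>B\<^esub>"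
  "baseV 12 = la" "baseV 13 = ra"
  by (simp_all add: baseV_def)

abbreviation "mods M N P \<equiv> baseO(2 := M, 3 := N, 4 := P)"
abbreviation "acts \<mu> \<rho> \<nu> \<sigma> \<pi> \<tau> \<equiv>
  baseV(14 := \<mu>, 15 := \<rho>, 16 := \<nu>, 17 := \<sigma>, 18 := \<pi>, 19 := \<tau>)"

lemma coev_snake2: "(ev \<otimes> \<langle>Hd\<rangle>) \<cdot> (\<langle>Hd\<rangle> \<otimes> coev) = \<langle>Hd\<rangle>"
proof -
  interpret D: diagrams C baseO baseV
    by unfold_locales simp
  note [simp] = objs
  interpret D: coev_diagrams C baseO baseV
    by unfold_locales (use ev_hom coev_hom coev_snake in
      \<open>simp_all add: D.sig_ok_def snake_gens_def D.gok_def D.holds_def r_snake1_def\<close>)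
  note B = ident_hom[OF Hd_obj]
  have h: "(ev \<otimes> \<langle>Hd\<rangle>) \<cdot> (\<langle>Hd\<rangle> \<otimes> coev) \<in> Hom Hd Hd"
    using cmp_hom[OF tarr_hom[OF B coev_hom, unfolded tobj_assoc[OF Hd_obj ob_obj Hd_obj, symmetric]] tarr_hom[OF ev_hom B]] by simp
  have "ev \<cdot> (((ev \<otimes> \<langle>Hd\<rangle>) \<cdot> (\<langle>Hd\<rangle> \<otimes> coev)) \<otimes> \<langle>ob H\<rangle>) = ev"
    using D.snake_ev by (simp add: D.holds_def r_snake_ev_def)
  then show ?thesis
    using ev_eqI[OF h B] cmp_ident_right[OF ev_hom] by (simp add: tarr_ident)
qed

lemma braid_sym_dual:
  assumes N: "N \<in> Obj C"
  shows "\<Phi> Hd N \<cdot> \<Phi> N Hd = \<langle>N \<boxtimes> Hd\<rangle>" "\<Phi> N Hd \<cdot> \<Phi> Hd N = \<langle>Hd \<boxtimes> N\<rangle>"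
proof -
  note [simp] = N objs
  interpret D: diagrams C "baseO(2 := N)" baseV
    by unfold_locales (simp add: N)
  interpret D: snake_diagrams C "baseO(2 := N)" baseV
    by unfold_locales (use ev_hom coev_hom coev_snake coev_snake2 braid_sym(2)[OF N] in
      \<open>simp_all add: D.sig_ok_def snake_gens_def D.gok_def D.holds_def r_snake1_def r_snake2_def r_sym_def\<close>)
  show 1: "\<Phi> Hd N \<cdot> \<Phi> N Hd = \<langle>N \<boxtimes> Hd\<rangle>"
    using D.monodromy by (simp add: D.holds_def r_monodromy_def)
  note j = braid_inv[OF N Hd_obj] and b = braid_hom[OF N Hd_obj] braid_hom[OF Hd_obj N]
  have "\<Phi> Hd N = inv (\<Phi> N Hd)"
    using cmp_assoc[OF j(1) b] 1 j(3) cmp_ident_right[OF b(2)] cmp_ident_left[OF j(1)] by simp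
  then show "\<Phi> N Hd \<cdot> \<Phi> Hd N = \<langle>Hd \<boxtimes> N\<rangle>"
    using j by simp
qed

lemma light_diagramsI:
  assumes "\<And>t. os t \<in> Obj C" "\<And>t. t < 2 \<Longrightarrow> os t = baseO t" "\<And>n. n < 8 \<Longrightarrow> vs n = baseV n"
  shows "light_diagrams C os vs"
proof -
  interpret D: hopf_diagrams C os vs
    by (rule hopf_diagramsI) (simp_all add: assms)
  show ?thesis
  proof
    fix a b :: nat
    have o: "os a = ob H \<or> os a = Hd \<or> os b = ob H \<or> os b = Hd" if "a < 2 \<or> b < 2"
      using that assms(2)[of a] assms(2)[of b] by (auto simp: less_2_cases_iff)
    show "a < 2 \<or> b < 2 \<Longrightarrow> D.holds (r_sym a b)"
      using o braid_sym[of "os a"] braid_sym[of "os b"] braid_sym_dual[of "os a"] braid_sym_dual[of "os b"] assms(1)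
      by (auto simp: D.holds_def r_sym_def tobj_unit_right)
  qed
qed

lemma pair_diagramsI:
  assumes "\<And>t. os t \<in> Obj C" "\<And>t. t < 2 \<Longrightarrow> os t = baseO t" "\<And>n. n < 8 \<Longrightarrow> vs n = baseV n"
  shows "pair_diagrams C os vs"
proof -
  interpret D: light_diagrams C os vs
    by (rule light_diagramsI) (simp_all add: assms)
  show ?thesis
    by unfold_locales (use ev_hom coev_hom coev_snake coev_snake2 in
      \<open>simp_all add: D.sig_ok_def snake_gens_def D.gok_def D.holds_def r_snake1_def r_snake2_def assms tobj_unit_right ob_obj Hd_obj tobj_obj\<close>)
qed

lemma dual_wf:
  "wf_expr (hopf_gens @ snake_gens) pair_mulE" "wf_expr (hopf_gens @ snake_gens) cou"
  "wf_expr (hopf_gens @ snake_gens) pair_comE" "wf_expr (hopf_gens @ snake_gens) pair_lactE"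
  "wf_expr (hopf_gens @ snake_gens) ract_defE" "wf_expr (hopf_gens @ snake_gens) (evl \<odot> Idw [1] \<oslash> uni)"
  by code_simp+

text \<open>The first three are the right-hand sides of the characterisations by pairing; their
  types must be known before the corresponding \<open>THE\<close> terms can be shown to denote
  anything.\<close>

lemma dual_homs:
  "(ev \<otimes> ev) \<cdot> (\<langle>Hd\<rangle> \<otimes> \<Phi> Hd (ob H) \<otimes> \<langle>ob H\<rangle>) \<cdot> (\<langle>Hd\<rangle> \<otimes> \<langle>Hd\<rangle> \<otimes> \<Delta>\<^bsub>H\<^esub>) \<in> Hom ((Hd \<boxtimes> Hd) \<boxtimes> ob H) \<I>"
  "ev \<cdot> (\<langle>Hd\<rangle> \<otimes> (\<nabla>\<^bsub>H\<^esub> \<cdot> \<Phi> (ob H) (ob H))) \<in> Hom (Hd \<boxtimes> ob H \<boxtimes> ob H) \<I>"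
  "evb \<cdot> ((\<nabla>\<^bsub>H\<^esub> \<cdot> \<Phi> (ob H) (ob H) \<cdot> (\<nabla>\<^bsub>H\<^esub> \<otimes> inv \<S>\<^bsub>H\<^esub>) \<cdot> (\<langle>ob H\<rangle> \<otimes> \<Delta>\<^bsub>H\<^esub>)) \<otimes> \<langle>Hd\<rangle>) \<in> Hom (ob H \<boxtimes> ob H \<boxtimes> Hd) \<I>"
  "ra \<in> Hom (ob H \<boxtimes> Hd) (ob H)"
  "ev \<cdot> (\<langle>Hd\<rangle> \<otimes> \<eta>\<^bsub>H\<^esub>) \<in> Hom Hd \<I>"
proof -
  interpret D: pair_diagrams C baseO baseV
    by (rule pair_diagramsI) simp_all
  have "D.sig_ok (hopf_gens @ snake_gens)"
    using D.sig_hopf D.sig_pair by (auto simp: D.sig_ok_def)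
  note h = D.sem_hom[OF this]
  note [simp] = objs tobj_assoc
  show "(ev \<otimes> ev) \<cdot> (\<langle>Hd\<rangle> \<otimes> \<Phi> Hd (ob H) \<otimes> \<langle>ob H\<rangle>) \<cdot> (\<langle>Hd\<rangle> \<otimes> \<langle>Hd\<rangle> \<otimes> \<Delta>\<^bsub>H\<^esub>) \<in> Hom ((Hd \<boxtimes> Hd) \<boxtimes> ob H) \<I>"
    using h[OF dual_wf(1)] by simp
  show "ev \<cdot> (\<langle>Hd\<rangle> \<otimes> (\<nabla>\<^bsub>H\<^esub> \<cdot> \<Phi> (ob H) (ob H))) \<in> Hom (Hd \<boxtimes> ob H \<boxtimes> ob H) \<I>"
    using h[OF dual_wf(3)] by simp
  show "evb \<cdot> ((\<nabla>\<^bsub>H\<^esub> \<cdot> \<Phi> (ob H) (ob H) \<cdot> (\<nabla>\<^bsub>H\<^esub> \<otimes> inv \<S>\<^bsub>H\<^esub>) \<cdot> (\<langle>ob H\<rangle> \<otimes> \<Delta>\<^bsub>H\<^esub>)) \<otimes> \<langle>Hd\<rangle>) \<in> Hom (ob H \<boxtimes> ob H \<boxtimes> Hd) \<I>"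
    using h[OF dual_wf(4)] by (simp add: ev_bar_def)
  show "ra \<in> Hom (ob H \<boxtimes> Hd) (ob H)"
    using h[OF dual_wf(5)] by (simp add: ev_bar_def double_right_action_def)
  show "ev \<cdot> (\<langle>Hd\<rangle> \<otimes> \<eta>\<^bsub>H\<^esub>) \<in> Hom Hd \<I>"
    using h[OF dual_wf(6)] by simp
qed

text \<open>The universal property of the inner hom handles one argument in H, and here there are
  two. The witness \<open>?q\<close> transposes \<open>p\<close> along two copies of
  \<open>coev\<close>, interleaved by a crossing.\<close>

lemma dual_comult_ex1:
  assumes p: "p \<in> Hom (Hd \<boxtimes> ob H \<boxtimes> ob H) \<I>"
  shows "\<exists>!c. c \<in> Hom Hd (Hd \<boxtimes> Hd) \<and>
    (ev \<otimes> ev) \<cdot> (\<langle>Hd\<rangle> \<otimes> \<Phi> Hd (ob H) \<otimes> \<langle>ob H\<rangle>) \<cdot> (c \<otimes> \<langle>ob H\<rangle> \<otimes> \<langle>ob H\<rangle>) = p"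
proof -
  note [simp] = objs tobj_assoc
  let ?q = "(p \<otimes> \<langle>Hd\<rangle> \<otimes> \<langle>Hd\<rangle>) \<cdot> (\<langle>Hd\<rangle> \<otimes> ((\<langle>ob H\<rangle> \<otimes> \<Phi> Hd (ob H) \<otimes> \<langle>Hd\<rangle>) \<cdot> (coev \<otimes> coev)))"
  interpret D: pair_diagrams C baseO "baseV(27 := p)"
    by (rule pair_diagramsI) simp_all
  have g: "D.gok (Gen 27 [1, 0, 0] [])"
    using p by (simp add: D.gok_def)
  then have "D.sig_ok (snake_gens @ [Gen 27 [1, 0, 0] []])"
    using D.sig_pair by (auto simp: D.sig_ok_def)
  moreover have "wf_expr (snake_gens @ [Gen 27 [1, 0, 0] []])
      (pair3 \<oslash> Idw [1] \<oslash> Idw [1] \<odot> Idw [1] \<oslash> (Idw [0] \<oslash> Atom (Over 1 0) \<oslash> Idw [1] \<odot> dbs \<oslash> dbs))"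
    by code_simp
  ultimately have "?q \<in> Hom Hd (Hd \<boxtimes> Hd)"
    using D.sem_hom by fastforce
  moreover have "(ev \<otimes> ev) \<cdot> (\<langle>Hd\<rangle> \<otimes> \<Phi> Hd (ob H) \<otimes> \<langle>ob H\<rangle>) \<cdot> (?q \<otimes> \<langle>ob H\<rangle> \<otimes> \<langle>ob H\<rangle>) = p"
    using D.pair_com[OF g] by (simp add: D.holds_def r_pair_com_def)
  moreover have "c = ?q" if "c \<in> Hom Hd (Hd \<boxtimes> Hd)"
    "(ev \<otimes> ev) \<cdot> (\<langle>Hd\<rangle> \<otimes> \<Phi> Hd (ob H) \<otimes> \<langle>ob H\<rangle>) \<cdot> (c \<otimes> \<langle>ob H\<rangle> \<otimes> \<langle>ob H\<rangle>) = p" for c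
  proof -
    interpret E: pair_diagrams C baseO "baseV(28 := c)"
      by (rule pair_diagramsI) simp_all
    have "E.gok (Gen 28 [1] [1, 1])"
      using that(1) by (simp add: E.gok_def)
    from E.copair_com[OF this] show ?thesis
      using that(2) by (simp add: E.holds_def r_copair_com_def)
  qed
  ultimately show ?thesis by blast
qed

lemma double_left_action_ex1:
  assumes p: "p \<in> Hom (ob H \<boxtimes> ob H \<boxtimes> Hd) \<I>"
  shows "\<exists>!t. t \<in> Hom (ob H \<boxtimes> Hd) Hd \<and> evb \<cdot> (\<langle>ob H\<rangle> \<otimes> t) = p"
proof -
  note [simp] = objs tobj_assoc ev_bar_def
  \<comment> \<open>\<open>\<Phi> (ob H) Hd \<cdot> coev\<close> is the dual basis for the flipped
    pairing \<open>evb\<close>.\<close>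
  let ?q = "(\<langle>Hd\<rangle> \<otimes> p) \<cdot> ((\<Phi> (ob H) Hd \<cdot> coev) \<otimes> \<langle>ob H\<rangle> \<otimes> \<langle>Hd\<rangle>)"
  interpret D: pair_diagrams C baseO "baseV(30 := p)"
    by (rule pair_diagramsI) simp_all
  have g: "D.gok (Gen 30 [0, 0, 1] [])"
    using p by (simp add: D.gok_def)
  then have "D.sig_ok (snake_gens @ [Gen 30 [0, 0, 1] []])"
    using D.sig_pair by (auto simp: D.sig_ok_def)
  moreover have "wf_expr (snake_gens @ [Gen 30 [0, 0, 1] []])
      (Idw [1] \<oslash> pair3' \<odot> (Atom (Over 0 1) \<odot> dbs) \<oslash> Idw [0] \<oslash> Idw [1])"
    by code_simp
  ultimately have "?q \<in> Hom (ob H \<boxtimes> Hd) Hd"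
    using D.sem_hom by fastforce
  moreover have "evb \<cdot> (\<langle>ob H\<rangle> \<otimes> ?q) = p"
    using D.pair_lact[OF g] by (simp add: D.holds_def r_pair_lact_def)
  moreover have "t = ?q" if "t \<in> Hom (ob H \<boxtimes> Hd) Hd" "evb \<cdot> (\<langle>ob H\<rangle> \<otimes> t) = p" for t
  proof -
    interpret E: pair_diagrams C baseO "baseV(29 := t)"
      by (rule pair_diagramsI) simp_all
    have "E.gok (Gen 29 [0, 1] [1])"
      using that(1) by (simp add: E.gok_def)
    from E.copair_lact[OF this] show ?thesis
      using that(2) by (simp add: E.holds_def r_copair_lact_def)
  qed
  ultimately show ?thesis by blast
qed

lemma dual_mult:
  "\<nabla>\<^bsub>B\<^esub> \<in> Hom (Hd \<boxtimes> Hd) Hd"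
  "ev \<cdot> (\<nabla>\<^bsub>B\<^esub> \<otimes> \<langle>ob H\<rangle>)
    = (ev \<otimes> ev) \<cdot> (\<langle>Hd\<rangle> \<otimes> \<Phi> Hd (ob H) \<otimes> \<langle>ob H\<rangle>) \<cdot> (\<langle>Hd\<rangle> \<otimes> \<langle>Hd\<rangle> \<otimes> \<Delta>\<^bsub>H\<^esub>)"
  using theI'[OF ev_ex1[OF tobj_obj[OF Hd_obj Hd_obj] dual_homs(1)]] by (simp_all add: dual_op_def)

lemma dual_unit:
  "\<eta>\<^bsub>B\<^esub> \<in> Hom \<I> Hd" "ev \<cdot> (\<eta>\<^bsub>B\<^esub> \<otimes> \<langle>ob H\<rangle>) = \<epsilon>\<^bsub>H\<^esub>"
proof -
  have "\<epsilon>\<^bsub>H\<^esub> \<in> Hom (\<I> \<boxtimes> ob H) \<I>"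
    using counit_hom ob_obj by (simp add: tobj_unit_left)
  from theI'[OF ev_ex1[OF unit_obj this]]
  show "\<eta>\<^bsub>B\<^esub> \<in> Hom \<I> Hd" "ev \<cdot> (\<eta>\<^bsub>B\<^esub> \<otimes> \<langle>ob H\<rangle>) = \<epsilon>\<^bsub>H\<^esub>"
    by (simp_all add: dual_op_def)
qed

lemma dual_comult:
  "\<Delta>\<^bsub>B\<^esub> \<in> Hom Hd (Hd \<boxtimes> Hd)"
  "(ev \<otimes> ev) \<cdot> (\<langle>Hd\<rangle> \<otimes> \<Phi> Hd (ob H) \<otimes> \<langle>ob H\<rangle>) \<cdot> (\<Delta>\<^bsub>B\<^esub> \<otimes> \<langle>ob H\<rangle> \<otimes> \<langle>ob H\<rangle>)
    = ev \<cdot> (\<langle>Hd\<rangle> \<otimes> (\<nabla>\<^bsub>H\<^esub> \<cdot> \<Phi> (ob H) (ob H)))"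
  using theI'[OF dual_comult_ex1[OF dual_homs(2)]] by (simp_all add: dual_op_def)

lemma double_left_action:
  "la \<in> Hom (ob H \<boxtimes> Hd) Hd"
  "evb \<cdot> (\<langle>ob H\<rangle> \<otimes> la) = evb
    \<cdot> ((\<nabla>\<^bsub>H\<^esub> \<cdot> \<Phi> (ob H) (ob H) \<cdot> (\<nabla>\<^bsub>H\<^esub> \<otimes> inv \<S>\<^bsub>H\<^esub>) \<cdot> (\<langle>ob H\<rangle> \<otimes> \<Delta>\<^bsub>H\<^esub>)) \<otimes> \<langle>Hd\<rangle>)"
  using theI'[OF double_left_action_ex1[OF dual_homs(3)]] by (simp_all add: double_left_action_def)

lemma dual_counit: "\<epsilon>\<^bsub>B\<^esub> = ev \<cdot> (\<langle>Hd\<rangle> \<otimes> \<eta>\<^bsub>H\<^esub>)"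
  by (simp add: dual_op_def)

lemma dual_diagramsI:
  assumes "\<And>t. os t \<in> Obj C" "\<And>t. t < 2 \<Longrightarrow> os t = baseO t" "\<And>n. n < 14 \<Longrightarrow> vs n = baseV n"
  shows "dual_diagrams C os vs"
proof -
  interpret D: light_diagrams C os vs
    by (rule light_diagramsI) (simp_all add: assms)
  note [simp] = objs assms
  show ?thesis
  proof
    show "D.sig_ok dual_gens"
      using D.sig_hopf ev_hom coev_hom dual_mult(1) dual_unit(1) dual_comult(1) dual_homs(4,5) double_left_action(1)
      by (auto simp: D.sig_ok_def dual_gens_def D.gok_def dual_counit)
  qed (use coev_snake coev_snake2 dual_mult(2) dual_unit(2) dual_comult(2) double_left_action(2) in
      \<open>simp_all add: D.holds_def r_snake1_def r_snake2_def r_pmul_def r_puni_def r_pcom_def r_pcou_def r_plact_def r_pract_def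
        dual_counit ev_bar_def double_right_action_def\<close>)
qed

lemma yd_diagramsI:
  assumes "YD (M, \<mu>, \<rho>)" "YD (N, \<nu>, \<sigma>)" "YD (P, \<pi>, \<tau>)"
  shows "yd_diagrams C (mods M N P) (acts \<mu> \<rho> \<nu> \<sigma> \<pi> \<tau>)"
proof -
  note yd = assms[unfolded yd_module_def left_module_def right_comodule_def prod.case]
  note [simp] = objs
  have [simp]: "M \<in> Obj C" "N \<in> Obj C" "P \<in> Obj C"
    using yd by auto
  interpret D: light_diagrams C "mods M N P" "acts \<mu> \<rho> \<nu> \<sigma> \<pi> \<tau>"
    by (rule light_diagramsI) simp_all
  show ?thesis
  proof
    show "D.sig_ok yd_gens"
      using D.sig_hopf yd by (auto simp: D.sig_ok_def yd_gens_def D.gok_def)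
  qed (use yd in \<open>simp_all add: D.holds_def r_modass_M_def r_modass_N_def r_modass_P_def r_modun_M_def r_modun_N_def r_modun_P_def
      r_coass_M_def r_coass_N_def r_coass_P_def r_coun_M_def r_coun_N_def r_coun_P_def r_yd_M_def r_yd_N_def r_yd_P_def\<close>)
qed

subsection \<open>The braided category of Yetter-Drinfel'd modules\<close>

lemma yd_wf:
  "wf_expr yd_gens tenA" "wf_expr yd_gens tenC" "wf_expr yd_gens brd" "wf_expr yd_gens dirb"
  by code_simp+

lemma yd_homs:
  assumes "YD (M, \<mu>, \<rho>)"
  shows "M \<in> Obj C" "\<mu> \<in> Hom (ob H \<boxtimes> M) M" "\<rho> \<in> Hom M (M \<boxtimes> ob H)"
  using assms by (auto simp: yd_module_def left_module_def right_comodule_def)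

lemma yd_tensor_module:
  assumes "YD (M, \<mu>, \<rho>)" "YD (N, \<nu>, \<sigma>)"
  shows "YD (ten (M, \<mu>, \<rho>) (N, \<nu>, \<sigma>))"
proof -
  interpret D: yd_diagrams C "mods M N N" "acts \<mu> \<rho> \<nu> \<sigma> \<nu> \<sigma>"
    by (rule yd_diagramsI assms)+
  note [simp] = objs tobj_assoc yd_homs(1)[OF assms(1)] yd_homs(1)[OF assms(2)]
  have ta: "D.sem tenA = tensor_action C H (M, \<mu>) (N, \<nu>)" and tc: "D.sem tenC = tensor_coaction_op C H (M, \<rho>) (N, \<sigma>)"
    by (simp_all add: tensor_action_def tensor_coaction_op_def)
  have h: "tensor_action C H (M, \<mu>) (N, \<nu>) \<in> Hom (ob H \<boxtimes> M \<boxtimes> N) (M \<boxtimes> N)"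
    "tensor_coaction_op C H (M, \<rho>) (N, \<sigma>) \<in> Hom (M \<boxtimes> N) (M \<boxtimes> N \<boxtimes> ob H)"
    using D.sem_hom[OF D.sig_yd yd_wf(1)] D.sem_hom[OF D.sig_yd yd_wf(2)] by (simp_all add: tensor_action_def tensor_coaction_op_def)
  have "left_module C H (M \<boxtimes> N) (tensor_action C H (M, \<mu>) (N, \<nu>))"
    using D.ten_modass D.ten_modun h unfolding ta[symmetric] left_module_def
    by (simp add: D.holds_def r_ten_modass_def r_ten_modun_def)
  moreover have "right_comodule C H (M \<boxtimes> N) (tensor_coaction_op C H (M, \<rho>) (N, \<sigma>))"
    using D.ten_coass D.ten_coun h unfolding tc[symmetric] right_comodule_def
    by (simp add: D.holds_def r_ten_coass_def r_ten_coun_def)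
  ultimately show ?thesis
    using D.ten_yd unfolding yd_module_def yd_tensor_def prod.case ta[symmetric] tc[symmetric]
    by (simp add: D.holds_def r_ten_yd_def)
qed

lemma yd_tensor_assoc:
  assumes "YD (M, \<mu>, \<rho>)" "YD (N, \<nu>, \<sigma>)" "YD (P, \<pi>, \<tau>)"
  shows "ten (ten (M, \<mu>, \<rho>) (N, \<nu>, \<sigma>)) (P, \<pi>, \<tau>)
       = ten (M, \<mu>, \<rho>) (ten (N, \<nu>, \<sigma>) (P, \<pi>, \<tau>))"
proof -
  interpret D: yd_diagrams C "mods M N P" "acts \<mu> \<rho> \<nu> \<sigma> \<pi> \<tau>"
    by (rule yd_diagramsI assms)+
  note [simp] = objs tobj_assoc yd_homs(1)[OF assms(1)] yd_homs(1)[OF assms(2)] yd_homs(1)[OF assms(3)]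
  show ?thesis
    using D.ten_act_assoc D.ten_coact_assoc
    by (simp add: yd_tensor_def tensor_action_def tensor_coaction_op_def D.holds_def r_ten_act_assoc_def r_ten_coact_assoc_def)
qed

lemma yd_unit:
  assumes "YD (M, \<mu>, \<rho>)"
  shows "ten (\<I>, \<epsilon>\<^bsub>H\<^esub>, \<eta>\<^bsub>H\<^esub>) (M, \<mu>, \<rho>) = (M, \<mu>, \<rho>)" "ten (M, \<mu>, \<rho>) (\<I>, \<epsilon>\<^bsub>H\<^esub>, \<eta>\<^bsub>H\<^esub>) = (M, \<mu>, \<rho>)"
proof -
  interpret D: yd_diagrams C "mods M M M" "acts \<mu> \<rho> \<mu> \<rho> \<mu> \<rho>"
    by (rule yd_diagramsI assms)+
  note [simp] = objs tobj_assoc yd_homs(1)[OF assms(1)]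
  show "ten (\<I>, \<epsilon>\<^bsub>H\<^esub>, \<eta>\<^bsub>H\<^esub>) (M, \<mu>, \<rho>) = (M, \<mu>, \<rho>)" "ten (M, \<mu>, \<rho>) (\<I>, \<epsilon>\<^bsub>H\<^esub>, \<eta>\<^bsub>H\<^esub>) = (M, \<mu>, \<rho>)"
    using D.unit_act_left D.unit_act_right D.unit_coact_left D.unit_coact_right
    by (simp_all add: yd_tensor_def tensor_action_def tensor_coaction_op_def D.holds_def
        r_unit_act_left_def r_unit_act_right_def r_unit_coact_left_def r_unit_coact_right_def)
qed

lemma yd_unit_module: "YD (\<I>, \<epsilon>\<^bsub>H\<^esub>, \<eta>\<^bsub>H\<^esub>)"
proof -
  note [simp] = objs tobj_assoc
  note [simp] = tarr_unit_left[OF hom_arr[OF counit_hom]] tarr_unit_right[OF hom_arr[OF counit_hom]]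
    tarr_unit_left[OF hom_arr[OF unit_hom]] tarr_unit_right[OF hom_arr[OF unit_hom]]
    tarr_unit_left[OF hom_arr[OF mult_hom]] tarr_unit_right[OF hom_arr[OF mult_hom]]
    tarr_unit_left[OF hom_arr[OF comult_hom]] tarr_unit_right[OF hom_arr[OF comult_hom]]
  have a: "\<langle>ob H\<rangle> \<in> Hom (ob H) (ob H)" by (simp add: ident_hom)
  have e: "\<epsilon>\<^bsub>H\<^esub> \<cdot> (\<langle>ob H\<rangle> \<otimes> \<epsilon>\<^bsub>H\<^esub>) = \<epsilon>\<^bsub>H\<^esub> \<otimes> \<epsilon>\<^bsub>H\<^esub>"
    using interchange[OF a counit_hom counit_hom ident_hom[OF unit_obj]] cmp_ident_right[OF counit_hom] cmp_ident_left[OF counit_hom]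
    by simp
  have u: "(\<eta>\<^bsub>H\<^esub> \<otimes> \<langle>ob H\<rangle>) \<cdot> \<eta>\<^bsub>H\<^esub> = \<eta>\<^bsub>H\<^esub> \<otimes> \<eta>\<^bsub>H\<^esub>"
    using interchange[OF ident_hom[OF unit_obj] unit_hom unit_hom a] cmp_ident_right[OF unit_hom] cmp_ident_left[OF unit_hom]
    by simp
  interpret D: light_diagrams C baseO baseV
    by (rule light_diagramsI) simp_all
  have "left_module C H \<I> \<epsilon>\<^bsub>H\<^esub>" "right_comodule C H \<I> \<eta>\<^bsub>H\<^esub>"
    using counit_hom unit_hom by (simp_all add: left_module_def right_comodule_def counit_mult counit_unit comult_unit e u)
  moreover have "(\<langle>\<I>\<rangle> \<otimes> \<nabla>\<^bsub>H\<^esub>) \<cdot> (\<eta>\<^bsub>H\<^esub> \<otimes> \<langle>ob H\<rangle>) \<cdot> inv (\<Phi> \<I> (ob H)) \<cdot> (\<langle>ob H\<rangle> \<otimes> \<epsilon>\<^bsub>H\<^esub>) \<cdot> (\<Delta>\<^bsub>H\<^esub> \<otimes> \<langle>\<I>\<rangle>)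
      = (\<epsilon>\<^bsub>H\<^esub> \<otimes> \<nabla>\<^bsub>H\<^esub>) \<cdot> (\<langle>ob H\<rangle> \<otimes> \<Phi> (ob H) \<I> \<otimes> \<langle>ob H\<rangle>) \<cdot> (\<Delta>\<^bsub>H\<^esub> \<otimes> \<eta>\<^bsub>H\<^esub>)"
    using D.unit_yd by (simp add: D.holds_def r_unit_yd_def)
  ultimately show ?thesis
    by (simp add: yd_module_def)
qed

definition yd_mor :: "'o \<times> 'a \<times> 'a \<Rightarrow> 'o \<times> 'a \<times> 'a \<Rightarrow> 'a \<Rightarrow> bool" where
  "yd_mor = (\<lambda>(M, \<mu>, \<rho>) (N, \<nu>, \<sigma>) f. left_linear C H (M, \<mu>) (N, \<nu>) f \<and> right_colinear C H (M, \<rho>) (N, \<sigma>) f)"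

lemma yd_mor_hom: "yd_mor (M, \<mu>, \<rho>) (N, \<nu>, \<sigma>) f \<Longrightarrow> f \<in> Hom M N"
  by (simp add: yd_mor_def left_linear_def)

lemma yd_mor_ident: "YD (M, \<mu>, \<rho>) \<Longrightarrow> yd_mor (M, \<mu>, \<rho>) (M, \<mu>, \<rho>) \<langle>M\<rangle>"
  using yd_homs[of M \<mu> \<rho>] cmp_ident_left[of \<mu> "ob H \<boxtimes> M" M] cmp_ident_right[of \<mu> "ob H \<boxtimes> M" M]
    cmp_ident_left[of \<rho> M "M \<boxtimes> ob H"] cmp_ident_right[of \<rho> M "M \<boxtimes> ob H"]
  by (simp add: yd_mor_def left_linear_def right_colinear_def ident_hom tarr_ident ob_obj)

lemma yd_mor_cmp:
  assumes X: "YD (M, \<mu>, \<rho>)" and Y: "YD (N, \<nu>, \<sigma>)" and Z: "YD (P, \<pi>, \<tau>)"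
    and f: "yd_mor (M, \<mu>, \<rho>) (N, \<nu>, \<sigma>) f" and g: "yd_mor (N, \<nu>, \<sigma>) (P, \<pi>, \<tau>) g"
  shows "yd_mor (M, \<mu>, \<rho>) (P, \<pi>, \<tau>) (g \<cdot> f)"
proof -
  note fh = yd_mor_hom[OF f] and gh = yd_mor_hom[OF g]
  note x = yd_homs[OF X] and y = yd_homs[OF Y] and z = yd_homs[OF Z]
  have A: "\<langle>ob H\<rangle> \<in> Hom (ob H) (ob H)" by (simp add: ident_hom ob_obj)
  note Af = tarr_hom[OF A fh] and Ag = tarr_hom[OF A gh] and fA = tarr_hom[OF fh A] and gA = tarr_hom[OF gh A]
  have l: "f \<cdot> \<mu> = \<nu> \<cdot> (\<langle>ob H\<rangle> \<otimes> f)" "g \<cdot> \<nu> = \<pi> \<cdot> (\<langle>ob H\<rangle> \<otimes> g)" "\<sigma> \<cdot> f = (f \<otimes> \<langle>ob H\<rangle>) \<cdot> \<rho>" "\<tau> \<cdot> g = (g \<otimes> \<langle>ob H\<rangle>) \<cdot> \<sigma>"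
    using f g by (simp_all add: yd_mor_def left_linear_def right_colinear_def)
  have "(g \<cdot> f) \<cdot> \<mu> = \<pi> \<cdot> (\<langle>ob H\<rangle> \<otimes> (g \<cdot> f))"
    using cmp_assoc[OF x(2) fh gh] cmp_assoc[OF Af y(2) gh] cmp_assoc[OF Af Ag z(2)] l
      interchange[OF A A fh gh] cmp_ident_left[OF A] by simp
  moreover have "\<tau> \<cdot> (g \<cdot> f) = ((g \<cdot> f) \<otimes> \<langle>ob H\<rangle>) \<cdot> \<rho>"
    using cmp_assoc[OF fh gh z(3)] cmp_assoc[OF fh y(3) gA] cmp_assoc[OF x(3) fA gA] l
      interchange[OF fh gh A A] cmp_ident_left[OF A] by simp
  ultimately show ?thesis
    using cmp_hom[OF fh gh] by (simp add: yd_mor_def left_linear_def right_colinear_def)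
qed

text \<open>Linearity and colinearity pass to a two-sided inverse; this settles them for the inverse
  braiding \<open>dirb\<close> without further diagrams.\<close>

lemma yd_mor_inv:
  assumes X: "YD (M, \<mu>, \<rho>)" and Y: "YD (N, \<nu>, \<sigma>)"
    and f: "yd_mor (M, \<mu>, \<rho>) (N, \<nu>, \<sigma>) f" and g: "g \<in> Hom N M" "g \<cdot> f = \<langle>M\<rangle>" "f \<cdot> g = \<langle>N\<rangle>"
  shows "yd_mor (N, \<nu>, \<sigma>) (M, \<mu>, \<rho>) g"
proof -
  note fh = yd_mor_hom[OF f]
  note x = yd_homs[OF X] and y = yd_homs[OF Y]
  have A: "\<langle>ob H\<rangle> \<in> Hom (ob H) (ob H)" by (simp add: ident_hom ob_obj)
  note Af = tarr_hom[OF A fh] and Ag = tarr_hom[OF A g(1)] and fA = tarr_hom[OF fh A] and gA = tarr_hom[OF g(1) A]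
  have l: "f \<cdot> \<mu> = \<nu> \<cdot> (\<langle>ob H\<rangle> \<otimes> f)" "\<sigma> \<cdot> f = (f \<otimes> \<langle>ob H\<rangle>) \<cdot> \<rho>"
    using f by (simp_all add: yd_mor_def left_linear_def right_colinear_def)
  have 1: "(\<langle>ob H\<rangle> \<otimes> f) \<cdot> (\<langle>ob H\<rangle> \<otimes> g) = \<langle>ob H \<boxtimes> N\<rangle>" "(g \<otimes> \<langle>ob H\<rangle>) \<cdot> (f \<otimes> \<langle>ob H\<rangle>) = \<langle>M \<boxtimes> ob H\<rangle>"
    using interchange[OF A A g(1) fh] interchange[OF fh g(1) A A] g cmp_ident_left[OF A] x y by (simp_all add: tarr_ident ob_obj)
  have "g \<cdot> \<nu> = g \<cdot> ((\<nu> \<cdot> (\<langle>ob H\<rangle> \<otimes> f)) \<cdot> (\<langle>ob H\<rangle> \<otimes> g))"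
    using cmp_assoc[OF Ag Af y(2)] 1 cmp_ident_right[OF y(2)] by simp
  also have "\<dots> = ((g \<cdot> f) \<cdot> \<mu>) \<cdot> (\<langle>ob H\<rangle> \<otimes> g)"
    using l(1)[symmetric] cmp_assoc[OF Ag x(2) fh] cmp_assoc[OF cmp_hom[OF Ag x(2)] fh g(1)]
      cmp_assoc[OF x(2) fh g(1)] cmp_assoc[OF Ag cmp_hom[OF x(2) fh] g(1)] by simp
  also have "\<dots> = \<mu> \<cdot> (\<langle>ob H\<rangle> \<otimes> g)"
    using g(2) cmp_ident_left[OF x(2)] by simp
  finally have a: "g \<cdot> \<nu> = \<mu> \<cdot> (\<langle>ob H\<rangle> \<otimes> g)" .
  have "\<rho> \<cdot> g = ((g \<otimes> \<langle>ob H\<rangle>) \<cdot> (f \<otimes> \<langle>ob H\<rangle>)) \<cdot> (\<rho> \<cdot> g)"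
    using 1 cmp_ident_left[OF cmp_hom[OF g(1) x(3)]] by simp
  also have "\<dots> = (g \<otimes> \<langle>ob H\<rangle>) \<cdot> ((\<sigma> \<cdot> f) \<cdot> g)"
    using l(2) cmp_assoc[OF cmp_hom[OF g(1) x(3)] fA gA] cmp_assoc[OF g(1) x(3) fA] by simp
  also have "\<dots> = (g \<otimes> \<langle>ob H\<rangle>) \<cdot> \<sigma>"
    using cmp_assoc[OF g(1) fh y(3)] g(3) cmp_ident_right[OF y(3)] by simp
  finally show ?thesis
    using a g(1) by (simp add: yd_mor_def left_linear_def right_colinear_def)
qed

lemma yd_braiding_mor:
  assumes X: "YD (M, \<mu>, \<rho>)" and Y: "YD (N, \<nu>, \<sigma>)"
  shows "yd_mor (ten (M, \<mu>, \<rho>) (N, \<nu>, \<sigma>)) (ten (N, \<nu>, \<sigma>) (M, \<mu>, \<rho>)) (br (M, \<mu>, \<rho>) (N, \<nu>, \<sigma>))"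
    and "\<exists>g. yd_mor (ten (N, \<nu>, \<sigma>) (M, \<mu>, \<rho>)) (ten (M, \<mu>, \<rho>) (N, \<nu>, \<sigma>)) g
      \<and> g \<cdot> br (M, \<mu>, \<rho>) (N, \<nu>, \<sigma>) = \<langle>M \<boxtimes> N\<rangle> \<and> br (M, \<mu>, \<rho>) (N, \<nu>, \<sigma>) \<cdot> g = \<langle>N \<boxtimes> M\<rangle>"
proof -
  interpret D: yd_diagrams C "mods M N N" "acts \<mu> \<rho> \<nu> \<sigma> \<nu> \<sigma>"
    by (rule yd_diagramsI assms)+
  note [simp] = objs tobj_assoc yd_homs(1)[OF X] yd_homs(1)[OF Y]
  have b: "D.sem brd = br (M, \<mu>, \<rho>) (N, \<nu>, \<sigma>)"
    by (simp add: yd_braiding_def)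
  have h: "D.sem brd \<in> Hom (M \<boxtimes> N) (N \<boxtimes> M)" and g: "D.sem dirb \<in> Hom (N \<boxtimes> M) (M \<boxtimes> N)"
    using D.sem_hom[OF D.sig_yd yd_wf(3)] D.sem_hom[OF D.sig_yd yd_wf(4)] by simp_all
  show m: "yd_mor (ten (M, \<mu>, \<rho>) (N, \<nu>, \<sigma>)) (ten (N, \<nu>, \<sigma>) (M, \<mu>, \<rho>)) (br (M, \<mu>, \<rho>) (N, \<nu>, \<sigma>))"
    using D.braid_lin D.braid_colin h unfolding b[symmetric]
    by (simp add: yd_mor_def yd_tensor_def left_linear_def right_colinear_def tensor_action_def tensor_coaction_op_def
        D.holds_def r_braid_lin_def r_braid_colin_def)
  have i: "D.sem dirb \<cdot> br (M, \<mu>, \<rho>) (N, \<nu>, \<sigma>) = \<langle>M \<boxtimes> N\<rangle>" "br (M, \<mu>, \<rho>) (N, \<nu>, \<sigma>) \<cdot> D.sem dirb = \<langle>N \<boxtimes> M\<rangle>"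
    using D.braid_inv_left D.braid_inv_right unfolding b[symmetric] by (simp_all add: D.holds_def r_braid_inv_left_def r_braid_inv_right_def)
  have "yd_mor (ten (N, \<nu>, \<sigma>) (M, \<mu>, \<rho>)) (ten (M, \<mu>, \<rho>) (N, \<nu>, \<sigma>)) (D.sem dirb)"
    using yd_mor_inv[OF yd_tensor_module[OF X Y, unfolded yd_tensor_def prod.case] yd_tensor_module[OF Y X, unfolded yd_tensor_def prod.case]
      m[unfolded yd_tensor_def prod.case] g i] by (simp add: yd_tensor_def)
  then show "\<exists>g. yd_mor (ten (N, \<nu>, \<sigma>) (M, \<mu>, \<rho>)) (ten (M, \<mu>, \<rho>) (N, \<nu>, \<sigma>)) g
      \<and> g \<cdot> br (M, \<mu>, \<rho>) (N, \<nu>, \<sigma>) = \<langle>M \<boxtimes> N\<rangle> \<and> br (M, \<mu>, \<rho>) (N, \<nu>, \<sigma>) \<cdot> g = \<langle>N \<boxtimes> M\<rangle>"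
    using i by blast
qed

lemma yd_hexagons:
  assumes "YD (M, \<mu>, \<rho>)" "YD (N, \<nu>, \<sigma>)" "YD (P, \<pi>, \<tau>)"
  shows "br (M, \<mu>, \<rho>) (ten (N, \<nu>, \<sigma>) (P, \<pi>, \<tau>))
      = (\<langle>N\<rangle> \<otimes> br (M, \<mu>, \<rho>) (P, \<pi>, \<tau>)) \<cdot> (br (M, \<mu>, \<rho>) (N, \<nu>, \<sigma>) \<otimes> \<langle>P\<rangle>)"
    and "br (ten (M, \<mu>, \<rho>) (N, \<nu>, \<sigma>)) (P, \<pi>, \<tau>)
      = (br (M, \<mu>, \<rho>) (P, \<pi>, \<tau>) \<otimes> \<langle>N\<rangle>) \<cdot> (\<langle>M\<rangle> \<otimes> br (N, \<nu>, \<sigma>) (P, \<pi>, \<tau>))"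
proof -
  interpret D: yd_diagrams C "mods M N P" "acts \<mu> \<rho> \<nu> \<sigma> \<pi> \<tau>"
    by (rule yd_diagramsI assms)+
  note [simp] = objs tobj_assoc yd_homs(1)[OF assms(1)] yd_homs(1)[OF assms(2)] yd_homs(1)[OF assms(3)]
  show "br (M, \<mu>, \<rho>) (ten (N, \<nu>, \<sigma>) (P, \<pi>, \<tau>))
      = (\<langle>N\<rangle> \<otimes> br (M, \<mu>, \<rho>) (P, \<pi>, \<tau>)) \<cdot> (br (M, \<mu>, \<rho>) (N, \<nu>, \<sigma>) \<otimes> \<langle>P\<rangle>)"
    "br (ten (M, \<mu>, \<rho>) (N, \<nu>, \<sigma>)) (P, \<pi>, \<tau>)
      = (br (M, \<mu>, \<rho>) (P, \<pi>, \<tau>) \<otimes> \<langle>N\<rangle>) \<cdot> (\<langle>M\<rangle> \<otimes> br (N, \<nu>, \<sigma>) (P, \<pi>, \<tau>))"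
    using D.braid_hexR D.braid_hexL
    by (simp_all add: yd_braiding_def yd_tensor_def tensor_action_def tensor_coaction_op_def D.holds_def r_braid_hexR_def r_braid_hexL_def)
qed

lemma yd_morphism_diagramsI:
  assumes X: "YD (M, \<mu>, \<rho>)" and Y: "YD (N, \<nu>, \<sigma>)"
    and X': "YD (M', \<mu>', \<rho>')" and Y': "YD (N', \<nu>', \<sigma>')"
    and f: "yd_mor (M, \<mu>, \<rho>) (N, \<nu>, \<sigma>) f" and g: "yd_mor (M', \<mu>', \<rho>') (N', \<nu>', \<sigma>') g"
  shows "yd_morphism_diagrams C (baseO(2 := M, 3 := N, 4 := M', 5 := N'))
    (baseV(14 := \<mu>, 15 := \<rho>, 16 := \<nu>, 17 := \<sigma>, 18 := \<mu>', 19 := \<rho>', 20 := \<nu>', 21 := \<sigma>', 22 := f, 23 := g))"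
proof -
  note h = yd_homs[OF X] yd_homs[OF Y] yd_homs[OF X'] yd_homs[OF Y'] yd_mor_hom[OF f] yd_mor_hom[OF g]
  note [simp] = objs h
  interpret D: light_diagrams C "baseO(2 := M, 3 := N, 4 := M', 5 := N')"
    "baseV(14 := \<mu>, 15 := \<rho>, 16 := \<nu>, 17 := \<sigma>, 18 := \<mu>', 19 := \<rho>', 20 := \<nu>', 21 := \<sigma>', 22 := f, 23 := g)"
    by (rule light_diagramsI) simp_all
  show ?thesis
  proof
    show "D.sig_ok mor_gens"
      using D.sig_hopf by (auto simp: D.sig_ok_def mor_gens_def D.gok_def)
  qed (use f g in \<open>simp_all add: D.holds_def yd_mor_def left_linear_def right_colinear_def r_linf_def r_ling_def r_colf_def r_colg_def\<close>)
qed

lemma yd_mor_tensor: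
  assumes X: "YD (M, \<mu>, \<rho>)" and Y: "YD (N, \<nu>, \<sigma>)"
    and X': "YD (M', \<mu>', \<rho>')" and Y': "YD (N', \<nu>', \<sigma>')"
    and f: "yd_mor (M, \<mu>, \<rho>) (N, \<nu>, \<sigma>) f" and g: "yd_mor (M', \<mu>', \<rho>') (N', \<nu>', \<sigma>') g"
  shows "yd_mor (ten (M, \<mu>, \<rho>) (M', \<mu>', \<rho>')) (ten (N, \<nu>, \<sigma>) (N', \<nu>', \<sigma>')) (f \<otimes> g)"
    and "br (N, \<nu>, \<sigma>) (N', \<nu>', \<sigma>') \<cdot> (f \<otimes> g) = (g \<otimes> f) \<cdot> br (M, \<mu>, \<rho>) (M', \<mu>', \<rho>')"
proof -
  note h = yd_homs(1)[OF X] yd_homs(1)[OF Y] yd_homs(1)[OF X'] yd_homs(1)[OF Y']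
  note [simp] = objs h
  interpret D: yd_morphism_diagrams C "baseO(2 := M, 3 := N, 4 := M', 5 := N')"
    "baseV(14 := \<mu>, 15 := \<rho>, 16 := \<nu>, 17 := \<sigma>, 18 := \<mu>', 19 := \<rho>', 20 := \<nu>', 21 := \<sigma>', 22 := f, 23 := g)"
    by (rule yd_morphism_diagramsI assms)+
  show "yd_mor (ten (M, \<mu>, \<rho>) (M', \<mu>', \<rho>')) (ten (N, \<nu>, \<sigma>) (N', \<nu>', \<sigma>')) (f \<otimes> g)"
    using D.mor_lin D.mor_colin tarr_hom[OF yd_mor_hom[OF f] yd_mor_hom[OF g]]
    by (simp add: yd_mor_def yd_tensor_def left_linear_def right_colinear_def tensor_action_def tensor_coaction_op_def
        D.holds_def r_mor_lin_def r_mor_colin_def)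
  show "br (N, \<nu>, \<sigma>) (N', \<nu>', \<sigma>') \<cdot> (f \<otimes> g) = (g \<otimes> f) \<cdot> br (M, \<mu>, \<rho>) (M', \<mu>', \<rho>')"
    using D.braid_nat by (simp add: yd_braiding_def D.holds_def r_braid_nat_def)
qed

lemma fst_yd_tensor: "fst (ten X Y) = fst X \<boxtimes> fst Y"
  by (cases X; cases Y) (simp add: yd_tensor_def)

lemma yd_concrete:
  "concrete_braided C (Collect YD) fst yd_mor ten (\<I>, \<epsilon>\<^bsub>H\<^esub>, \<eta>\<^bsub>H\<^esub>) br"
  by (unfold_locales; auto simp: fst_yd_tensor yd_unit yd_unit_module yd_tensor_assoc yd_hexagons dest: yd_homs(1)
      intro: yd_mor_hom yd_mor_ident yd_mor_cmp yd_tensor_module yd_mor_tensor yd_braiding_mor)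

lemma yd_category_concrete:
  "yd_category C H = concrete_cat C (Collect YD) fst yd_mor ten (\<I>, \<epsilon>\<^bsub>H\<^esub>, \<eta>\<^bsub>H\<^esub>) br"
  by (auto simp: yd_category_def concrete_cat_def yd_mor_def)

subsection \<open>Modules over the Drinfel'd double\<close>

definition yd_star :: "'o \<Rightarrow> 'a \<Rightarrow> 'a" where
  "yd_star M \<rho> = (\<langle>M\<rangle> \<otimes> ev) \<cdot> (\<Phi> Hd M \<otimes> \<langle>ob H\<rangle>) \<cdot> (\<langle>Hd\<rangle> \<otimes> \<rho>)"

definition to_double :: "'o \<times> 'a \<times> 'a \<Rightarrow> 'o \<times> 'a" where
  "to_double = (\<lambda>(M, \<mu>, \<rho>). (M, yd_star M \<rho> \<cdot> (\<langle>Hd\<rangle> \<otimes> \<mu>)))"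

definition star_coaction :: "'o \<Rightarrow> 'a \<Rightarrow> 'a" where
  "star_coaction M s = \<Phi> (ob H) M \<cdot> (\<langle>ob H\<rangle> \<otimes> s) \<cdot> (coev \<otimes> \<langle>M\<rangle>)"

definition of_double :: "'o \<times> 'a \<Rightarrow> 'o \<times> 'a \<times> 'a" where
  "of_double X = (fst X, resH X, star_coaction (fst X) (resB X))"

lemma double_simps [simp]:
  "ob DH = Hd \<boxtimes> ob H" "\<eta>\<^bsub>DH\<^esub> = \<eta>\<^bsub>B\<^esub> \<otimes> \<eta>\<^bsub>H\<^esub>" "\<epsilon>\<^bsub>DH\<^esub> = \<epsilon>\<^bsub>B\<^esub> \<otimes> \<epsilon>\<^bsub>H\<^esub>"
  "\<Delta>\<^bsub>DH\<^esub> = (\<langle>Hd\<rangle> \<otimes> \<Phi> Hd (ob H) \<otimes> \<langle>ob H\<rangle>) \<cdot> (\<Delta>\<^bsub>B\<^esub> \<otimes> \<Delta>\<^bsub>H\<^esub>)"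
  "\<nabla>\<^bsub>DH\<^esub> = (\<nabla>\<^bsub>B\<^esub> \<otimes> \<nabla>\<^bsub>H\<^esub>)
       \<cdot> (\<langle>Hd\<rangle> \<otimes> la \<otimes> ra \<otimes> \<langle>ob H\<rangle>)
       \<cdot> (\<langle>Hd\<rangle> \<otimes> \<langle>ob H\<rangle> \<otimes> \<Phi> (ob H) Hd \<otimes> \<langle>Hd\<rangle> \<otimes> \<langle>ob H\<rangle>)
       \<cdot> (\<langle>Hd\<rangle> \<otimes> \<Delta>\<^bsub>H\<^esub> \<otimes> \<Delta>\<^bsub>B\<^esub> \<otimes> \<langle>ob H\<rangle>)"
  by (simp_all add: drinfeld_double_def)

lemma dual_yd_diagramsI:
  assumes "YD (M, \<mu>, \<rho>)" "YD (N, \<nu>, \<sigma>)" "YD (P, \<pi>, \<tau>)"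
  shows "dual_yd_diagrams C (mods M N P) (acts \<mu> \<rho> \<nu> \<sigma> \<pi> \<tau>)"
proof -
  note [simp] = yd_homs[OF assms(1)] yd_homs[OF assms(2)] yd_homs[OF assms(3)] tobj_unit_right ob_obj
  interpret D: yd_diagrams C "mods M N P" "acts \<mu> \<rho> \<nu> \<sigma> \<pi> \<tau>"
    by (rule yd_diagramsI assms)+
  interpret D: dual_diagrams C "mods M N P" "acts \<mu> \<rho> \<nu> \<sigma> \<pi> \<tau>"
    by (rule dual_diagramsI) simp_all
  show ?thesis
    by unfold_locales (use D.sig_dual in \<open>auto simp: D.sig_ok_def dual_yd_gens_def D.gok_def\<close>)
qed

lemma star_diagramsI:
  assumes M: "M \<in> Obj C" and m: "\<mu> \<in> Hom (ob H \<boxtimes> M) M" and s: "s \<in> Hom (Hd \<boxtimes> M) M"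
    and "\<mu> \<cdot> (\<nabla>\<^bsub>H\<^esub> \<otimes> \<langle>M\<rangle>) = \<mu> \<cdot> (\<langle>ob H\<rangle> \<otimes> \<mu>)" "\<mu> \<cdot> (\<eta>\<^bsub>H\<^esub> \<otimes> \<langle>M\<rangle>) = \<langle>M\<rangle>"
    and "s \<cdot> (\<nabla>\<^bsub>B\<^esub> \<otimes> \<langle>M\<rangle>) = s \<cdot> (\<langle>Hd\<rangle> \<otimes> s)" "s \<cdot> (\<eta>\<^bsub>B\<^esub> \<otimes> \<langle>M\<rangle>) = \<langle>M\<rangle>"
    and "\<mu> \<cdot> (\<langle>ob H\<rangle> \<otimes> s) = s \<cdot> (\<langle>Hd\<rangle> \<otimes> \<mu>) \<cdot> (((la \<otimes> ra)
      \<cdot> (\<langle>ob H\<rangle> \<otimes> \<Phi> (ob H) Hd \<otimes> \<langle>Hd\<rangle>) \<cdot> (\<Delta>\<^bsub>H\<^esub> \<otimes> \<Delta>\<^bsub>B\<^esub>)) \<otimes> \<langle>M\<rangle>)"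
  shows "star_diagrams C (baseO(2 := M)) (baseV(14 := \<mu>, 25 := s))"
proof -
  note [simp] = M m s tobj_unit_right ob_obj Hd_obj
  interpret D: dual_diagrams C "baseO(2 := M)" "baseV(14 := \<mu>, 25 := s)"
    by (rule dual_diagramsI) simp_all
  show ?thesis
  proof
    show "D.sig_ok star_gens"
      using D.sig_dual by (auto simp: D.sig_ok_def star_gens_def D.gok_def)
  qed (use assms in \<open>simp_all add: D.holds_def r_modass_M_def r_modun_M_def r_st_mul_def r_st_uni_def r_st_cross_def\<close>)
qed

lemma alpha_diagramsI:
  assumes "DM (M, \<alpha>)"
  shows "alpha_diagrams C (baseO(2 := M)) (baseV(24 := \<alpha>))"
proof -
  have a: "M \<in> Obj C" "\<alpha> \<in> Hom (Hd \<boxtimes> ob H \<boxtimes> M) M"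
    using assms by (auto simp: double_module_def left_module_def tobj_assoc ob_obj Hd_obj)
  note [simp] = a tobj_unit_right ob_obj Hd_obj
  interpret D: dual_diagrams C "baseO(2 := M)" "baseV(24 := \<alpha>)"
    by (rule dual_diagramsI) simp_all
  show ?thesis
  proof
    show "D.sig_ok alpha_gens"
      using D.sig_dual by (auto simp: D.sig_ok_def alpha_gens_def D.gok_def)
  qed (use assms in \<open>simp_all add: D.holds_def r_alp_mul_def r_alp_uni_def double_module_def left_module_def\<close>)
qed

lemma yd_star_diagrams:
  assumes X: "YD (M, \<mu>, \<rho>)"
  shows "star_diagrams C (baseO(2 := M)) (baseV(14 := \<mu>, 25 := yd_star M \<rho>))"
    and "star_coaction M (yd_star M \<rho>) = \<rho>"
proof -
  note [simp] = yd_homs[OF X] tobj_unit_right ob_obj Hd_obj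
  interpret D: dual_yd_diagrams C "mods M M M" "acts \<mu> \<rho> \<mu> \<rho> \<mu> \<rho>"
    by (rule dual_yd_diagramsI X)+
  have s: "D.sem starM = yd_star M \<rho>"
    by (simp add: yd_star_def)
  have "wf_expr dual_yd_gens starM"
    by code_simp
  from D.sem_hom[OF D.sig_dual_yd this] have h: "yd_star M \<rho> \<in> Hom (Hd \<boxtimes> M) M"
    by (simp add: yd_star_def)
  show "star_diagrams C (baseO(2 := M)) (baseV(14 := \<mu>, 25 := yd_star M \<rho>))"
    using D.modass_M D.modun_M D.star_mul D.star_uni D.star_cross
    by (intro star_diagramsI h)
      (simp_all add: yd_star_def D.holds_def r_modass_M_def r_modun_M_def r_star_mul_def r_star_uni_def r_star_cross_def)
  show "star_coaction M (yd_star M \<rho>) = \<rho>"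
    using D.coact_star by (simp add: star_coaction_def yd_star_def D.holds_def r_coact_star_def)
qed

lemma to_double:
  assumes X: "YD (M, \<mu>, \<rho>)"
  shows "DM (to_double (M, \<mu>, \<rho>))" "of_double (to_double (M, \<mu>, \<rho>)) = (M, \<mu>, \<rho>)"
    and "resH (to_double (M, \<mu>, \<rho>)) = \<mu>" "resB (to_double (M, \<mu>, \<rho>)) = yd_star M \<rho>"
proof -
  note [simp] = yd_homs[OF X] objs tobj_assoc
  interpret D: star_diagrams C "baseO(2 := M)" "baseV(14 := \<mu>, 25 := yd_star M \<rho>)"
    by (rule yd_star_diagrams X)+
  have "wf_expr star_gens alS"
    by code_simp
  from D.sem_hom[OF D.sig_star this] have "yd_star M \<rho> \<cdot> (\<langle>Hd\<rangle> \<otimes> \<mu>) \<in> Hom (Hd \<boxtimes> ob H \<boxtimes> M) M"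
    by simp
  then show "DM (to_double (M, \<mu>, \<rho>))"
    using D.al_mul D.al_uni by (simp add: to_double_def double_module_def left_module_def D.holds_def r_al_mul_def r_al_uni_def)
  show r: "resH (to_double (M, \<mu>, \<rho>)) = \<mu>" "resB (to_double (M, \<mu>, \<rho>)) = yd_star M \<rho>"
    using D.al_H D.al_B by (simp_all add: to_double_def restrict_to_H_def restrict_to_dual_def D.holds_def r_al_H_def r_al_B_def)
  show "of_double (to_double (M, \<mu>, \<rho>)) = (M, \<mu>, \<rho>)"
    using yd_star_diagrams(2)[OF X] by (simp add: of_double_def r) (simp add: to_double_def)
qed

lemma of_double:
  assumes X: "DM (M, \<alpha>)"
  shows "YD (of_double (M, \<alpha>))" "to_double (of_double (M, \<alpha>)) = (M, \<alpha>)"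
proof -
  interpret A: alpha_diagrams C "baseO(2 := M)" "baseV(24 := \<alpha>)"
    by (rule alpha_diagramsI X)+
  have M: "M \<in> Obj C"
    using X by (simp add: double_module_def left_module_def)
  note [simp] = M objs tobj_assoc
  define m where "m = resH (M, \<alpha>)"
  define s where "s = resB (M, \<alpha>)"
  have m': "A.sem actAl = m" and s': "A.sem starAl = s"
    by (simp_all add: m_def s_def restrict_to_H_def restrict_to_dual_def)
  have "wf_expr alpha_gens actAl" "wf_expr alpha_gens starAl"
    by code_simp+
  then have h: "m \<in> Hom (ob H \<boxtimes> M) M" "s \<in> Hom (Hd \<boxtimes> M) M"
    using A.sem_hom[OF A.sig_alpha, of actAl] A.sem_hom[OF A.sig_alpha, of starAl] unfolding m' s' by simp_all
  \<comment> \<open>The two restrictions form a compatible pair of actions, and the coaction is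
    built from this pair alone.\<close>
  interpret D: star_diagrams C "baseO(2 := M)" "baseV(14 := m, 25 := s)"
    using A.go_act A.go_actun A.go_star A.go_starun A.go_cross
    by (intro star_diagramsI h M)
      (simp_all add: A.holds_def r_go_act_def r_go_actun_def r_go_star_def r_go_starun_def r_go_cross_def
        m_def s_def restrict_to_H_def restrict_to_dual_def)
  have c: "D.sem coS = star_coaction M s"
    by (simp add: star_coaction_def)
  have "wf_expr star_gens coS"
    by code_simp
  from D.sem_hom[OF D.sig_star this] have ch: "star_coaction M s \<in> Hom M (M \<boxtimes> ob H)"
    by (simp add: star_coaction_def)
  have "left_module C H M m"
    using D.modass_M D.modun_M h by (simp add: left_module_def D.holds_def r_modass_M_def r_modun_M_def)
  moreover have "right_comodule C H M (star_coaction M s)"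
    using D.co_coass D.co_coun ch by (simp add: right_comodule_def D.holds_def r_co_coass_def r_co_coun_def star_coaction_def)
  ultimately show "YD (of_double (M, \<alpha>))"
    using D.co_yd by (simp add: of_double_def m_def[symmetric] s_def[symmetric] yd_module_def D.holds_def r_co_yd_def star_coaction_def)
  have "yd_star M (star_coaction M s) = s"
    using D.star_coG by (simp add: yd_star_def star_coaction_def D.holds_def r_star_coG_def)
  moreover have "\<alpha> = s \<cdot> (\<langle>Hd\<rangle> \<otimes> m)"
    using A.go_factor by (simp add: A.holds_def r_go_factor_def m_def s_def restrict_to_H_def restrict_to_dual_def)
  moreover have "of_double (M, \<alpha>) = (M, m, star_coaction M s)"
    by (simp add: of_double_def m_def s_def)
  ultimately show "to_double (of_double (M, \<alpha>)) = (M, \<alpha>)"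
    by (simp add: to_double_def)
qed

lemma fst_to_double: "fst (to_double X) = fst X"
  by (cases X) (simp add: to_double_def)

lemma to_double_mor:
  assumes X: "YD (M, \<mu>, \<rho>)" and Y: "YD (N, \<nu>, \<sigma>)"
  shows "left_linear C DH (to_double (M, \<mu>, \<rho>)) (to_double (N, \<nu>, \<sigma>)) f \<longleftrightarrow> yd_mor (M, \<mu>, \<rho>) (N, \<nu>, \<sigma>) f"
proof
  note [simp] = yd_homs[OF X] yd_homs[OF Y] objs tobj_assoc
  {
    assume f: "yd_mor (M, \<mu>, \<rho>) (N, \<nu>, \<sigma>) f"
    note [simp] = yd_mor_hom[OF f]
    interpret D: dual_diagrams C "baseO(2 := M, 3 := N)" "baseV(14 := \<mu>, 15 := \<rho>, 16 := \<nu>, 17 := \<sigma>, 22 := f)"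
      by (rule dual_diagramsI) simp_all
    interpret D: lin_diagrams C "baseO(2 := M, 3 := N)" "baseV(14 := \<mu>, 15 := \<rho>, 16 := \<nu>, 17 := \<sigma>, 22 := f)"
    proof
      show "D.sig_ok lin_gens"
        using D.sig_dual by (auto simp: D.sig_ok_def lin_gens_def D.gok_def)
    qed (use f in \<open>simp_all add: D.holds_def yd_mor_def left_linear_def right_colinear_def r_linf_def r_colf_def\<close>)
    show "left_linear C DH (to_double (M, \<mu>, \<rho>)) (to_double (N, \<nu>, \<sigma>)) f"
      using D.lin_al by (simp add: left_linear_def to_double_def yd_star_def D.holds_def r_lin_al_def)
  next
    assume f: "left_linear C DH (to_double (M, \<mu>, \<rho>)) (to_double (N, \<nu>, \<sigma>)) f"
    obtain \<alpha> \<beta> where a: "to_double (M, \<mu>, \<rho>) = (M, \<alpha>)" "to_double (N, \<nu>, \<sigma>) = (N, \<beta>)"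
      by (simp add: to_double_def)
    have h: "f \<in> Hom M N" "\<alpha> \<in> Hom (Hd \<boxtimes> ob H \<boxtimes> M) M" "\<beta> \<in> Hom (Hd \<boxtimes> ob H \<boxtimes> N) N"
      using f to_double(1)[OF X] to_double(1)[OF Y] by (auto simp: a left_linear_def double_module_def left_module_def)
    note [simp] = h
    interpret D: dual_diagrams C "baseO(2 := M, 3 := N)" "baseV(24 := \<alpha>, 26 := \<beta>, 22 := f)"
      by (rule dual_diagramsI) simp_all
    interpret D: alpha_lin_diagrams C "baseO(2 := M, 3 := N)" "baseV(24 := \<alpha>, 26 := \<beta>, 22 := f)"
    proof
      show "D.sig_ok alpha_lin_gens"
        using D.sig_dual by (auto simp: D.sig_ok_def alpha_lin_gens_def D.gok_def)
    qed (use f in \<open>simp_all add: D.holds_def left_linear_def a r_alf_def\<close>)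
    \<comment> \<open>Action and coaction are recovered from \<open>\<alpha>\<close> and
      \<open>\<beta>\<close> as in \<open>of_double\<close>. Being composed from these with units,
      \<open>coev\<close> and crossings, they are respected by every map that is linear over the
      double.\<close>
    have r: "\<alpha> \<cdot> (\<eta>\<^bsub>B\<^esub> \<otimes> \<langle>ob H\<rangle> \<otimes> \<langle>M\<rangle>) = \<mu>" "\<beta> \<cdot> (\<eta>\<^bsub>B\<^esub> \<otimes> \<langle>ob H\<rangle> \<otimes> \<langle>N\<rangle>) = \<nu>"
      "\<Phi> (ob H) M \<cdot> (\<langle>ob H\<rangle> \<otimes> (\<alpha> \<cdot> (\<langle>Hd\<rangle> \<otimes> \<eta>\<^bsub>H\<^esub> \<otimes> \<langle>M\<rangle>))) \<cdot> (coev \<otimes> \<langle>M\<rangle>) = \<rho>"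
      "\<Phi> (ob H) N \<cdot> (\<langle>ob H\<rangle> \<otimes> (\<beta> \<cdot> (\<langle>Hd\<rangle> \<otimes> \<eta>\<^bsub>H\<^esub> \<otimes> \<langle>N\<rangle>))) \<cdot> (coev \<otimes> \<langle>N\<rangle>) = \<sigma>"
      using to_double(2)[OF X] to_double(2)[OF Y]
      by (simp_all add: a of_double_def restrict_to_H_def restrict_to_dual_def star_coaction_def)
    have "f \<cdot> \<alpha> \<cdot> (\<eta>\<^bsub>B\<^esub> \<otimes> \<langle>ob H\<rangle> \<otimes> \<langle>M\<rangle>) = (\<beta> \<cdot> (\<eta>\<^bsub>B\<^esub> \<otimes> \<langle>ob H\<rangle> \<otimes> \<langle>N\<rangle>)) \<cdot> (\<langle>ob H\<rangle> \<otimes> f)"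
      using D.lin_H by (simp add: D.holds_def r_lin_H_def)
    then have "f \<cdot> \<mu> = \<nu> \<cdot> (\<langle>ob H\<rangle> \<otimes> f)"
      by (simp add: r)
    moreover have "\<sigma> \<cdot> f = (f \<otimes> \<langle>ob H\<rangle>) \<cdot> \<rho>"
      using D.colin_B by (simp add: D.holds_def r_colin_B_def r)
    ultimately show "yd_mor (M, \<mu>, \<rho>) (N, \<nu>, \<sigma>) f"
      by (simp add: yd_mor_def left_linear_def right_colinear_def)
  }
qed

lemma to_double_tensor:
  assumes X: "YD (M, \<mu>, \<rho>)" and Y: "YD (N, \<nu>, \<sigma>)"
  shows "double_tensor C H Hd ev (to_double (M, \<mu>, \<rho>)) (to_double (N, \<nu>, \<sigma>)) = to_double (ten (M, \<mu>, \<rho>) (N, \<nu>, \<sigma>))"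
    and "double_braiding C H Hd ev coev (to_double (M, \<mu>, \<rho>)) (to_double (N, \<nu>, \<sigma>)) = br (M, \<mu>, \<rho>) (N, \<nu>, \<sigma>)"
proof -
  note [simp] = yd_homs(1)[OF X] yd_homs(1)[OF Y] objs tobj_assoc
  interpret D: dual_yd_diagrams C "mods M N N" "acts \<mu> \<rho> \<nu> \<sigma> \<nu> \<sigma>"
    by (rule dual_yd_diagramsI assms)+
  show "double_tensor C H Hd ev (to_double (M, \<mu>, \<rho>)) (to_double (N, \<nu>, \<sigma>)) = to_double (ten (M, \<mu>, \<rho>) (N, \<nu>, \<sigma>))"
    using D.al_tensor by (simp add: double_tensor_def to_double_def yd_star_def yd_tensor_def tensor_action_def tensor_coaction_op_def
        D.holds_def r_al_tensor_def)
  show "double_braiding C H Hd ev coev (to_double (M, \<mu>, \<rho>)) (to_double (N, \<nu>, \<sigma>)) = br (M, \<mu>, \<rho>) (N, \<nu>, \<sigma>)"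
    using D.al_braid unfolding double_braiding_def to_double(3)[OF X] to_double(4)[OF Y]
    by (simp add: to_double_def yd_star_def yd_braiding_def D.holds_def r_al_braid_def)
qed

lemma to_double_unit: "(\<I>, \<epsilon>\<^bsub>DH\<^esub>) = to_double (\<I>, \<epsilon>\<^bsub>H\<^esub>, \<eta>\<^bsub>H\<^esub>)"
proof -
  note [simp] = tobj_unit_right unit_obj ob_obj Hd_obj
  interpret D: dual_yd_diagrams C "mods \<I> \<I> \<I>"
    "acts \<epsilon>\<^bsub>H\<^esub> \<eta>\<^bsub>H\<^esub> \<epsilon>\<^bsub>H\<^esub> \<eta>\<^bsub>H\<^esub> \<epsilon>\<^bsub>H\<^esub> \<eta>\<^bsub>H\<^esub>"
    by (rule dual_yd_diagramsI yd_unit_module)+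
  show ?thesis
    using D.al_unit by (simp add: to_double_def yd_star_def D.holds_def r_al_unit_def)
qed

lemma double_category_concrete:
  "double_module_category C H Hd ev coev = concrete_cat C (Collect DM) fst (left_linear C DH)
     (double_tensor C H Hd ev) (\<I>, \<epsilon>\<^bsub>DH\<^esub>) (double_braiding C H Hd ev coev)"
  by (auto simp: double_module_category_def concrete_cat_def)

theorem isomorphic_categories:
  "isomorphic_braided_categories (yd_category C H) (double_module_category C H Hd ev coev)"
proof -
  interpret Y: concrete_braided C "Collect YD" fst yd_mor ten "(\<I>, \<epsilon>\<^bsub>H\<^esub>, \<eta>\<^bsub>H\<^esub>)" br
    by (rule yd_concrete)
  show ?thesis
    unfolding yd_category_concrete double_category_concrete
    by (rule Y.isomorphic_concrete[where F = to_double and G = of_double, OF _ _ _ _ _ _ _ to_double_unit])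
      (auto simp: to_double of_double to_double_mor to_double_tensor fst_to_double)
qed

end

theorem proposition5p1:
  fixes C :: "('o, 'a) braided_cat"
    and H :: "('o, 'a) hopf_data"
    and Hd HH :: 'o
    and ev evH :: 'a
  assumes "strict_braided_category C"
    and "hopf_algebra C H"
    and "finite_object C (ob H) Hd ev HH evH"
    and "is_iso C (antipode H)"
    and "\<And>M \<mu> \<rho>. (M, \<mu>, \<rho>) \<in> Obj (yd_category C H)
           \<Longrightarrow> braid C (ob H) M = arr_inv C (braid C M (ob H))"
  shows "isomorphic_braided_categories
           (yd_category C H)
           (double_module_category C H Hd ev (dual_basis C (ob H) Hd ev HH evH))"
proof -
  have "double_setting C H Hd HH ev evH"
    unfolding double_setting_def double_setting_axioms_def
    using assms by (simp add: yd_category_def)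
  then show ?thesis
    by (rule double_setting.isomorphic_categories)
qed

end
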